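(* Let $\tau\in\mathbf C$, $\tau\neq2$. Suppose that a $\tau$-representation $\rho:\Gamma\to\mathrm{SL}(2,\mathbf C)$ is stabilized by a hyperbolic element $H\in\mathrm{SL}(2,\mathbf Z)\cong\mathcal{MCG}$ and that $\rho$ satisfies the BQ-conditions on $\hat\Omega/\langle H_*\rangle$, that is, (i) $\mathrm{tr}\,\rho([g])\notin[-2,2]$ for all classes $[g]\in\hat\Omega/\langle H_*\rangle$, and (ii) $|\mathrm{tr}\,\rho([g])|\le2$ for only finitely many (possibly no) classes $[g]\in\hat\Omega/\langle H_*\rangle$. Then $$\sum_{[g]\in\hat\Omega/\langle H_*\rangle}\mathfrak h_\tau\big(\mathrm{tr}\,\rho([g])\big)=0\mod 2\pi i,$$ where the sum converges absolutely.
   Context: $\Gamma=\langle a,b\rangle$ is the free group of rank two, the fundamental group of a once-punctured torus $\mathbb T$. On $\Gamma$ let $g\sim h$ iff $g$ is conjugate to $h$ or $h^{-1}$; $\hat\Omega\subset\Gamma/\!\sim$ is the set of classes corresponding to non-trivial, non-peripheral simple closed curves on $\mathbb T$ (equivalently, classes of elements belonging to a free basis). A $\tau$-representation is a homomorphism $\rho:\Gamma\to\mathrm{SL}(2,\mathbf C)$ with $\mathrm{tr}\,\rho(aba^{-1}b^{-1})=\tau$. $\mathcal{MCG}\cong\mathrm{SL}(2,\mathbf Z)$ is the mapping class group of $\mathbb T$. Each $H\in\mathcal{MCG}$ induces an automorphism $H_*$ of $\Gamma$ (well defined up to inner automorphisms), hence a permutation of $\hat\Omega$, and acts on conjugacy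 classes of $\tau$-representations by $H(\rho)(g)=\rho(H_*(g))$. "$\rho$ is stabilized by $H$" means $H(\rho)$ is conjugate to $\rho$; then $\mathrm{tr}\,\rho$ is well defined on the set $\hat\Omega/\langle H_*\rangle$ of orbits of the cyclic group generated by $H_*$. $H\in\mathrm{SL}(2,\mathbf Z)$ is hyperbolic if $|\mathrm{tr}\,H|>2$. Conventions: $\cosh^{-1}$ takes values with nonnegative real part and imaginary part in $(-\pi,\pi]$ (and, when the real part is $0$, nonnegative imaginary part); $\log$ takes values with imaginary part in $(-\pi,\pi]$. For $x\in\mathbf C$, $l(x)=2\cosh^{-1}(x/2)$, so $e^{l(x)}$ is well defined. With $\nu=\cosh^{-1}(-\tau/2)$, the function $\mathfrak h_\tau:\mathbf C\setminus\{\pm\sqrt{\tau+2}\}\to\mathbf C$ is $$\mathfrak h_\tau(x)=\log\frac{e^{\nu}+e^{l(x)}}{e^{-\nu}+e^{l(x)}}.$$ *)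

theory Defs
  imports
    "HOL-Analysis.Analysis"
    "HOL-Algebra.Generated_Groups"
    "HOL-Algebra.Bij"
    "HOL-Algebra.Group_Action"
begin

section \<open>Free bases\<close>

text \<open>A word is a list of letters \<open>(x, e)\<close>, standing for \<open>x\<close> if \<open>e\<close> is true and for the inverse
  of \<open>x\<close> otherwise.\<close>

definition word_val :: "('g, 'm) monoid_scheme \<Rightarrow> ('g \<times> bool) list \<Rightarrow> 'g" where
  "word_val G w =
     foldr (\<lambda>(x, e) y. (if e then x else inv\<^bsub>G\<^esub> x) \<otimes>\<^bsub>G\<^esub> y) w \<one>\<^bsub>G\<^esub>"

definition reduced_word :: "('g \<times> bool) list \<Rightarrow> bool" where
  "reduced_word w \<longleftrightarrow> successively (\<lambda>(x, e) (y, d). \<not> (x = y \<and> e \<noteq> d)) w"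

definition free_basis :: "('g, 'm) monoid_scheme \<Rightarrow> 'g set \<Rightarrow> bool" where
  "free_basis G X \<longleftrightarrow>
     X \<subseteq> carrier G \<and> generate G X = carrier G \<and>
     (\<forall>w. fst ` set w \<subseteq> X \<and> reduced_word w \<and> w \<noteq> [] \<longrightarrow> word_val G w \<noteq> \<one>\<^bsub>G\<^esub>)"

section \<open>Classes of simple closed curves\<close>

definition curve_rel :: "('g, 'm) monoid_scheme \<Rightarrow> ('g \<times> 'g) set" where
  "curve_rel G = {(g, h). g \<in> carrier G \<and> h \<in> carrier G \<and>
     (\<exists>k\<in>carrier G. g = k \<otimes>\<^bsub>G\<^esub> h \<otimes>\<^bsub>G\<^esub> inv\<^bsub>G\<^esub> k \<or>
                    g = k \<otimes>\<^bsub>G\<^esub> inv\<^bsub>G\<^esub> h \<otimes>\<^bsub>G\<^esub> inv\<^bsub>G\<^esub> k)}"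

text \<open>For the free group of rank two, the fundamental group of a once-punctured torus, these are the
  classes of the essential (non-trivial and non-peripheral) simple closed curves.\<close>

definition curve_classes :: "('g, 'm) monoid_scheme \<Rightarrow> 'g set set" where
  "curve_classes G = {C \<in> carrier G // curve_rel G. \<exists>g\<in>C. \<exists>X. free_basis G X \<and> g \<in> X}"

section \<open>Mapping classes\<close>

text \<open>\<open>SL(2, \<int>)\<close> is identified with the mapping class group of the once-punctured torus through the
  action on first homology, the abelianization of \<open>\<langle>a, b\<rangle>\<close>, written in the basis \<open>a, b\<close> (so the
  columns of \<open>H\<close> are the images of \<open>a\<close> and \<open>b\<close>).  The automorphisms induced by the mapping class
  \<open>H\<close> are then exactly those that act on the abelianization by the matrix \<open>H\<close>; any two of them differ
  by an inner automorphism.\<close>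

definition induced_by ::
    "('g, 'm) monoid_scheme \<Rightarrow> 'g \<Rightarrow> 'g \<Rightarrow> int ^ 2 ^ 2 \<Rightarrow> ('g \<Rightarrow> 'g) \<Rightarrow> bool" where
  "induced_by G a b H f \<longleftrightarrow> f \<in> auto G \<and>
     f a \<in> derived G (carrier G) #>\<^bsub>G\<^esub> (a [^]\<^bsub>G\<^esub> (H $ 1 $ 1) \<otimes>\<^bsub>G\<^esub> b [^]\<^bsub>G\<^esub> (H $ 2 $ 1)) \<and>
     f b \<in> derived G (carrier G) #>\<^bsub>G\<^esub> (a [^]\<^bsub>G\<^esub> (H $ 1 $ 2) \<otimes>\<^bsub>G\<^esub> b [^]\<^bsub>G\<^esub> (H $ 2 $ 2))"

definition hyperbolic :: "int ^ 2 ^ 2 \<Rightarrow> bool" where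
  "hyperbolic H \<longleftrightarrow> \<bar>trace H\<bar> > 2"

definition curve_orbits :: "('g, 'm) monoid_scheme \<Rightarrow> ('g \<Rightarrow> 'g) \<Rightarrow> 'g set set set" where
  "curve_orbits G f =
     orbits (subgroup_generated (AutoGroup G) {f}) (curve_classes G) (\<lambda>h C. h ` C)"

section \<open>Representations\<close>

definition SL2C :: "(complex ^ 2 ^ 2) monoid" where
  "SL2C = \<lparr>carrier = {A. det A = 1}, mult = (**), one = mat 1\<rparr>"

lemma group_SL2C: "group SL2C"
proof (rule groupI)
  fix A assume "A \<in> carrier SL2C"
  then have d: "det A = 1" by (simp add: SL2C_def)
  then have "invertible A" by (simp add: invertible_det_nz)
  then obtain B where B: "B ** A = mat 1" by (auto simp: invertible_def)
  then have "det B * det A = 1" by (metis det_mul det_I)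
  with d B show "\<exists>B\<in>carrier SL2C. B \<otimes>\<^bsub>SL2C\<^esub> A = \<one>\<^bsub>SL2C\<^esub>"
    by (auto simp: SL2C_def)
qed (auto simp: SL2C_def det_mul matrix_mul_assoc)

definition tau_rep ::
    "('g, 'm) monoid_scheme \<Rightarrow> 'g \<Rightarrow> 'g \<Rightarrow> complex \<Rightarrow> ('g \<Rightarrow> complex ^ 2 ^ 2) \<Rightarrow> bool" where
  "tau_rep G a b \<tau> \<rho> \<longleftrightarrow> \<rho> \<in> hom G SL2C \<and>
     trace (\<rho> (a \<otimes>\<^bsub>G\<^esub> b \<otimes>\<^bsub>G\<^esub> inv\<^bsub>G\<^esub> a \<otimes>\<^bsub>G\<^esub> inv\<^bsub>G\<^esub> b)) = \<tau>"

definition conjugate_reps ::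
    "('g, 'm) monoid_scheme \<Rightarrow> ('g \<Rightarrow> complex ^ 2 ^ 2) \<Rightarrow> ('g \<Rightarrow> complex ^ 2 ^ 2) \<Rightarrow> bool" where
  "conjugate_reps G \<rho> \<rho>' \<longleftrightarrow>
     (\<exists>P\<in>carrier SL2C. \<forall>g\<in>carrier G. \<rho>' g = P \<otimes>\<^bsub>SL2C\<^esub> \<rho> g \<otimes>\<^bsub>SL2C\<^esub> inv\<^bsub>SL2C\<^esub> P)"

definition stabilized_by ::
    "('g, 'm) monoid_scheme \<Rightarrow> ('g \<Rightarrow> complex ^ 2 ^ 2) \<Rightarrow> ('g \<Rightarrow> 'g) \<Rightarrow> bool" where
  "stabilized_by G \<rho> f \<longleftrightarrow> conjugate_reps G \<rho> (\<lambda>g. \<rho> (f g))"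

text \<open>The common value of \<open>trace (\<rho> g)\<close> over all elements of all classes in the orbit \<open>X\<close>; see
  \<open>orbit_trace_eq\<close> below.\<close>

definition orbit_trace :: "('g \<Rightarrow> complex ^ 2 ^ 2) \<Rightarrow> 'g set set \<Rightarrow> complex" where
  "orbit_trace \<rho> X = (THE t. \<forall>C\<in>X. \<forall>g\<in>C. trace (\<rho> g) = t)"

lemma trace_conj_SL2C:
  assumes P: "P \<in> carrier SL2C" and A: "A \<in> carrier SL2C"
  shows "trace (P \<otimes>\<^bsub>SL2C\<^esub> A \<otimes>\<^bsub>SL2C\<^esub> inv\<^bsub>SL2C\<^esub> P) = trace A"
proof -
  interpret S: group SL2C by (rule group_SL2C)
  have "trace (P \<otimes>\<^bsub>SL2C\<^esub> A \<otimes>\<^bsub>SL2C\<^esub> inv\<^bsub>SL2C\<^esub> P) = trace (inv\<^bsub>SL2C\<^esub> P \<otimes>\<^bsub>SL2C\<^esub> (P \<otimes>\<^bsub>SL2C\<^esub> A))"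
    using trace_mul_sym[of "P \<otimes>\<^bsub>SL2C\<^esub> A" "inv\<^bsub>SL2C\<^esub> P"] by (simp only: SL2C_def monoid.simps)
  also have "inv\<^bsub>SL2C\<^esub> P \<otimes>\<^bsub>SL2C\<^esub> (P \<otimes>\<^bsub>SL2C\<^esub> A) = A"
    using P A by (simp add: S.m_assoc[symmetric])
  finally show ?thesis .
qed

lemma trace_inv_SL2C:
  assumes A: "A \<in> carrier SL2C"
  shows "trace (inv\<^bsub>SL2C\<^esub> A) = trace A"
proof -
  interpret S: group SL2C by (rule group_SL2C)
  define B :: "complex ^ 2 ^ 2" where
    "B = vector [vector [A $ 2 $ 2, - (A $ 1 $ 2)], vector [- (A $ 2 $ 1), A $ 1 $ 1]]"
  have dA: "A $ 1 $ 1 * A $ 2 $ 2 - A $ 1 $ 2 * A $ 2 $ 1 = 1"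
    using A by (simp add: SL2C_def det_2)
  have "det B = 1"
    unfolding det_2 B_def vector_2 using dA by (metis (no_types) minus_mult_minus mult.commute)
  then have "B \<in> carrier SL2C"
    by (simp add: SL2C_def)
  moreover have "B ** A = mat 1"
    unfolding matrix_matrix_mult_def mat_def vec_eq_iff forall_2 sum_2 B_def vector_2 vec_lambda_beta
    using dA by (simp add: mult.commute)
  then have "B \<otimes>\<^bsub>SL2C\<^esub> A = \<one>\<^bsub>SL2C\<^esub>"
    by (simp add: SL2C_def)
  ultimately have "inv\<^bsub>SL2C\<^esub> A = B" using A by (metis S.inv_equality)
  then show ?thesis by (simp add: trace_def B_def sum_2)
qed

lemma trace_curve_rel:
  assumes G: "group G" and \<rho>: "\<rho> \<in> hom G SL2C" and gh: "(g, h) \<in> curve_rel G"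
  shows "trace (\<rho> g) = trace (\<rho> h)"
proof -
  interpret group_hom G SL2C \<rho>
    using G \<rho> group_SL2C by (simp add: group_hom_def group_hom_axioms_def)
  from gh obtain k where k: "k \<in> carrier G" "g \<in> carrier G" "h \<in> carrier G"
    and "g = k \<otimes>\<^bsub>G\<^esub> h \<otimes>\<^bsub>G\<^esub> inv\<^bsub>G\<^esub> k \<or> g = k \<otimes>\<^bsub>G\<^esub> inv\<^bsub>G\<^esub> h \<otimes>\<^bsub>G\<^esub> inv\<^bsub>G\<^esub> k"
    unfolding curve_rel_def by auto
  then show ?thesis
    by (elim disjE) (simp_all add: trace_conj_SL2C trace_inv_SL2C)
qed

lemma equiv_curve_rel:
  fixes G (structure)
  assumes "group G"
  shows "equiv (carrier G) (curve_rel G)"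
proof -
  interpret group G by fact
  have A: "(h, g) \<in> curve_rel G" if "(g, h) \<in> curve_rel G" for g h
  proof -
    from that obtain k where k: "k \<in> carrier G" "g \<in> carrier G" "h \<in> carrier G"
    and d: "g = k \<otimes>\<^bsub>G\<^esub> h \<otimes>\<^bsub>G\<^esub> inv\<^bsub>G\<^esub> k \<or> g = k \<otimes>\<^bsub>G\<^esub> inv\<^bsub>G\<^esub> h \<otimes>\<^bsub>G\<^esub> inv\<^bsub>G\<^esub> k"
      unfolding curve_rel_def by auto
    have c: "inv k \<otimes> (k \<otimes> z) = z" if "z \<in> carrier G" for z
      using that k by (simp add: m_assoc[symmetric])
    have 1: "h = inv k \<otimes> g \<otimes> inv (inv k)" if "g = k \<otimes> h \<otimes> inv k"
      using that k by (simp add: m_assoc c)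
    have 2: "h = inv k \<otimes> inv g \<otimes> inv (inv k)" if "g = k \<otimes> inv h \<otimes> inv k"
      using that k by (simp add: m_assoc inv_mult_group c)
    have "inv k \<in> carrier G" using k by simp
    with 1 2 d k show ?thesis unfolding curve_rel_def by blast
  qed
  have B: "(g, h) \<in> curve_rel G" if "(g, l) \<in> curve_rel G" "(l, h) \<in> curve_rel G" for g l h
  proof -
    from that obtain k k' where k: "k \<in> carrier G" "k' \<in> carrier G" "g \<in> carrier G" "h \<in> carrier G" "l \<in> carrier G"
    and d: "g = k \<otimes> l \<otimes> inv k \<or> g = k \<otimes> inv l \<otimes> inv k"
    and d': "l = k' \<otimes> h \<otimes> inv k' \<or> l = k' \<otimes> inv h \<otimes> inv k'"
      unfolding curve_rel_def by auto
    have "k \<otimes> (k' \<otimes> h \<otimes> inv k') \<otimes> inv k = (k \<otimes> k') \<otimes> h \<otimes> inv (k \<otimes> k')"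
      "k \<otimes> (k' \<otimes> inv h \<otimes> inv k') \<otimes> inv k = (k \<otimes> k') \<otimes> inv h \<otimes> inv (k \<otimes> k')"
      "k \<otimes> inv (k' \<otimes> h \<otimes> inv k') \<otimes> inv k = (k \<otimes> k') \<otimes> inv h \<otimes> inv (k \<otimes> k')"
      "k \<otimes> inv (k' \<otimes> inv h \<otimes> inv k') \<otimes> inv k = (k \<otimes> k') \<otimes> h \<otimes> inv (k \<otimes> k')"
      using k by (simp_all add: m_assoc inv_mult_group)
    then have "g = (k \<otimes> k') \<otimes> h \<otimes> inv (k \<otimes> k') \<or>
        g = (k \<otimes> k') \<otimes> inv h \<otimes> inv (k \<otimes> k')"
      using d d' by metis
    moreover have "k \<otimes> k' \<in> carrier G" using k by simp
    ultimately show ?thesis using k unfolding curve_rel_def by blast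
  qed
  have C: "(g, g) \<in> curve_rel G" if "g \<in> carrier G" for g
    using that unfolding curve_rel_def by (auto intro!: bexI[of _ "\<one>"])
  show ?thesis
  proof (rule equivI)
    show "curve_rel G \<subseteq> carrier G \<times> carrier G" by (auto simp: curve_rel_def)
    show "refl_on (carrier G) (curve_rel G)" using C by (simp add: refl_on_def)
    show "sym (curve_rel G)" using A by (rule symI)
    show "trans (curve_rel G)" using B by (rule transI)
  qed
qed

lemma generated_auto_trace:
  assumes G: "group G" and f: "f \<in> auto G" and \<rho>: "\<rho> \<in> hom G SL2C" and s: "stabilized_by G \<rho> f"
    and h: "h \<in> carrier (subgroup_generated (AutoGroup G) {f})"
  shows "h \<in> auto G \<and> (\<forall>g\<in>carrier G. trace (\<rho> (h g)) = trace (\<rho> g))"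
proof -
  interpret group G by fact
  interpret A: group "AutoGroup G" by (rule AutoGroup)
  have cA: "carrier (AutoGroup G) = auto G" by (simp add: AutoGroup_def)
  have cl: "k g \<in> carrier G" if "k \<in> auto G" "g \<in> carrier G" for k g
    using that by (auto simp: auto_def hom_def)
  have tf: "trace (\<rho> (f g)) = trace (\<rho> g)" if g: "g \<in> carrier G" for g
  proof -
    from s obtain P where "P \<in> carrier SL2C"
      "\<rho> (f g) = P \<otimes>\<^bsub>SL2C\<^esub> \<rho> g \<otimes>\<^bsub>SL2C\<^esub> inv\<^bsub>SL2C\<^esub> P"
      using g unfolding stabilized_by_def conjugate_reps_def by blast
    moreover have "\<rho> g \<in> carrier SL2C" using \<rho> g by (auto simp: hom_def)
    ultimately show ?thesis by (simp add: trace_conj_SL2C)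
  qed
  have mult: "(k \<otimes>\<^bsub>AutoGroup G\<^esub> l) g = k (l g)" if "k \<in> auto G" "l \<in> auto G" "g \<in> carrier G" for k l g
    using that by (simp add: AutoGroup_def BijGroup_def auto_def compose_def)
  have one': "\<one>\<^bsub>AutoGroup G\<^esub> g = g" if "g \<in> carrier G" for g
    using that by (simp add: AutoGroup_def BijGroup_def)
  have "h \<in> generate (AutoGroup G) {f}"
    using h f cA by (simp add: carrier_subgroup_generated)
  then show ?thesis
  proof (induction rule: generate.induct)
    case one
    then show ?case using A.one_closed cA one' by simp
  next
    case (incl h) then show ?case using f tf by simp
  next
    case (inv h)
    then have hf: "h = f" by simp
    have i: "inv\<^bsub>AutoGroup G\<^esub> f \<in> auto G" using A.inv_closed f cA by simp
    have "trace (\<rho> ((inv\<^bsub>AutoGroup G\<^esub> f) g)) = trace (\<rho> g)" if g: "g \<in> carrier G" for g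
    proof -
      have "f ((inv\<^bsub>AutoGroup G\<^esub> f) g) = g"
        using mult[OF f i g] one'[OF g] A.r_inv f cA by simp
      then show ?thesis using tf[OF cl[OF i g]] by simp
    qed
    then show ?case using i hf by simp
  next
    case (eng h1 h2)
    then show ?case using A.m_closed cA mult cl by auto
  qed
qed

lemma orbit_trace_eq:
  assumes G: "group G" and f: "f \<in> auto G" and \<rho>: "\<rho> \<in> hom G SL2C" and s: "stabilized_by G \<rho> f"
    and X: "X \<in> curve_orbits G f" and C: "C \<in> X" and g: "g \<in> C"
  shows "orbit_trace \<rho> X = trace (\<rho> g)"
proof -
  note eqv = equiv_curve_rel[OF G]
  from X obtain D where D: "D \<in> curve_classes G"
    and X': "X = {h ` D | h. h \<in> carrier (subgroup_generated (AutoGroup G) {f})}"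
    unfolding curve_orbits_def orbits_def orbit_def by auto
  from D have DQ: "D \<in> carrier G // curve_rel G" by (simp add: curve_classes_def)
  then obtain d where d: "d \<in> D" using eqv by (metis equiv_Eps_in)
  have sub: "D \<subseteq> carrier G" using in_quotient_imp_subset[OF eqv DQ] .
  have key: "trace (\<rho> x) = trace (\<rho> d)" if "E \<in> X" "x \<in> E" for E x
  proof -
    from that X' obtain h y where h: "h \<in> carrier (subgroup_generated (AutoGroup G) {f})"
      and y: "y \<in> D" "x = h y" by auto
    then have "trace (\<rho> x) = trace (\<rho> y)"
      using generated_auto_trace[OF G f \<rho> s h] sub by auto
    also have "\<dots> = trace (\<rho> d)"
      using trace_curve_rel[OF G \<rho>] in_quotient_imp_in_rel[OF eqv DQ] y d by blast
    finally show ?thesis .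
  qed
  have "orbit_trace \<rho> X = trace (\<rho> d)"
    unfolding orbit_trace_def
  proof (rule the_equality)
    show "\<forall>C\<in>X. \<forall>g\<in>C. trace (\<rho> g) = trace (\<rho> d)" using key by blast
  next
    fix t assume "\<forall>C\<in>X. \<forall>g\<in>C. trace (\<rho> g) = t"
    then have "trace (\<rho> g) = t" using C g by blast
    then show "t = trace (\<rho> d)" using key[OF C g] by simp
  qed
  with key[OF C g] show ?thesis by simp
qed

definition BQ_conditions ::
    "('g, 'm) monoid_scheme \<Rightarrow> ('g \<Rightarrow> 'g) \<Rightarrow> ('g \<Rightarrow> complex ^ 2 ^ 2) \<Rightarrow> bool" where
  "BQ_conditions G f \<rho> \<longleftrightarrow>
     (\<forall>X\<in>curve_orbits G f. orbit_trace \<rho> X \<notin> complex_of_real ` {-2..2}) \<and>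
     finite {X \<in> curve_orbits G f. cmod (orbit_trace \<rho> X) \<le> 2}"

section \<open>The function \<open>\<hh>\<close>\<close>

text \<open>The library's \<open>arcosh\<close> uses a different branch on the complex numbers: its values may have
  negative real part.\<close>

definition Arcosh :: "complex \<Rightarrow> complex" where
  "Arcosh z = (THE w. cosh w = z \<and> Re w \<ge> 0 \<and> Im w \<in> {-pi<..pi} \<and> (Re w = 0 \<longrightarrow> Im w \<ge> 0))"

lemma Arcosh_ex1:
  "\<exists>!w. cosh w = z \<and> Re w \<ge> 0 \<and> Im w \<in> {-pi<..pi} \<and> (Re w = 0 \<longrightarrow> Im w \<ge> 0)"
proof (rule ex_ex1I)
  have "\<exists>v. cosh v = z"
  proof
    show "cosh (\<i> * Arccos z) = z"
      unfolding cosh_conv_cos by (simp add: mult.assoc[symmetric])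
  qed
  then obtain v where v: "cosh v = z" by blast
  define u where "u = Ln (exp v)"
  have u: "cosh u = z" "Im u \<le> pi" "- pi < Im u"
    using v by (auto simp: u_def cosh_field_def exp_minus mpi_less_Im_Ln Im_Ln_le_pi)
  show "\<exists>w. cosh w = z \<and> Re w \<ge> 0 \<and> Im w \<in> {-pi<..pi} \<and> (Re w = 0 \<longrightarrow> Im w \<ge> 0)"
  proof (cases "Re u > 0 \<or> Re u = 0 \<and> Im u \<ge> 0")
    case True
    then show ?thesis using u by (intro exI[of _ u]) auto
  next
    case False
    show ?thesis
    proof (cases "Im u = pi")
      case True
      have "exp (- cnj u) = exp (- u)"
      proof -
        have "- cnj u = - u + 2 * of_real pi * \<i>"
          using True by (simp add: complex_eq_iff)
        then have "exp (- cnj u) = exp (- u) * exp (2 * of_real pi * \<i>)"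
          by (metis exp_add)
        then show ?thesis by simp
      qed
      moreover from this have "exp (cnj u) = exp u"
        by (metis exp_minus inverse_inverse_eq minus_minus)
      ultimately have "cosh (- cnj u) = z"
        using u by (simp add: cosh_field_def add.commute)
      then show ?thesis using True False
        by (intro exI[of _ "- cnj u"]) auto
    next
      case ne: False
      then show ?thesis using u False by (intro exI[of _ "- u"]) auto
    qed
  qed
next
  fix w w' :: complex
  assume w: "cosh w = z \<and> Re w \<ge> 0 \<and> Im w \<in> {-pi<..pi} \<and> (Re w = 0 \<longrightarrow> Im w \<ge> 0)"
    and w': "cosh w' = z \<and> Re w' \<ge> 0 \<and> Im w' \<in> {-pi<..pi} \<and> (Re w' = 0 \<longrightarrow> Im w' \<ge> 0)"
  then have "cos (\<i> * w) = cos (\<i> * w')" by (simp add: cosh_conv_cos)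
  then obtain n where n: "n \<in> \<int>"
    and eq: "\<i> * w = \<i> * w' + of_real (2 * n * pi) \<or> \<i> * w = - (\<i> * w') + of_real (2 * n * pi)"
    unfolding complex_cos_eq by blast
  from n obtain m :: int where m: "n = of_int m" by (auto elim: Ints_cases)
  have small: "m = 0" if "\<bar>2 * n * pi\<bar> < 2 * pi"
  proof -
    have "\<bar>n\<bar> * (2 * pi) < 1 * (2 * pi)" using that by (simp add: abs_mult)
    then have "\<bar>n\<bar> < 1" by (subst (asm) mult_less_cancel_right) auto
    then show ?thesis using m by simp
  qed
  from eq show "w = w'"
  proof
    assume "\<i> * w = \<i> * w' + of_real (2 * n * pi)"
    then have e: "Re w = Re w'" "Im w = Im w' - 2 * n * pi" by (auto simp: complex_eq_iff)
    then have "\<bar>2 * n * pi\<bar> < 2 * pi" using w w' by auto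
    then have "m = 0" by (rule small)
    then show ?thesis using e m by (simp add: complex_eq_iff)
  next
    assume "\<i> * w = - (\<i> * w') + of_real (2 * n * pi)"
    then have e: "Re w = - Re w'" "Im w = - Im w' - 2 * n * pi" by (auto simp: complex_eq_iff)
    then have r: "Re w = 0" "Re w' = 0" using w w' by auto
    show ?thesis
    proof (cases "Im w = pi \<and> Im w' = pi")
      case True
      then show ?thesis using r by (simp add: complex_eq_iff)
    next
      case False
      then have "\<bar>2 * n * pi\<bar> < 2 * pi" using w w' r e by auto
      then have "m = 0" by (rule small)
      then show ?thesis using e m r w w' by (auto simp: complex_eq_iff)
    qed
  qed
qed

definition trace_length :: "complex \<Rightarrow> complex" where
  "trace_length x = 2 * Arcosh (x / 2)"

text \<open>The argument of the logarithm is undefined or zero exactly at \<open>x = \<plusminus> csqrt (\<tau> + 2)\<close>, which are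
  excluded from the domain of the function.  For a representation with \<open>\<tau> \<noteq> 2\<close> that is stabilized by a
  hyperbolic element and satisfies the BQ-conditions, no trace on a curve class takes such a value: the
  traces on its neighbours in the Farey complex would tend to zero in one direction.\<close>

definition h_fun :: "complex \<Rightarrow> complex \<Rightarrow> complex" where
  "h_fun \<tau> x = (let \<nu> = Arcosh (- \<tau> / 2) in
     Ln ((exp \<nu> + exp (trace_length x)) / (exp (- \<nu>) + exp (trace_length x))))"

end

theory Submission imports Defs "HOL-Algebra.Elementary_Groups" begin

text \<open>Curve classes correspond to primitive vectors of \<open>\<int>\<^sup>2\<close> up to sign: by Nielsen reduction, every
  primitive vector is the image of a basis element, which is unique up to conjugation. The trace is
  therefore a Markoff map \<open>\<phi>\<close> on primitive vectors: \<open>\<phi> (v + w) + \<phi> (v - w) = \<phi> v * \<phi> w\<close> for every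
  basis \<open>v, w\<close>. With \<open>E = exp \<nu>\<close> and \<open>F = exp \<circ> \<hh>\<close>, an explicit function \<open>gap\<close> on bases satisfies
  \<open>gap v w = gap v (v + w) * F (\<phi> (v + w)) * gap (v + w) w\<close>. Iterating this along the Stern-Brocot
  tree below \<open>v, w\<close> shows that the sum of \<open>\<hh>\<close> over the primitive vectors strictly between \<open>v\<close> and \<open>w\<close>
  has exponential \<open>gap v w\<close>, provided that the sum converges. If it diverged below some basis, it would
  diverge along an infinite path in the tree; by the BQ-conditions the traces along that path
  eventually decrease forever while staying larger than \<open>2\<close> in modulus, and this is impossible unless
  \<open>\<tau> = 2\<close>. Finally, up to sign \<open>H\<close> has nonnegative entries in a suitable basis \<open>v, w\<close>, and the
  vectors between \<open>v\<close> and \<open>w\<close> but not between \<open>H v\<close> and \<open>H w\<close> represent each orbit once. As the gaps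
  of \<open>v, w\<close> and \<open>H v, H w\<close> agree, the exponential of the sum over these representatives is \<open>1\<close>.\<close>

section \<open>The tree of bases of \<open>\<int>\<^sup>2\<close> and Markoff maps\<close>

text \<open>The shape of \<open>gap\<close> is dictated by its limits. By the edge relation the
  quotients of \<open>\<phi> (v + w)\<close> and \<open>\<phi> (v - w)\<close> by
  \<open>\<phi> v * \<phi> w\<close> add up to 1. As \<open>w\<close> runs through the neighbours of
  a fixed \<open>v\<close>, the second one tends to \<open>1 / (1 + (ev v)\<^sup>2)\<close>;
  dividing by the factors \<open>\<kappa>\<close> makes \<open>gap\<close> tend to 1, as the
  exponential of a sum over a vanishing sector must.

  Two obstacles shape the proof. Moreover, a value of modulus at most 2 recurs at all translates
  under \<open>H\<close>, so only the set of small values is finite, not the set of vectors that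
  carry them. This still bounds \<open>\<phi>\<close> away from 0, which settles the paths that turn
  around a single vector. All other infinite paths turn both ways infinitely often; they are treated
  only in regions with finitely many small vectors, such as a sector without its image under
  \<open>H\<close>.\<close>

definition vdet :: "int \<times> int \<Rightarrow> int \<times> int \<Rightarrow> int" where
  "vdet v w = fst v * snd w - snd v * fst w"

definition primitive :: "int \<times> int \<Rightarrow> bool" where
  "primitive v \<longleftrightarrow> coprime (fst v) (snd v)"

text \<open>For \<open>vdet v w = 1\<close> the numbers \<open>vdet u w\<close> and
  \<open>vdet v u\<close> are the coordinates of \<open>u\<close> in the basis \<open>v, w\<close>
  (\<open>vdet_cramer\<close>), so this is the set of primitive vectors in the open cone spanned by
  \<open>v\<close> and \<open>w\<close>.\<close>

definition sector :: "int \<times> int \<Rightarrow> int \<times> int \<Rightarrow> (int \<times> int) set" where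
  "sector v w = {u. primitive u \<and> vdet v u > 0 \<and> vdet u w > 0}"

lemma vdet_simps [simp]:
  "vdet (u + v) w = vdet u w + vdet v w" "vdet u (v + w) = vdet u v + vdet u w"
  "vdet (u - v) w = vdet u w - vdet v w" "vdet u (v - w) = vdet u v - vdet u w"
  "vdet (- u) w = - vdet u w" "vdet u (- w) = - vdet u w" "vdet u u = 0"
  by (auto simp: vdet_def algebra_simps)

lemma vdet_swap: "vdet w v = - vdet v w"
  by (simp add: vdet_def)

text \<open>The vector \<open>((+) v ^^ n) w\<close> is \<open>w + n v\<close>. For a basis
  \<open>v, w\<close> these vectors form the fan of neighbours of \<open>v\<close> in the Farey
  graph, starting at \<open>w\<close>.\<close>

lemma vdet_funpow [simp]:
  "vdet v (((+) v ^^ n) w) = vdet v w" "vdet (((+) v ^^ n) w) v = vdet w v"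
  by (induction n) auto

lemma primitive_minus [simp]: "primitive (- v) \<longleftrightarrow> primitive v"
  by (simp add: primitive_def)

lemma primitive_if_vdet: "\<bar>vdet v w\<bar> = 1 \<Longrightarrow> primitive v"
proof -
  assume "\<bar>vdet v w\<bar> = 1"
  then have "is_unit (vdet v w)" by simp
  moreover have "c dvd vdet v w" if "c dvd fst v" "c dvd snd v" for c
    using that by (simp add: vdet_def)
  ultimately show ?thesis unfolding primitive_def by (meson coprimeI dvd_trans)
qed

lemma primitive_if_vdet': "\<bar>vdet v w\<bar> = 1 \<Longrightarrow> primitive w"
  using primitive_if_vdet[of w v] by (simp add: vdet_swap[of w v])

lemma ex_vdet_eq_1:
  assumes "primitive v" shows "\<exists>w. vdet v w = 1"
proof -
  have "gcd (fst v) (snd v) = 1" using assms by (simp add: primitive_def)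
  then obtain x y where "x * fst v + y * snd v = 1" using bezout_int by metis
  then have "vdet v (- y, x) = 1" by (simp add: vdet_def algebra_simps)
  then show ?thesis by blast
qed

lemma vdet_cramer:
  assumes "vdet v w = 1"
  shows "u = (vdet u w * fst v + vdet v u * fst w, vdet u w * snd v + vdet v u * snd w)"
proof -
  have "fst u * vdet v w = vdet u w * fst v + vdet v u * fst w"
    "snd u * vdet v w = vdet u w * snd v + vdet v u * snd w"
    by (simp_all add: vdet_def algebra_simps)
  then show ?thesis using assms by (simp add: prod_eq_iff)
qed

lemma vdet_cramer_det:
  assumes "vdet v w = 1"
  shows "vdet a b = vdet a w * vdet v b - vdet v a * vdet b w"
proof -
  have "vdet a b = vdet a b * vdet v w" using assms by simp
  also have "\<dots> = vdet a w * vdet v b - vdet v a * vdet b w"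
    by (simp add: vdet_def algebra_simps)
  finally show ?thesis .
qed

text \<open>Completing \<open>v\<close> to a basis exhibits \<open>u\<close> as a multiple
  \<open>c\<close> of \<open>v\<close>, and \<open>c\<close> divides both coordinates of the
  primitive vector \<open>u\<close>.\<close>

lemma primitive_parallel:
  assumes "primitive u" "primitive v" "vdet u v = 0"
  shows "u = v \<or> u = - v"
proof -
  obtain w where w: "vdet v w = 1" using ex_vdet_eq_1[OF assms(2)] by blast
  define c where "c = vdet u w"
  have u: "u = (c * fst v, c * snd v)"
    using vdet_cramer[OF w, of u] assms(3) vdet_swap[of u v] by (simp add: c_def)
  have "c dvd fst u" "c dvd snd u" unfolding u by auto
  then have "is_unit c" using assms(1) unfolding primitive_def by (meson coprime_common_divisor)
  then have "c = 1 \<or> c = -1" by auto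
  then show ?thesis using u by (auto simp: prod_eq_iff)
qed

lemma add_in_sector: "vdet v w = 1 \<Longrightarrow> v + w \<in> sector v w"
  using primitive_if_vdet[of "v + w" w] by (simp add: sector_def)

text \<open>The ray through \<open>v + w\<close> divides the cone according to which coordinate of
  \<open>u\<close> is larger; on the ray itself primitivity leaves only
  \<open>v + w\<close>.\<close>

lemma sector_split:
  assumes "vdet v w = 1"
  shows "sector v w = insert (v + w) (sector v (v + w) \<union> sector (v + w) w)"
proof (intro equalityI subsetI)
  fix u assume u: "u \<in> sector v w"
  consider "vdet v u < vdet u w" | "vdet v u > vdet u w" | "vdet v u = vdet u w" by linarith
  then show "u \<in> insert (v + w) (sector v (v + w) \<union> sector (v + w) w)"
  proof cases
    case 3
    have "u = v + w \<or> u = - (v + w)"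
      using u 3 primitive_if_vdet[of "v + w" w] assms vdet_swap[of u v]
      by (intro primitive_parallel) (auto simp: sector_def)
    moreover have "u \<noteq> - (v + w)" using u assms by (auto simp: sector_def)
    ultimately show ?thesis by simp
  qed (use u vdet_swap[of u v] vdet_swap[of w u] in \<open>auto simp: sector_def\<close>)
next
  fix u assume "u \<in> insert (v + w) (sector v (v + w) \<union> sector (v + w) w)"
  then show "u \<in> sector v w"
    using add_in_sector[OF assms] vdet_swap[of u v] vdet_swap[of w u] by (auto simp: sector_def)
qed

lemma sector_split_disjoint:
  assumes "vdet v w = 1"
  shows "v + w \<notin> sector v (v + w)" "v + w \<notin> sector (v + w) w" "sector v (v + w) \<inter> sector (v + w) w = {}"
proof -
  show "sector v (v + w) \<inter> sector (v + w) w = {}"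
  proof (intro equals0I)
    fix u assume "u \<in> sector v (v + w) \<inter> sector (v + w) w"
    then show False using vdet_swap[of v u] vdet_swap[of w u] by (auto simp: sector_def)
  qed
qed (use vdet_swap[of v w] in \<open>auto simp: sector_def\<close>)

section \<open>Eigenvalues and linear recurrences\<close>

definition eigen :: "complex \<Rightarrow> complex" where
  "eigen x = exp (Arcosh (x / 2))"

lemma eigen_nonzero [simp]: "eigen x \<noteq> 0"
  by (simp add: eigen_def)

lemma exp_trace_length: "exp (trace_length x) = (eigen x)\<^sup>2"
  by (simp add: trace_length_def eigen_def exp_double)

lemma Arcosh_props: "cosh (Arcosh z) = z" "Re (Arcosh z) \<ge> 0"
  using theI'[OF Arcosh_ex1, of z] unfolding Arcosh_def by auto

text \<open>Thus \<open>eigen x\<close> and its inverse are the eigenvalues of a matrix of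
  determinant 1 and trace \<open>x\<close>; the branch of \<open>Arcosh\<close> selects the one of
  modulus at least 1.\<close>

lemma eigen_add_inverse: "eigen x + 1 / eigen x = x"
proof -
  have "(eigen x + 1 / eigen x) / 2 = x / 2"
    using Arcosh_props(1)[of "x / 2"] by (simp only: eigen_def cosh_field_def exp_minus inverse_eq_divide)
  then show ?thesis by (metis divide_cancel_right zero_neq_numeral)
qed

lemma norm_eigen_ge_1: "cmod (eigen x) \<ge> 1"
  using Arcosh_props(2)[of "x / 2"] by (simp add: eigen_def)

text \<open>An eigenvalue of modulus 1 makes \<open>Arcosh (x / 2)\<close> purely imaginary, and
  then \<open>x\<close> is twice the cosine of a real number.\<close>

lemma norm_eigen_gt_1:
  assumes "x \<notin> complex_of_real ` {-2..2}"
  shows "cmod (eigen x) > 1"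
proof (rule ccontr)
  assume "\<not> cmod (eigen x) > 1"
  then have "Re (Arcosh (x / 2)) = 0" using Arcosh_props(2)[of "x / 2"] by (simp add: eigen_def)
  then have "Arcosh (x / 2) = \<i> * of_real (Im (Arcosh (x / 2)))" (is "_ = \<i> * of_real ?t")
    by (simp add: complex_eq_iff)
  then have "x / 2 = cosh (\<i> * of_real ?t)" using Arcosh_props(1)[of "x / 2"] by metis
  also have "\<dots> = cos (- of_real ?t)" by (simp add: cosh_conv_cos mult.assoc[symmetric])
  also have "\<dots> = complex_of_real (cos ?t)" by (simp add: cos_of_real)
  finally have "x / 2 = complex_of_real (cos ?t)" .
  then have "x = complex_of_real (2 * cos (Im (Arcosh (x / 2))))" by (simp add: mult.commute)
  moreover have "2 * cos (Im (Arcosh (x / 2))) \<in> {-2..2}" by auto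
  ultimately show False using assms by blast
qed

lemma norm_le_eigen: "cmod x / 2 \<le> cmod (eigen x)"
proof -
  have "cmod x \<le> cmod (eigen x) + cmod (1 / eigen x)"
    using norm_triangle_ineq[of "eigen x" "1 / eigen x"] by (simp add: eigen_add_inverse)
  also have "cmod (1 / eigen x) \<le> 1" using norm_eigen_ge_1[of x] by (simp add: norm_divide)
  also have "1 \<le> cmod (eigen x)" by (rule norm_eigen_ge_1)
  finally show ?thesis by simp
qed

lemma one_plus_eigen_sq: "1 + (eigen x)\<^sup>2 = x * eigen x"
proof -
  have "x * eigen x = (eigen x + 1 / eigen x) * eigen x" by (simp only: eigen_add_inverse)
  also have "\<dots> = 1 + (eigen x)\<^sup>2" by (simp add: distrib_right power2_eq_square)
  finally show ?thesis by simp
qed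

text \<open>The characteristic roots are \<open>l\<close> and \<open>1 / l\<close>; the combination
  on the left annihilates the solution \<open>(1 / l) ^ n\<close>, so only the mode
  \<open>l ^ n\<close> survives.\<close>

lemma linear_recurrence_growth:
  fixes Y :: "nat \<Rightarrow> complex"
  assumes "\<And>n. Y (Suc (Suc n)) = x * Y (Suc n) - Y n" and "x = l + 1 / l" "l \<noteq> 0"
  shows "Y (Suc n) - Y n / l = l ^ n * (Y 1 - Y 0 / l)"
proof (induction n)
  case (Suc n)
  have "Y (Suc (Suc n)) - Y (Suc n) / l = l * (Y (Suc n) - Y n / l)"
    using assms(3) by (simp add: assms(1,2) field_simps)
  then show ?case using Suc by simp
qed simp

text \<open>The parameter satisfies \<open>E + 1 / E = - \<tau>\<close> in the application, so
  \<open>E \<noteq> -1\<close> encodes \<open>\<tau> \<noteq> 2\<close>, and the right-hand side of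
  \<open>vertex\<close> is \<open>\<tau> + 2\<close>. The last assumption counts values rather than
  vectors, because every orbit of the mapping class consists of infinitely many vectors with one
  common value.\<close>

locale markoff_map =
  fixes \<phi> :: "int \<times> int \<Rightarrow> complex" and E :: complex
  assumes E0: "E \<noteq> 0" and E1: "E \<noteq> -1"
    and minus: "primitive v \<Longrightarrow> \<phi> (- v) = \<phi> v"
    and edge: "vdet v w = 1 \<Longrightarrow> \<phi> (v + w) + \<phi> (v - w) = \<phi> v * \<phi> w"
    and vertex: "vdet v w = 1 \<Longrightarrow>
      (\<phi> v)\<^sup>2 + (\<phi> w)\<^sup>2 + (\<phi> (v + w))\<^sup>2 - \<phi> v * \<phi> w * \<phi> (v + w) = 2 - E - 1 / E"
    and not_real: "primitive v \<Longrightarrow> \<phi> v \<notin> complex_of_real ` {-2..2}"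
    and finite_small: "finite {\<phi> v | v. primitive v \<and> cmod (\<phi> v) \<le> 2}"
begin

section \<open>Values at the neighbours of a vector\<close>

definition \<mu> :: complex where "\<mu> = 2 - E - 1 / E"

abbreviation ev :: "int \<times> int \<Rightarrow> complex" where "ev v \<equiv> eigen (\<phi> v)"

lemma \<mu>_eq: "E * \<mu> = - (E - 1)\<^sup>2"
  using E0 by (simp add: \<mu>_def field_simps power2_eq_square)

lemma edge_abs:
  assumes "\<bar>vdet v w\<bar> = 1" shows "\<phi> (v + w) + \<phi> (v - w) = \<phi> v * \<phi> w"
proof (cases "vdet v w = 1")
  case False
  then have d: "vdet w v = 1" using assms vdet_swap[of w v] by linarith
  have "\<phi> (v - w) = \<phi> (w - v)"
    using minus[of "w - v"] primitive_if_vdet[of "w - v" v] d by simp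
  then show ?thesis using edge[OF d] by (simp add: add.commute mult.commute)
qed (rule edge)

lemma vertex_abs:
  assumes "\<bar>vdet v w\<bar> = 1"
  shows "(\<phi> v)\<^sup>2 + (\<phi> w)\<^sup>2 + (\<phi> (v + w))\<^sup>2 - \<phi> v * \<phi> w * \<phi> (v + w) = \<mu>"
proof (cases "vdet v w = 1")
  case False
  then have d: "vdet w v = 1" using assms vdet_swap[of w v] by linarith
  then show ?thesis using vertex[OF d] by (simp add: add.commute mult.commute \<mu>_def)
qed (simp add: vertex \<mu>_def)

lemma mult_neighbours:
  assumes "\<bar>vdet v w\<bar> = 1"
  shows "\<phi> (v + w) * \<phi> (v - w) = (\<phi> v)\<^sup>2 + (\<phi> w)\<^sup>2 - \<mu>"
proof -
  have "\<phi> (v - w) = \<phi> v * \<phi> w - \<phi> (v + w)" using edge_abs[OF assms] by (simp add: algebra_simps)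
  then show ?thesis using vertex_abs[OF assms] by algebra
qed

lemma diff_sym: "\<bar>vdet v w\<bar> = 1 \<Longrightarrow> \<phi> (w - v) = \<phi> (v - w)"
  using minus[of "v - w"] primitive_if_vdet[of "v - w" v] vdet_swap[of w v] by simp

lemma nonzero: "primitive v \<Longrightarrow> \<phi> v \<noteq> 0"
  using not_real[of v] by force

lemma ev_gt_1: "primitive v \<Longrightarrow> cmod (ev v) > 1"
  by (simp add: norm_eigen_gt_1 not_real)

text \<open>The values of modulus at most 2 form a finite set, and it avoids 0 because 0 lies in the
  excluded interval.\<close>

lemma norm_ge: obtains m where "m > 0" "\<And>v. primitive v \<Longrightarrow> m \<le> cmod (\<phi> v)"
proof -
  define S where "S = insert 2 (cmod ` {\<phi> v | v. primitive v \<and> cmod (\<phi> v) \<le> 2})"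
  have S: "finite S" "S \<noteq> {}" using finite_small by (auto simp: S_def)
  have "\<forall>s\<in>S. s > 0" using nonzero by (auto simp: S_def)
  then have "Min S > 0" using S by simp
  moreover have "Min S \<le> cmod (\<phi> v)" if "primitive v" for v
  proof (cases "cmod (\<phi> v) \<le> 2")
    case True
    then have "cmod (\<phi> v) \<in> S" using that unfolding S_def by blast
    then show ?thesis using S by simp
  next
    case False
    have "2 \<in> S" by (simp add: S_def)
    then have "Min S \<le> 2" using S by simp
    then show ?thesis using False by simp
  qed
  ultimately show ?thesis using that by blast
qed

lemma neighbours_rec:
  assumes "\<bar>vdet v w\<bar> = 1"
  shows "\<phi> (((+) v ^^ Suc (Suc n)) w) = \<phi> v * \<phi> (((+) v ^^ Suc n) w) - \<phi> (((+) v ^^ n) w)"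
proof -
  define u where "u = ((+) v ^^ Suc n) w"
  have d: "\<bar>vdet v u\<bar> = 1" using assms by (simp add: u_def)
  have "u - v = ((+) v ^^ n) w" by (simp add: u_def)
  then have "\<phi> (v - u) = \<phi> (((+) v ^^ n) w)" using diff_sym[OF d] by simp
  moreover have "v + u = ((+) v ^^ Suc (Suc n)) w" by (simp add: u_def)
  ultimately show ?thesis using edge_abs[OF d] by (simp add: u_def algebra_simps)
qed

lemma neighbours_growth:
  assumes "\<bar>vdet v w\<bar> = 1"
  shows "\<phi> (((+) v ^^ Suc n) w) - \<phi> (((+) v ^^ n) w) / ev v = ev v ^ n * (\<phi> (v + w) - \<phi> w / ev v)"
  using linear_recurrence_growth[where Y = "\<lambda>n. \<phi> (((+) v ^^ n) w)" and x = "\<phi> v" and l = "ev v" and n = n]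
    neighbours_rec[OF assms] eigen_add_inverse[of "\<phi> v"] by simp

text \<open>Otherwise the neighbours of \<open>v\<close> would tend to zero geometrically.\<close>

lemma growth_coeff_nonzero:
  assumes "\<bar>vdet v w\<bar> = 1"
  shows "\<phi> (v + w) - \<phi> w / ev v \<noteq> 0"
proof
  assume z: "\<phi> (v + w) - \<phi> w / ev v = 0"
  have v: "primitive v" using primitive_if_vdet[OF assms] .
  obtain m where m: "m > 0" "\<And>v. primitive v \<Longrightarrow> m \<le> cmod (\<phi> v)" using norm_ge by blast
  have rec: "\<phi> (((+) v ^^ Suc n) w) = \<phi> (((+) v ^^ n) w) / ev v" for n
    using neighbours_growth[OF assms, of n] z by simp
  have "\<phi> (((+) v ^^ n) w) = \<phi> w * (1 / ev v) ^ n" for n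
    by (induction n) (use rec in \<open>simp_all del: funpow.simps(2) add: funpow.simps(1)\<close>)
  moreover have "(\<lambda>n. \<phi> w * (1 / ev v) ^ n) \<longlonglongrightarrow> \<phi> w * 0"
    using ev_gt_1[OF v] by (intro tendsto_mult tendsto_const LIMSEQ_power_zero) (simp add: norm_divide)
  ultimately have "(\<lambda>n. \<phi> (((+) v ^^ n) w)) \<longlonglongrightarrow> 0" by simp
  then obtain n where "cmod (\<phi> (((+) v ^^ n) w)) < m"
    using m(1) by (metis LIMSEQ_iff diff_zero order_refl)
  moreover have "primitive (((+) v ^^ n) w)"
    using assms by (intro primitive_if_vdet'[of v]) simp
  ultimately show False using m(2) by (meson not_le)
qed

text \<open>The fan around \<open>v\<close> can be followed in two directions, towards
  \<open>w\<close> and towards \<open>- w\<close>. Both growth coefficients are nonzero, and their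
  product is exactly \<open>(\<phi> v)\<^sup>2 - \<mu>\<close>. Hence no value meets the points
  \<open>\<plusminus> csqrt (\<tau> + 2)\<close> where the summand is singular.\<close>

lemma \<phi>_sq_neq_\<mu>:
  assumes "primitive v" shows "(\<phi> v)\<^sup>2 \<noteq> \<mu>"
proof -
  obtain w where w: "vdet v w = 1" using ex_vdet_eq_1[OF assms] by blast
  define z z' y x l where "z = \<phi> (v + w)" and "z' = \<phi> (v - w)" and "y = \<phi> w" and "x = \<phi> v" and "l = ev v"
  have l: "l \<noteq> 0" "x = l + 1 / l" using eigen_add_inverse[of "\<phi> v"] by (auto simp: l_def x_def)
  have "z - y / l \<noteq> 0" using growth_coeff_nonzero[of v w] w by (simp add: z_def y_def l_def)
  moreover have "\<phi> (v - w) - \<phi> w / ev v \<noteq> 0"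
    using growth_coeff_nonzero[of v "- w"] w minus[of w] primitive_if_vdet'[of v w] by simp
  ultimately have "(z - y / l) * (z' - y / l) \<noteq> 0" by (simp add: z'_def y_def l_def)
  moreover have "(z - y / l) * (z' - y / l) = z * z' - (z + z') * (y / l) + (y / l)\<^sup>2"
    by algebra
  moreover have "z * z' = x\<^sup>2 + y\<^sup>2 - \<mu>" "z + z' = x * y"
    using mult_neighbours[of v w] edge_abs[of v w] w by (auto simp: z_def z'_def x_def y_def)
  moreover have "x\<^sup>2 + y\<^sup>2 - \<mu> - x * y * (y / l) + (y / l)\<^sup>2 = x\<^sup>2 - \<mu>"
    unfolding l(2) using l(1) by (simp add: field_simps power2_eq_square)
  ultimately have "x\<^sup>2 - \<mu> \<noteq> 0" by metis
  then show ?thesis by (simp add: x_def)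
qed

section \<open>The gap function and its splitting identity\<close>

definition \<kappa> :: "complex \<Rightarrow> complex" where
  "\<kappa> x = 1 + (E - 1) / (1 + (eigen x)\<^sup>2)"

definition F :: "complex \<Rightarrow> complex" where
  "F x = (E + (eigen x)\<^sup>2) / (1 / E + (eigen x)\<^sup>2)"

text \<open>The vector \<open>v - w\<close> is the vertex opposite to \<open>v + w\<close> at the
  edge \<open>v, w\<close>, outside the sector. The numerator tends to
  \<open>\<kappa> (\<phi> v)\<close> when \<open>w\<close> moves outwards along the fan of
  \<open>v\<close>, while \<open>\<kappa> (\<phi> w)\<close> tends to 1; the denominator therefore
  normalises both ends of the sector.\<close>

definition gap :: "int \<times> int \<Rightarrow> int \<times> int \<Rightarrow> complex" where
  "gap v w = (1 + (E - 1) * \<phi> (v - w) / (\<phi> v * \<phi> w)) / (\<kappa> (\<phi> v) * \<kappa> (\<phi> w))"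

text \<open>With \<open>L = (ev v)\<^sup>2\<close> the right-hand side is
  \<open>(1 + L)\<^sup>2 - \<mu> * L\<close>, a quadratic polynomial in \<open>L\<close>; the choice
  of \<open>\<mu>\<close> gives it the roots \<open>- E\<close> and \<open>- 1 / E\<close>.\<close>

lemma eigen_factor:
  assumes "primitive v"
  shows "(E + (ev v)\<^sup>2) * (1 / E + (ev v)\<^sup>2) = ((\<phi> v)\<^sup>2 - \<mu>) * (ev v)\<^sup>2"
proof -
  have "((\<phi> v)\<^sup>2 - \<mu>) * (ev v)\<^sup>2 = (1 + (ev v)\<^sup>2)\<^sup>2 - \<mu> * (ev v)\<^sup>2"
    by (simp add: one_plus_eigen_sq power_mult_distrib left_diff_distrib)
  also have "\<dots> = (E + (ev v)\<^sup>2) * (1 / E + (ev v)\<^sup>2)"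
    using E0 by (simp add: \<mu>_def field_simps power2_eq_square)
  finally show ?thesis by simp
qed

lemma F_parts_nonzero:
  assumes "primitive v"
  shows "E + (ev v)\<^sup>2 \<noteq> 0" "1 / E + (ev v)\<^sup>2 \<noteq> 0"
proof -
  have "((\<phi> v)\<^sup>2 - \<mu>) * (ev v)\<^sup>2 \<noteq> 0" using \<phi>_sq_neq_\<mu>[OF assms] by simp
  then show "E + (ev v)\<^sup>2 \<noteq> 0" "1 / E + (ev v)\<^sup>2 \<noteq> 0" using eigen_factor[OF assms] by auto
qed

lemma \<kappa>_eq:
  assumes "primitive v"
  shows "\<kappa> (\<phi> v) = (E + (ev v)\<^sup>2) / (\<phi> v * ev v)"
proof -
  have "1 + (ev v)\<^sup>2 \<noteq> 0" using one_plus_eigen_sq[of "\<phi> v"] nonzero[OF assms] by simp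
  then have "\<kappa> (\<phi> v) = (E + (ev v)\<^sup>2) / (1 + (ev v)\<^sup>2)" by (simp add: \<kappa>_def field_simps)
  then show ?thesis by (simp add: one_plus_eigen_sq)
qed

lemma \<kappa>_nonzero: "primitive v \<Longrightarrow> \<kappa> (\<phi> v) \<noteq> 0"
  by (simp add: \<kappa>_eq F_parts_nonzero nonzero)

text \<open>This eliminates the eigenvalue: after the factors \<open>\<kappa>\<close> have been
  collected, only a rational function of the trace remains, and the splitting of \<open>gap\<close>
  becomes a polynomial identity in the traces.\<close>

lemma F_\<kappa>:
  assumes "primitive v"
  shows "F (\<phi> v) / (\<kappa> (\<phi> v))\<^sup>2 = (\<phi> v)\<^sup>2 / ((\<phi> v)\<^sup>2 - \<mu>)"
proof -
  have "F (\<phi> v) / (\<kappa> (\<phi> v))\<^sup>2 = (\<phi> v)\<^sup>2 * (ev v)\<^sup>2 / ((E + (ev v)\<^sup>2) * (1 / E + (ev v)\<^sup>2))"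
    using F_parts_nonzero[OF assms] nonzero[OF assms]
    unfolding F_def \<kappa>_eq[OF assms] power_divide power_mult_distrib
    by (simp add: divide_simps) (simp add: power2_eq_square)
  then show ?thesis by (simp add: eigen_factor[OF assms])
qed

text \<open>The two factors belong to the two sides of one edge. Their product depends only on the
  sum and the product of the opposite values, which the edge relation and
  \<open>mult_neighbours\<close> supply; it is nonzero by \<open>\<phi>_sq_neq_\<mu>\<close>, which
  gives \<open>gap_nonzero\<close>.\<close>

lemma gap_numerator_mult:
  assumes "\<bar>vdet v w\<bar> = 1"
  shows "(\<phi> v * \<phi> w + (E - 1) * \<phi> (v - w)) * (\<phi> v * \<phi> w + (E - 1) * \<phi> (v + w))
    = E * ((\<phi> v)\<^sup>2 - \<mu>) * ((\<phi> w)\<^sup>2 - \<mu>)"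
proof -
  have "(\<phi> v * \<phi> w + (E - 1) * \<phi> (v - w)) * (\<phi> v * \<phi> w + (E - 1) * \<phi> (v + w))
    = (\<phi> v * \<phi> w)\<^sup>2 + (E - 1) * (\<phi> v * \<phi> w) * (\<phi> (v + w) + \<phi> (v - w))
      + (E - 1)\<^sup>2 * (\<phi> (v + w) * \<phi> (v - w))"
    by (simp add: algebra_simps power2_eq_square)
  also have "\<dots> = E * (\<phi> v * \<phi> w)\<^sup>2 - E * \<mu> * ((\<phi> v)\<^sup>2 + (\<phi> w)\<^sup>2 - \<mu>)"
    unfolding edge_abs[OF assms] mult_neighbours[OF assms] \<mu>_eq
    by (simp add: algebra_simps power2_eq_square)
  also have "\<dots> = E * ((\<phi> v)\<^sup>2 - \<mu>) * ((\<phi> w)\<^sup>2 - \<mu>)"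
    by (simp add: algebra_simps power2_eq_square)
  finally show ?thesis .
qed

lemma gap_nonzero:
  assumes "\<bar>vdet v w\<bar> = 1" shows "gap v w \<noteq> 0"
proof -
  have p: "primitive v" "primitive w" using assms primitive_if_vdet primitive_if_vdet' by blast+
  have "E * ((\<phi> v)\<^sup>2 - \<mu>) * ((\<phi> w)\<^sup>2 - \<mu>) \<noteq> 0" using E0 \<phi>_sq_neq_\<mu> p by simp
  then have "\<phi> v * \<phi> w + (E - 1) * \<phi> (v - w) \<noteq> 0" using gap_numerator_mult[OF assms] by auto
  moreover have "1 + (E - 1) * \<phi> (v - w) / (\<phi> v * \<phi> w) = (\<phi> v * \<phi> w + (E - 1) * \<phi> (v - w)) / (\<phi> v * \<phi> w)"
    using nonzero[OF p(1)] nonzero[OF p(2)] by (simp add: field_simps)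
  ultimately show ?thesis using \<kappa>_nonzero p nonzero by (simp add: gap_def)
qed

text \<open>The factors \<open>\<kappa> x\<close> and \<open>\<kappa> y\<close> occur equally on
  both sides, and the two factors \<open>\<kappa> z\<close> combine with \<open>F z\<close> by
  \<open>F_\<kappa>\<close>. What remains is the identity \<open>id\<close> in \<open>x\<close>,
  \<open>y\<close>, \<open>z\<close>, which is the vertex relation together with
  \<open>\<mu>_eq\<close>.\<close>

lemma gap_split:
  assumes "vdet v w = 1"
  shows "gap v w = gap v (v + w) * F (\<phi> (v + w)) * gap (v + w) w"
proof -
  define x y z where "x = \<phi> v" and "y = \<phi> w" and "z = \<phi> (v + w)"
  have p: "primitive v" "primitive w" "primitive (v + w)"
    using assms primitive_if_vdet[of v w] primitive_if_vdet'[of v w] primitive_if_vdet[of "v + w" w] by auto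
  have nz: "x \<noteq> 0" "y \<noteq> 0" "z \<noteq> 0" "z\<^sup>2 - \<mu> \<noteq> 0" "\<kappa> x \<noteq> 0" "\<kappa> y \<noteq> 0" "\<kappa> z \<noteq> 0"
    using nonzero p \<phi>_sq_neq_\<mu> \<kappa>_nonzero by (auto simp: x_def y_def z_def)
  have z': "\<phi> (v - w) = x * y - z"
    using edge[OF assms] by (simp add: x_def y_def z_def algebra_simps)
  have m: "v - (v + w) = - w" "v + w - w = v" by simp_all
  have g1: "gap v w = (x * y + (E - 1) * (x * y - z)) / (x * y) / (\<kappa> x * \<kappa> y)"
    using nz by (simp add: gap_def z' flip: x_def y_def) (simp add: field_simps)
  have g2: "gap v (v + w) = (x * z + (E - 1) * y) / (x * z) / (\<kappa> x * \<kappa> z)"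
    using nz minus[OF p(2)] by (simp add: gap_def m flip: x_def y_def z_def) (simp add: field_simps)
  have g3: "gap (v + w) w = (z * y + (E - 1) * x) / (z * y) / (\<kappa> z * \<kappa> y)"
    using nz by (simp add: gap_def m flip: x_def y_def z_def) (simp add: field_simps)
  have Fz: "F z = z\<^sup>2 / (z\<^sup>2 - \<mu>) * (\<kappa> z)\<^sup>2"
    using F_\<kappa>[OF p(3)] nz by (simp add: z_def field_simps)
  have id: "(x * y + (E - 1) * (x * y - z)) * (z\<^sup>2 - \<mu>) = (x * z + (E - 1) * y) * (z * y + (E - 1) * x)"
  proof -
    have "(x * z + (E - 1) * y) * (z * y + (E - 1) * x)
      = x * y * z\<^sup>2 + (E - 1) * z * (x\<^sup>2 + y\<^sup>2) + (E - 1)\<^sup>2 * (x * y)"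
      by (simp add: algebra_simps power2_eq_square)
    also have "x\<^sup>2 + y\<^sup>2 = \<mu> - z\<^sup>2 + x * y * z"
      using vertex_abs[of v w] assms by (simp add: x_def y_def z_def algebra_simps)
    also have "(E - 1)\<^sup>2 = - (E * \<mu>)" by (simp add: \<mu>_eq)
    finally show ?thesis by (simp add: algebra_simps power2_eq_square)
  qed
  have "gap v (v + w) * F (\<phi> (v + w)) * gap (v + w) w
    = ((x * z + (E - 1) * y) * (z * y + (E - 1) * x)) / (x * y * (z\<^sup>2 - \<mu>)) / (\<kappa> x * \<kappa> y)"
    unfolding g2 g3 z_def[symmetric] Fz using nz by (simp add: divide_simps) (simp add: power2_eq_square)
  also have "\<dots> = gap v w"
    unfolding g1 id[symmetric] using nz by (simp add: divide_simps)
  finally show ?thesis by simp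
qed

end

section \<open>Convergence in sectors\<close>

context markoff_map begin

definition h :: "int \<times> int \<Rightarrow> complex" where "h v = Ln (F (\<phi> v))"

text \<open>In the sectors with large, growing values, this quantity dominates the middle summand as
  well as the logarithm of \<open>gap\<close>, and its total over the two halves of the sector is at
  most half as large (\<open>steep_weight\<close>).\<close>

definition weight :: "int \<times> int \<Rightarrow> int \<times> int \<Rightarrow> real" where
  "weight v w = 1 / (cmod (\<phi> v) * cmod (\<phi> w))"

lemma exp_h: "primitive v \<Longrightarrow> exp (h v) = F (\<phi> v)"
  unfolding h_def F_def using F_parts_nonzero[of v] by (intro exp_Ln) simp

text \<open>The identity is stated for exponentials because the sum of logarithms determines
  \<open>gap\<close> only up to multiples of \<open>2 * pi * \<i>\<close>.\<close>

definition conv :: "int \<times> int \<Rightarrow> int \<times> int \<Rightarrow> bool" where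
  "conv v w \<longleftrightarrow> (\<lambda>u. norm (h u)) summable_on sector v w \<and> exp (infsum h (sector v w)) = gap v w"

lemma sector_split_sums:
  assumes "vdet v w = 1" "(\<lambda>u. norm (h u)) summable_on sector v (v + w)" "(\<lambda>u. norm (h u)) summable_on sector (v + w) w"
  shows "(\<lambda>u. norm (h u)) summable_on sector v w"
    and "infsum h (sector v w) = h (v + w) + infsum h (sector v (v + w)) + infsum h (sector (v + w) w)"
proof -
  note dj = sector_split_disjoint[OF assms(1)]
  have 1: "(\<lambda>u. norm (h u)) summable_on sector v (v + w) \<union> sector (v + w) w"
    using assms dj by (intro summable_on_Un_disjoint)
  then show "(\<lambda>u. norm (h u)) summable_on sector v w"
    using dj by (simp add: sector_split[OF assms(1)] summable_on_insert_iff)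
  have "infsum h (sector v w) = h (v + w) + infsum h (sector v (v + w) \<union> sector (v + w) w)"
    using dj 1 unfolding sector_split[OF assms(1)] by (intro infsum_insert) (auto intro: abs_summable_summable)
  also have "infsum h (sector v (v + w) \<union> sector (v + w) w) =
      infsum h (sector v (v + w)) + infsum h (sector (v + w) w)"
    using dj assms by (intro infsum_Un_disjoint) (auto intro: abs_summable_summable)
  finally show "infsum h (sector v w) = h (v + w) + infsum h (sector v (v + w)) + infsum h (sector (v + w) w)"
    by (simp add: add.assoc)
qed

lemma conv_split:
  assumes "vdet v w = 1" "conv v (v + w)" "conv (v + w) w"
  shows "conv v w"
proof -
  have "primitive (v + w)" using add_in_sector[OF assms(1)] by (simp add: sector_def)
  then show ?thesis
    using assms sector_split_sums[of v w] unfolding conv_def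
    by (auto simp: exp_add exp_h gap_split[OF assms(1)] mult_ac)
qed

section \<open>Estimates for large values\<close>

lemma norm_h_large:
  assumes "8 * cmod (1 / E) \<le> (cmod (\<phi> v))\<^sup>2" "32 * cmod (E - 1 / E) \<le> (cmod (\<phi> v))\<^sup>2"
    and "primitive v"
  shows "cmod (h v) \<le> 16 * cmod (E - 1 / E) / (cmod (\<phi> v))\<^sup>2" "cmod (h v) \<le> 1 / 2"
proof -
  define t where "t = (E - 1 / E) / (1 / E + (ev v)\<^sup>2)"
  have pos: "(cmod (\<phi> v))\<^sup>2 > 0" using nonzero[OF assms(3)] by simp
  have "F (\<phi> v) = 1 + t"
    using F_parts_nonzero[OF assms(3)] by (simp add: F_def t_def field_simps)
  have "(cmod (\<phi> v) / 2)\<^sup>2 \<le> (cmod (ev v))\<^sup>2"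
    by (intro power_mono norm_le_eigen) auto
  then have "(cmod (\<phi> v))\<^sup>2 / 4 \<le> cmod ((ev v)\<^sup>2)" by (simp add: power_divide norm_power)
  moreover have "cmod ((ev v)\<^sup>2) \<le> cmod (1 / E + (ev v)\<^sup>2) + cmod (1 / E)"
    using norm_triangle_ineq4[of "1 / E + (ev v)\<^sup>2" "1 / E"] by simp
  \<comment> \<open>The square of the eigenvalue has modulus at least a quarter of
    \<open>(cmod (\<phi> v))\<^sup>2\<close>, and \<open>1 / E\<close> can remove at most an
    eighth.\<close>
  ultimately have d: "(cmod (\<phi> v))\<^sup>2 / 8 \<le> cmod (1 / E + (ev v)\<^sup>2)" using assms(1) by linarith
  have d0: "cmod (1 / E + (ev v)\<^sup>2) > 0" using d pos by linarith
  have t: "cmod t \<le> cmod (E - 1 / E) / ((cmod (\<phi> v))\<^sup>2 / 8)"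
    unfolding t_def norm_divide using d d0 pos by (intro divide_left_mono mult_pos_pos) auto
  moreover have "cmod (E - 1 / E) / ((cmod (\<phi> v))\<^sup>2 / 8) \<le> 1 / 4"
    using assms(2) pos by (simp add: field_simps)
  ultimately have t4: "cmod t \<le> 1 / 4" by linarith
  then have "cmod (Ln (1 + t)) \<le> 2 * cmod t" by (intro norm_Ln_le) simp
  then have hb: "cmod (h v) \<le> 2 * cmod t" by (simp add: h_def \<open>F (\<phi> v) = 1 + t\<close>)
  then show "cmod (h v) \<le> 1 / 2" using t4 by linarith
  show "cmod (h v) \<le> 16 * cmod (E - 1 / E) / (cmod (\<phi> v))\<^sup>2" using hb t by simp
qed

text \<open>Expanding \<open>\<kappa> (\<phi> v) * \<kappa> (\<phi> w)\<close> shows that the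
  estimated expression is the numerator of \<open>gap v w - 1\<close> divided by
  \<open>E - 1\<close>. The main point is that \<open>t\<close> is close to \<open>r\<close>, its
  limit along the fan of \<open>v\<close>. The bound involves \<open>w\<close> alone; exchanging the
  roles of \<open>v\<close> and \<open>w\<close> yields the companion bound.\<close>

lemma gap_error_term:
  assumes d: "\<bar>vdet v w\<bar> = 1" and large: "8 \<le> cmod (\<phi> v)" "8 \<le> cmod (\<phi> w)"
    "4 * cmod (E - 1) \<le> (cmod (\<phi> v))\<^sup>2" "cmod \<mu> \<le> (cmod (\<phi> v))\<^sup>2"
    and le: "cmod (\<phi> (v - w)) \<le> cmod (\<phi> (v + w))"
  defines "r \<equiv> 1 / (1 + (ev v)\<^sup>2)" and "s \<equiv> 1 / (1 + (ev w)\<^sup>2)" and "t \<equiv> \<phi> (v - w) / (\<phi> v * \<phi> w)"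
  shows "cmod (t - r - s - (E - 1) * r * s) \<le> 12 / (cmod (\<phi> w))\<^sup>2" "cmod ((E - 1) * r) \<le> 1 / 2"
proof -
  define x y z z' l where "x = \<phi> v" and "y = \<phi> w" and "z = \<phi> (v + w)" and "z' = \<phi> (v - w)" and "l = ev v"
  note defs = x_def y_def z_def z'_def l_def
  have l: "l \<noteq> 0" "x = l + 1 / l" "cmod l \<ge> 1" using eigen_add_inverse[of "\<phi> v"] norm_eigen_ge_1 by (auto simp: l_def x_def)
  have nz: "x \<noteq> 0" "y \<noteq> 0" using large by (auto simp: x_def y_def)
  have zz: "z * z' = x\<^sup>2 + y\<^sup>2 - \<mu>" "z + z' = x * y"
    using mult_neighbours[OF d] edge_abs[OF d] by (auto simp: defs)
  have rb: "cmod r \<le> 2 / (cmod x)\<^sup>2" "cmod s \<le> 2 / (cmod y)\<^sup>2"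
  proof -
    have *: "cmod (1 / (1 + (eigen a)\<^sup>2)) \<le> 2 / (cmod a)\<^sup>2" if "a \<noteq> 0" for a
    proof -
      have "(cmod a)\<^sup>2 / 2 \<le> cmod a * cmod (eigen a)"
        using norm_le_eigen[of a] mult_left_mono[of "cmod a / 2" "cmod (eigen a)" "cmod a"]
        by (simp add: power2_eq_square)
      then show ?thesis using that unfolding one_plus_eigen_sq norm_divide norm_mult
        by (simp add: field_simps)
    qed
    show "cmod r \<le> 2 / (cmod x)\<^sup>2" "cmod s \<le> 2 / (cmod y)\<^sup>2" using * nz by (auto simp: r_def s_def defs)
  qed
  show kr: "cmod ((E - 1) * r) \<le> 1 / 2"
  proof -
    have "cmod ((E - 1) * r) \<le> cmod (E - 1) * (2 / (cmod x)\<^sup>2)"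
      unfolding norm_mult using rb by (intro mult_left_mono) auto
    also have "\<dots> \<le> 1 / 2" using large nz by (simp add: defs field_simps)
    finally show ?thesis .
  qed
  have xy: "cmod x * cmod y / 2 \<le> cmod z"
  proof -
    have "cmod x * cmod y \<le> cmod z + cmod z'" using norm_triangle_ineq[of z z'] by (simp add: zz norm_mult)
    then show ?thesis using le by (simp add: defs)
  qed
  have low: "cmod x * cmod y / 4 \<le> cmod (z - y / l)"
  proof -
    have "cmod (y / l) \<le> cmod y" using l(3) by (simp add: norm_divide divide_le_eq mult_le_cancel_left1)
    moreover have "8 * cmod y \<le> cmod x * cmod y" using large by (intro mult_right_mono) (auto simp: defs)
    moreover have "cmod z \<le> cmod (z - y / l) + cmod (y / l)" using norm_triangle_ineq[of "z - y / l" "y / l"] by simp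
    moreover have "0 \<le> cmod x * cmod y" by simp
    ultimately show ?thesis using xy by linarith
  qed
  \<comment> \<open>Up to sign this is the product of the growth coefficients in the two directions
    of the fan around \<open>v\<close>. As the outward factor is large, \<open>z'\<close> must be
    close to \<open>y / l\<close>.\<close>
  have prod: "(z - y / l) * (y / l - z') = \<mu> - x\<^sup>2"
  proof -
    define c where "c = y / l"
    have yc: "y = c * l" "x * l = l\<^sup>2 + 1" using l(1) by (auto simp: c_def l(2) field_simps power2_eq_square)
    have "(z - c) * (c - z') = (z + z') * c - c\<^sup>2 - z * z'" by algebra
    also have "\<dots> = x * y * c - c\<^sup>2 - (x\<^sup>2 + y\<^sup>2 - \<mu>)" using zz by simp
    also have "\<dots> = \<mu> - x\<^sup>2" using yc by algebra
    finally show ?thesis by (simp add: c_def)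
  qed
  have tr: "cmod (t - r) \<le> 8 / (cmod y)\<^sup>2"
  proof -
    have "r = 1 / (x * l)" unfolding r_def one_plus_eigen_sq by (simp add: defs)
    then have "t - r = (z' - y / l) / (x * y)" using nz l(1) by (simp add: t_def field_simps flip: defs)
    then have "cmod (t - r) = cmod (z' - y / l) / (cmod x * cmod y)" by (simp add: norm_divide norm_mult)
    moreover have "cmod (z' - y / l) \<le> 2 * (cmod x)\<^sup>2 / (cmod x * cmod y / 4)"
    proof -
      have p: "cmod x * cmod y / 4 > 0" using nz by simp
      have "cmod (z' - y / l) * (cmod x * cmod y / 4) \<le> cmod (z' - y / l) * cmod (z - y / l)"
        using low by (intro mult_left_mono) auto
      also have "\<dots> = cmod (\<mu> - x\<^sup>2)"
        unfolding prod[symmetric] norm_mult by (simp add: norm_minus_commute mult.commute)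
      also have "\<dots> \<le> 2 * (cmod x)\<^sup>2"
        using norm_triangle_ineq4[of \<mu> "x\<^sup>2"] large by (simp add: defs norm_power)
      finally show ?thesis using p by (simp only: pos_le_divide_eq)
    qed
    ultimately have "cmod (t - r) \<le> 2 * (cmod x)\<^sup>2 / (cmod x * cmod y / 4) / (cmod x * cmod y)"
      by (metis divide_right_mono mult_nonneg_nonneg norm_ge_zero)
    also have "\<dots> = 8 / (cmod y)\<^sup>2" using nz by (simp add: field_simps power2_eq_square)
    finally show ?thesis .
  qed
  have "t - r - s - (E - 1) * r * s = (t - r) - s * (1 + (E - 1) * r)" by (simp add: algebra_simps)
  then have "cmod (t - r - s - (E - 1) * r * s) \<le> cmod (t - r) + cmod s * cmod (1 + (E - 1) * r)"
    by (metis norm_mult norm_triangle_ineq4)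
  also have "cmod s * cmod (1 + (E - 1) * r) \<le> 2 / (cmod y)\<^sup>2 * 2"
    using rb kr norm_triangle_ineq[of 1 "(E - 1) * r"] by (intro mult_mono) auto
  finally show "cmod (t - r - s - (E - 1) * r * s) \<le> 12 / (cmod (\<phi> w))\<^sup>2" using tr by (simp add: defs)
qed

text \<open>The error \<open>q\<close> is symmetric in \<open>v\<close> and \<open>w\<close>, so
  \<open>gap_error_term\<close> bounds it in two ways; the geometric mean of the two bounds is
  \<open>12 * weight v w\<close>. Each factor \<open>\<kappa>\<close> has modulus at least
  \<open>1 / 2\<close>, which turns 12 into 48.\<close>

lemma norm_gap_minus_1:
  assumes d: "\<bar>vdet v w\<bar> = 1" and large: "8 \<le> cmod (\<phi> v)" "8 \<le> cmod (\<phi> w)"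
    "4 * cmod (E - 1) \<le> (cmod (\<phi> v))\<^sup>2" "cmod \<mu> \<le> (cmod (\<phi> v))\<^sup>2"
    "4 * cmod (E - 1) \<le> (cmod (\<phi> w))\<^sup>2" "cmod \<mu> \<le> (cmod (\<phi> w))\<^sup>2"
    and le: "cmod (\<phi> (v - w)) \<le> cmod (\<phi> (v + w))"
  shows "cmod (gap v w - 1) \<le> 48 * cmod (E - 1) * weight v w"
proof -
  define r s t q where "r = 1 / (1 + (ev v)\<^sup>2)" and "s = 1 / (1 + (ev w)\<^sup>2)"
    and "t = \<phi> (v - w) / (\<phi> v * \<phi> w)" and "q = t - r - s - (E - 1) * r * s"
  have d': "\<bar>vdet w v\<bar> = 1" using d vdet_swap[of w v] by simp
  have q1: "cmod q \<le> 12 / (cmod (\<phi> w))\<^sup>2" and k1: "cmod ((E - 1) * r) \<le> 1 / 2"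
    using gap_error_term[OF d large(1-4) le] by (auto simp: r_def s_def t_def q_def)
  have le': "cmod (\<phi> (w - v)) \<le> cmod (\<phi> (w + v))" using le diff_sym[OF d] by (simp add: add.commute)
  have q2: "cmod q \<le> 12 / (cmod (\<phi> v))\<^sup>2" and k2: "cmod ((E - 1) * s) \<le> 1 / 2"
    using gap_error_term[OF d' large(2,1,5,6) le'] diff_sym[OF d]
    by (auto simp: r_def s_def t_def q_def mult_ac diff_diff_eq add.commute)
  have "(cmod q)\<^sup>2 \<le> 12 / (cmod (\<phi> w))\<^sup>2 * (12 / (cmod (\<phi> v))\<^sup>2)"
    unfolding power2_eq_square[of "cmod q"] using q1 q2 by (intro mult_mono) auto
  also have "\<dots> = (12 * weight v w)\<^sup>2" by (simp add: weight_def power_mult_distrib power_divide)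
  finally have q: "cmod q \<le> 12 * weight v w" by (rule power2_le_imp_le) (simp add: weight_def)
  have half: "1 / 2 \<le> cmod (1 + a)" if "cmod a \<le> 1 / 2" for a
    using norm_triangle_ineq4[of "1 + a" a] that by simp
  have \<kappa>: "\<kappa> (\<phi> v) = 1 + (E - 1) * r" "\<kappa> (\<phi> w) = 1 + (E - 1) * s"
    by (auto simp: \<kappa>_def r_def s_def)
  have nz: "1 + (E - 1) * r \<noteq> 0" "1 + (E - 1) * s \<noteq> 0"
    using half[OF k1] half[OF k2] by auto
  have "gap v w = (1 + (E - 1) * t) / ((1 + (E - 1) * r) * (1 + (E - 1) * s))"
    by (simp add: gap_def \<kappa> t_def)
  then have "gap v w - 1 = (E - 1) * q / ((1 + (E - 1) * r) * (1 + (E - 1) * s))"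
    using nz by (simp add: q_def divide_simps) (simp add: algebra_simps)
  then have "cmod (gap v w - 1) = cmod (E - 1) * cmod q / (cmod (1 + (E - 1) * r) * cmod (1 + (E - 1) * s))"
    by (simp add: norm_mult norm_divide)
  also have "\<dots> \<le> cmod (E - 1) * (12 * weight v w) / (1 / 2 * (1 / 2))"
    using q half[OF k1] half[OF k2] nz by (intro frac_le mult_mono) (auto simp: weight_def)
  finally show ?thesis by simp
qed

section \<open>Sectors with growing values\<close>

definition \<M> :: real where
  "\<M> = 8 + 8 * cmod (1 / E) + 196 * cmod (E - 1) + cmod \<mu> + 32 * cmod (E - 1 / E)"

text \<open>The first summand is the constant of \<open>norm_h_large\<close>; the second is twice
  the constant 48 of \<open>norm_gap_minus_1\<close>, the factor 2 coming from passing to the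
  logarithm.\<close>

definition \<C> :: real where
  "\<C> = 16 * cmod (E - 1 / E) + 96 * cmod (E - 1)"

text \<open>Both ends are large, and the modulus does not decrease when the edge \<open>v, w\<close>
  is crossed into the sector. These properties are inherited by both halves
  (\<open>steep_child\<close>), so the values grow throughout the sector.\<close>

definition steep :: "int \<times> int \<Rightarrow> int \<times> int \<Rightarrow> bool" where
  "steep v w \<longleftrightarrow> vdet v w = 1 \<and> \<M> \<le> cmod (\<phi> v) \<and> \<M> \<le> cmod (\<phi> w) \<and>
     cmod (\<phi> (v - w)) \<le> cmod (\<phi> (v + w))"

lemma outward_growth:
  assumes "\<bar>vdet v w\<bar> = 1" "cmod (\<phi> (v - w)) \<le> cmod (\<phi> (v + w))"
  shows "cmod (\<phi> v) * cmod (\<phi> w) / 2 \<le> cmod (\<phi> (v + w))"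
  using edge_abs[OF assms(1)] norm_triangle_ineq[of "\<phi> (v + w)" "\<phi> (v - w)"] assms(2)
  by (simp add: norm_mult)

text \<open>The edge relation at \<open>v\<close> and \<open>v + w\<close> gives that
  \<open>2 * cmod (\<phi> (v + w))\<close> is at most the sum of the moduli at
  \<open>v + (v + w)\<close> and at \<open>w\<close>, and the latter is already at most
  \<open>cmod (\<phi> (v + w))\<close>.\<close>

lemma outward_step:
  assumes d: "\<bar>vdet v w\<bar> = 1" and le: "cmod (\<phi> (v - w)) \<le> cmod (\<phi> (v + w))"
    and x: "2 \<le> cmod (\<phi> v)"
  shows "cmod (\<phi> w) \<le> cmod (\<phi> (v + w))" "cmod (\<phi> (v - (v + w))) \<le> cmod (\<phi> (v + (v + w)))"
proof -
  have "cmod (\<phi> w) * 2 \<le> cmod (\<phi> w) * cmod (\<phi> v)" using x by (intro mult_left_mono) auto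
  then show 1: "cmod (\<phi> w) \<le> cmod (\<phi> (v + w))" using outward_growth[OF d le] by (simp add: mult.commute)
  have d': "\<bar>vdet v (v + w)\<bar> = 1" using d by simp
  have e: "\<phi> (v - (v + w)) = \<phi> w" using minus[OF primitive_if_vdet'[OF d]] by simp
  have "cmod (\<phi> (v + w)) * 2 \<le> cmod (\<phi> (v + w)) * cmod (\<phi> v)" using x by (intro mult_left_mono) auto
  also have "\<dots> \<le> cmod (\<phi> (v + (v + w))) + cmod (\<phi> w)"
    using edge_abs[OF d'] norm_triangle_ineq[of "\<phi> (v + (v + w))" "\<phi> w"] unfolding e
    by (simp add: norm_mult mult.commute)
  finally show "cmod (\<phi> (v - (v + w))) \<le> cmod (\<phi> (v + (v + w)))" using 1 unfolding e by linarith
qed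

lemma outward_step':
  assumes d: "\<bar>vdet v w\<bar> = 1" and le: "cmod (\<phi> (v - w)) \<le> cmod (\<phi> (v + w))"
    and y: "2 \<le> cmod (\<phi> w)"
  shows "cmod (\<phi> v) \<le> cmod (\<phi> (v + w))" "cmod (\<phi> (v + w - w)) \<le> cmod (\<phi> (v + w + w))"
proof -
  have d': "\<bar>vdet w v\<bar> = 1" using d vdet_swap[of w v] by simp
  have le': "cmod (\<phi> (w - v)) \<le> cmod (\<phi> (w + v))" using le diff_sym[OF d] by (simp add: add.commute)
  show "cmod (\<phi> v) \<le> cmod (\<phi> (v + w))" using outward_step(1)[OF d' le' y] by (simp add: add.commute)
  have "\<phi> (w - (w + v)) = \<phi> v" using minus[OF primitive_if_vdet[OF d]] by simp
  then show "cmod (\<phi> (v + w - w)) \<le> cmod (\<phi> (v + w + w))"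
    using outward_step(2)[OF d' le' y] by (simp add: add_ac)
qed

text \<open>Since \<open>\<M>\<close> is at least 8, \<open>a\<close> is at most
  \<open>a\<^sup>2\<close>, and each bound follows from one summand of \<open>\<M>\<close>. The
  factor 192 is 4 times 48: it keeps \<open>gap\<close> within \<open>1 / 4\<close> of 1 in
  \<open>steep_gap\<close>.\<close>

lemma \<M>_ge:
  assumes "\<M> \<le> a"
  shows "8 \<le> a" "8 * cmod (1 / E) \<le> a\<^sup>2" "4 * cmod (E - 1) \<le> a\<^sup>2" "192 * cmod (E - 1) \<le> a\<^sup>2"
    "cmod \<mu> \<le> a\<^sup>2" "32 * cmod (E - 1 / E) \<le> a\<^sup>2"
proof -
  have *: "8 + 8 * cmod (1 / E) + 196 * cmod (E - 1) + cmod \<mu> + 32 * cmod (E - 1 / E) \<le> a"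
    using assms by (simp add: \<M>_def)
  have nn: "cmod (1 / E) \<ge> 0" "cmod (E - 1) \<ge> 0" "cmod \<mu> \<ge> 0" "cmod (E - 1 / E) \<ge> 0" by simp_all
  show a: "8 \<le> a" using * nn by linarith
  then have "a \<le> a\<^sup>2" unfolding power2_eq_square by (simp add: mult_le_cancel_left1)
  then show "8 * cmod (1 / E) \<le> a\<^sup>2" "4 * cmod (E - 1) \<le> a\<^sup>2" "192 * cmod (E - 1) \<le> a\<^sup>2"
    "cmod \<mu> \<le> a\<^sup>2" "32 * cmod (E - 1 / E) \<le> a\<^sup>2" using * nn by linarith+
qed

lemma steep_child:
  assumes "steep v w" shows "steep v (v + w)" "steep (v + w) w"
proof -
  have d: "\<bar>vdet v w\<bar> = 1" "vdet v w = 1" and le: "cmod (\<phi> (v - w)) \<le> cmod (\<phi> (v + w))"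
    and m: "\<M> \<le> cmod (\<phi> v)" "\<M> \<le> cmod (\<phi> w)" using assms by (auto simp: steep_def)
  have "2 \<le> cmod (\<phi> v)" "2 \<le> cmod (\<phi> w)" using \<M>_ge(1)[OF m(1)] \<M>_ge(1)[OF m(2)] by auto
  then show "steep v (v + w)" "steep (v + w) w"
    using outward_step[OF d(1) le] outward_step'[OF d(1) le] m d by (auto simp: steep_def simp del: add_diff_cancel_right')
qed

text \<open>The new value has modulus at least half the product of the old moduli, hence at least
  four times each of them. Each half of the sector therefore has at most a quarter of the
  weight.\<close>

lemma steep_weight:
  assumes "steep v w"
  shows "weight v (v + w) + weight (v + w) w \<le> weight v w / 2" "1 / (cmod (\<phi> (v + w)))\<^sup>2 \<le> weight v w / 2"
    "weight v w * 64 \<le> 1"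
proof -
  define x y z where "x = cmod (\<phi> v)" and "y = cmod (\<phi> w)" and "z = cmod (\<phi> (v + w))"
  have x: "x \<ge> 8" and y: "y \<ge> 8" using assms \<M>_ge(1) by (auto simp: steep_def x_def y_def)
  have z: "x * y / 2 \<le> z" using outward_growth[of v w] assms by (simp add: steep_def x_def y_def z_def)
  have xy: "x * y \<ge> 8 * 8" using x y by (intro mult_mono) auto
  have zx: "z \<ge> 4 * y" "z \<ge> 4 * x"
  proof -
    have "8 * y \<le> x * y" using x y by (intro mult_right_mono) auto
    moreover have "x * 8 \<le> x * y" using x y by (intro mult_left_mono) auto
    ultimately show "z \<ge> 4 * y" "z \<ge> 4 * x" using z by linarith+
  qed
  have z0: "z > 0" using zx x by linarith
  have "1 / (x * z) \<le> 1 / (x * (4 * y))"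
    using zx x y z0 by (intro divide_left_mono mult_left_mono mult_pos_pos) auto
  moreover have "1 / (z * y) \<le> 1 / (4 * x * y)"
    using zx x y z0 by (intro divide_left_mono mult_right_mono mult_pos_pos) auto
  ultimately show "weight v (v + w) + weight (v + w) w \<le> weight v w / 2"
    using x y by (simp add: weight_def flip: x_def y_def z_def)
  show "weight v w * 64 \<le> 1" using xy by (simp add: weight_def flip: x_def y_def)
  have "x * y / 2 * (4 * 8) \<le> z * z" using z zx x y xy by (intro mult_mono) auto
  then have "2 * (x * y) \<le> z\<^sup>2" using xy by (simp add: power2_eq_square)
  then have "1 / z\<^sup>2 \<le> 1 / (2 * (x * y))" using xy z0
    by (intro divide_left_mono mult_pos_pos[of "2 * (x * y)"]) auto
  then show "1 / (cmod (\<phi> (v + w)))\<^sup>2 \<le> weight v w / 2" by (simp add: weight_def flip: x_def y_def z_def)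
qed

lemma steep_h:
  assumes "steep v w" shows "cmod (h (v + w)) \<le> \<C> * weight v w / 2" "cmod (h (v + w)) \<le> 1 / 2"
proof -
  have "\<M> \<le> cmod (\<phi> (v + w))" using steep_child(1)[OF assms] by (simp add: steep_def)
  note m = \<M>_ge[OF this]
  have p: "primitive (v + w)" using add_in_sector[of v w] assms by (simp add: steep_def sector_def)
  note hh = norm_h_large[OF m(2) m(6) p]
  show "cmod (h (v + w)) \<le> 1 / 2" by (rule hh)
  have "cmod (h (v + w)) \<le> 16 * cmod (E - 1 / E) * (1 / (cmod (\<phi> (v + w)))\<^sup>2)" using hh by simp
  also have "\<dots> \<le> 16 * cmod (E - 1 / E) * (weight v w / 2)"
    using steep_weight(2)[OF assms] by (intro mult_left_mono) auto
  also have "\<dots> \<le> \<C> * (weight v w / 2)" by (intro mult_right_mono) (auto simp: \<C>_def weight_def)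
  finally show "cmod (h (v + w)) \<le> \<C> * weight v w / 2" by simp
qed

lemma steep_gap:
  assumes "steep v w" shows "cmod (Ln (gap v w)) \<le> \<C> * weight v w" "cmod (Ln (gap v w)) \<le> 1 / 2"
proof -
  have m: "\<M> \<le> cmod (\<phi> v)" "\<M> \<le> cmod (\<phi> w)" using assms by (auto simp: steep_def)
  note m1 = \<M>_ge[OF m(1)] note m2 = \<M>_ge[OF m(2)]
  have g: "cmod (gap v w - 1) \<le> 48 * cmod (E - 1) * weight v w"
    using assms m1 m2 by (intro norm_gap_minus_1) (auto simp: steep_def)
  also have "\<dots> \<le> 1 / 4"
  proof -
    have "192 * cmod (E - 1) \<le> \<M>" by (simp add: \<M>_def)
    also have "\<M> \<le> cmod (\<phi> v) * 1" using m by simp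
    also have "\<dots> \<le> cmod (\<phi> v) * cmod (\<phi> w)" using m1 m2 by (intro mult_left_mono) auto
    finally have "192 * cmod (E - 1) \<le> cmod (\<phi> v) * cmod (\<phi> w)" .
    moreover have "cmod (\<phi> v) * cmod (\<phi> w) > 0" using m1 m2 by (intro mult_pos_pos) auto
    ultimately show ?thesis by (simp add: weight_def field_simps)
  qed
  finally have q: "cmod (gap v w - 1) \<le> 1 / 4" .
  then have "cmod (Ln (1 + (gap v w - 1))) \<le> 2 * cmod (gap v w - 1)" by (intro norm_Ln_le) simp
  then have l: "cmod (Ln (gap v w)) \<le> 2 * cmod (gap v w - 1)" by simp
  then show "cmod (Ln (gap v w)) \<le> 1 / 2" using q by linarith
  have "cmod (Ln (gap v w)) \<le> 96 * cmod (E - 1) * weight v w" using l g by simp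
  also have "\<dots> \<le> \<C> * weight v w" by (intro mult_right_mono) (auto simp: \<C>_def weight_def)
  finally show "cmod (Ln (gap v w)) \<le> \<C> * weight v w" .
qed

text \<open>The budget \<open>\<C> * weight v w\<close> suffices by induction: one half of it pays
  for the middle vector, the other half for the two subsectors. The induction runs over a bound for
  the coordinate sums of the members of the finite set, which drop whenever the sector is
  halved.\<close>

lemma steep_finite_sum:
  assumes "steep v w" "finite A" "A \<subseteq> sector v w"
  shows "(\<Sum>u\<in>A. cmod (h u)) \<le> \<C> * weight v w"
proof -
  have C0: "\<C> * weight v w \<ge> 0" for v w by (simp add: \<C>_def weight_def)
  have "\<exists>N. \<forall>u\<in>A. vdet v u + vdet u w \<le> int N"
  proof
    show "\<forall>u\<in>A. vdet v u + vdet u w \<le> int (nat (\<Sum>u\<in>A. vdet v u + vdet u w))"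
    proof
      fix u assume "u \<in> A"
      then have "vdet v u + vdet u w \<le> (\<Sum>u\<in>A. vdet v u + vdet u w)"
        using assms(2,3) by (intro member_le_sum) (auto simp: sector_def)
      then show "vdet v u + vdet u w \<le> int (nat (\<Sum>u\<in>A. vdet v u + vdet u w))" by simp
    qed
  qed
  then obtain N where "\<forall>u\<in>A. vdet v u + vdet u w \<le> int N" by blast
  then show ?thesis using assms
  proof (induction N arbitrary: v w A)
    case 0
    have "A = {}"
    proof (rule equals0I)
      fix u assume "u \<in> A"
      with 0 show False by (auto simp: sector_def dest!: bspec[of _ _ u])
    qed
    then show ?case using C0 by simp
  next
    case (Suc N)
    have d: "vdet v w = 1" using Suc.prems(2) by (simp add: steep_def)
    define B where "B = A \<inter> sector v (v + w)" define B' where "B' = A \<inter> sector (v + w) w"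
    have fin: "finite B" "finite B'" using Suc.prems by (auto simp: B_def B'_def)
    have "(\<Sum>u\<in>B. cmod (h u)) \<le> \<C> * weight v (v + w)"
    proof (rule Suc.IH)
      show "\<forall>u\<in>B. vdet v u + vdet u (v + w) \<le> int N"
      proof
        fix u assume u: "u \<in> B"
        then have "vdet v u + vdet u w \<le> int (Suc N)" "0 < vdet v u"
          using Suc.prems(1) by (auto simp: B_def sector_def)
        then show "vdet v u + vdet u (v + w) \<le> int N" using vdet_swap[of u v] by simp
      qed
    qed (use Suc.prems steep_child fin in \<open>auto simp: B_def\<close>)
    moreover have "(\<Sum>u\<in>B'. cmod (h u)) \<le> \<C> * weight (v + w) w"
    proof (rule Suc.IH)
      show "\<forall>u\<in>B'. vdet (v + w) u + vdet u w \<le> int N"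
      proof
        fix u assume u: "u \<in> B'"
        then have "vdet v u + vdet u w \<le> int (Suc N)" "0 < vdet u w"
          using Suc.prems(1) by (auto simp: B'_def sector_def)
        then show "vdet (v + w) u + vdet u w \<le> int N" using vdet_swap[of w u] by simp
      qed
    qed (use Suc.prems steep_child fin in \<open>auto simp: B'_def\<close>)
    moreover have "(\<Sum>u\<in>A. cmod (h u)) \<le> (\<Sum>u\<in>insert (v + w) (B \<union> B'). cmod (h u))"
      using Suc.prems(4) fin unfolding sector_split[OF d] by (intro sum_mono2) (auto simp: B_def B'_def)
    moreover have "(\<Sum>u\<in>insert (v + w) (B \<union> B'). cmod (h u))
        = cmod (h (v + w)) + ((\<Sum>u\<in>B. cmod (h u)) + (\<Sum>u\<in>B'. cmod (h u)))"
    proof -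
      have "v + w \<notin> B \<union> B'" "B \<inter> B' = {}"
        using sector_split_disjoint[OF d] by (auto simp: B_def B'_def)
      then show ?thesis using fin by (simp add: sum.union_disjoint)
    qed
    moreover have "\<C> * (weight v (v + w) + weight (v + w) w) \<le> \<C> * (weight v w / 2)"
      using steep_weight[OF Suc.prems(2)] by (intro mult_left_mono) (auto simp: \<C>_def)
    ultimately show ?case using steep_h[OF Suc.prems(2)] by (simp add: distrib_left)
  qed
qed

lemma steep_abs_summable:
  assumes "steep v w"
  shows "(\<lambda>u. norm (h u)) summable_on sector v w" "cmod (infsum h (sector v w)) \<le> \<C> * weight v w"
proof -
  show 1: "(\<lambda>u. norm (h u)) summable_on sector v w"
    by (rule nonneg_bdd_above_summable_on) (auto intro!: bdd_aboveI steep_finite_sum[OF assms])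
  have "infsum (\<lambda>u. cmod (h u)) (sector v w) \<le> \<C> * weight v w"
    using 1 by (rule infsum_le_finite_sums) (rule steep_finite_sum[OF assms])
  then show "cmod (infsum h (sector v w)) \<le> \<C> * weight v w"
    using norm_infsum_bound[OF 1] by linarith
qed

text \<open>All logarithms involved are small, so the relation between the values of \<open>gap\<close> holds for the
  logarithms themselves; the defect is additive and decays under subdivision.\<close>

lemma conv_if_steep:
  assumes "steep v w" shows "conv v w"
proof -
  define e where "e v w = infsum h (sector v w) - Ln (gap v w)" for v w
  have add: "e v w = e v (v + w) + e (v + w) w" if steep: "steep v w" for v w
  proof -
    have d: "vdet v w = 1" using steep by (simp add: steep_def)
    have g: "gap v w \<noteq> 0" "gap v (v + w) \<noteq> 0" "gap (v + w) w \<noteq> 0" by (rule gap_nonzero; simp add: d)+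
    have p: "primitive (v + w)" using add_in_sector[OF d] by (simp add: sector_def)
    have "Ln (gap v w) = Ln (gap v (v + w)) + h (v + w) + Ln (gap (v + w) w)"
    proof (rule exp_complex_eqI)
      show "exp (Ln (gap v w)) = exp (Ln (gap v (v + w)) + h (v + w) + Ln (gap (v + w) w))"
        using g by (simp add: exp_add exp_h[OF p] gap_split[OF d])
      have "\<bar>Im (Ln (gap v w))\<bar> \<le> 1 / 2" "\<bar>Im (Ln (gap v (v + w)))\<bar> \<le> 1 / 2"
        "\<bar>Im (Ln (gap (v + w) w))\<bar> \<le> 1 / 2" "\<bar>Im (h (v + w))\<bar> \<le> 1 / 2"
        using steep_gap(2)[OF steep] steep_gap(2)[OF steep_child(1)[OF steep]] steep_gap(2)[OF steep_child(2)[OF steep]] steep_h(2)[OF steep]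
        by (meson abs_Im_le_cmod order_trans)+
      then show "\<bar>Im (Ln (gap v w)) - Im (Ln (gap v (v + w)) + h (v + w) + Ln (gap (v + w) w))\<bar> < 2 * pi"
        using pi_gt3 by simp
    qed
    moreover note sector_split_sums(2)[OF d steep_abs_summable(1)[OF steep_child(1)[OF steep]]
        steep_abs_summable(1)[OF steep_child(2)[OF steep]]]
    ultimately show ?thesis by (simp add: e_def)
  qed
  have bound: "cmod (e v w) \<le> 2 * \<C> * weight v w / 2 ^ n" if "steep v w" for n v w
    using that
  proof (induction n arbitrary: v w)
    case 0
    have "cmod (e v w) \<le> cmod (infsum h (sector v w)) + cmod (Ln (gap v w))"
      unfolding e_def by (rule norm_triangle_ineq4)
    then show ?case using steep_abs_summable(2)[OF 0] steep_gap(1)[OF 0] by simp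
  next
    case (Suc n)
    have "cmod (e v w) \<le> cmod (e v (v + w)) + cmod (e (v + w) w)"
      unfolding add[OF Suc.prems] by (rule norm_triangle_ineq)
    also have "\<dots> \<le> 2 * \<C> * weight v (v + w) / 2 ^ n + 2 * \<C> * weight (v + w) w / 2 ^ n"
      using Suc.IH steep_child[OF Suc.prems] by (intro add_mono) auto
    also have "\<dots> = 2 * \<C> / 2 ^ n * (weight v (v + w) + weight (v + w) w)" by (simp add: field_simps)
    also have "\<dots> \<le> 2 * \<C> / 2 ^ n * (weight v w / 2)"
      using steep_weight(1)[OF Suc.prems] by (intro mult_left_mono) (auto simp: \<C>_def)
    finally show ?case by simp
  qed
  have "(\<lambda>n. 2 * \<C> * weight v w * (1 / 2) ^ n) \<longlonglongrightarrow> 2 * \<C> * weight v w * 0"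
    by (intro tendsto_mult tendsto_const LIMSEQ_power_zero) simp
  then have "(\<lambda>n. 2 * \<C> * weight v w / 2 ^ n) \<longlonglongrightarrow> 0" by (simp add: power_divide)
  then have "cmod (e v w) \<le> 0"
    using bound[OF assms] by (intro LIMSEQ_le_const) auto
  then have "infsum h (sector v w) = Ln (gap v w)" by (simp add: e_def)
  moreover have "gap v w \<noteq> 0" by (rule gap_nonzero) (use assms in \<open>simp add: steep_def\<close>)
  ultimately show ?thesis using steep_abs_summable(1)[OF assms] by (simp add: conv_def)
qed

end

section \<open>Exhausting a sector along a fan\<close>

lemma infsum_exhaustion:
  fixes h :: "'a \<Rightarrow> complex" and T B :: "nat \<Rightarrow> 'a set"
  assumes T: "\<And>n. T n = insert (p n) (B n \<union> T (Suc n))"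
    and disj: "\<And>n. p n \<notin> B n" "\<And>n. p n \<notin> T (Suc n)" "\<And>n. B n \<inter> T (Suc n) = {}"
    and exhaust: "\<And>u. \<exists>n. u \<notin> T n"
    and B: "\<And>n A. finite A \<Longrightarrow> A \<subseteq> B n \<Longrightarrow> (\<Sum>u\<in>A. cmod (h u)) \<le> c n"
    and p: "\<And>n. cmod (h (p n)) \<le> c n" and c: "summable c"
  shows "(\<lambda>u. norm (h u)) summable_on T n" and "(\<lambda>n. infsum h (T n)) \<longlonglongrightarrow> 0"
proof -
  have c0: "c n \<ge> 0" for n using order_trans[OF norm_ge_zero p] .
  have sub: "T (Suc n) \<subseteq> T n" for n using T[of n] by blast
  have mono: "T m \<subseteq> T n" if "n \<le> m" for n m
    using lift_Suc_antimono_le[of T, OF sub that] .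
  \<comment> \<open>Each step from \<open>T n\<close> to \<open>T (Suc n)\<close> removes one point
    and one block, both bounded by \<open>c n\<close>; this explains the factor 2.\<close>
  have part: "(\<Sum>u\<in>A. cmod (h u)) \<le> (\<Sum>i<N. 2 * c (i + n))"
    if "finite A" "A \<subseteq> T n" "A \<inter> T (n + N) = {}" for A n N
    using that
  proof (induction N arbitrary: n A)
    case 0
    then have "A = {}" by auto
    then show ?case by simp
  next
    case (Suc N)
    define A1 A2 where "A1 = A \<inter> B n" and "A2 = A \<inter> T (Suc n)"
    have fin: "finite A1" "finite A2" using Suc.prems by (auto simp: A1_def A2_def)
    have "(\<Sum>u\<in>A. cmod (h u)) \<le> (\<Sum>u\<in>insert (p n) (A1 \<union> A2). cmod (h u))"
      using Suc.prems(2) fin T[of n] by (intro sum_mono2) (auto simp: A1_def A2_def)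
    also have "\<dots> = cmod (h (p n)) + (\<Sum>u\<in>A1. cmod (h u)) + (\<Sum>u\<in>A2. cmod (h u))"
    proof -
      have "p n \<notin> A1 \<union> A2" "A1 \<inter> A2 = {}" using disj by (auto simp: A1_def A2_def)
      then show ?thesis using fin by (simp add: sum.union_disjoint)
    qed
    also have "\<dots> \<le> c n + c n + (\<Sum>i<N. 2 * c (i + Suc n))"
      using fin p B Suc.prems by (intro add_mono Suc.IH) (auto simp: A1_def A2_def)
    also have "\<dots> = (\<Sum>i<Suc N. 2 * c (i + n))"
      by (subst sum.lessThan_Suc_shift) simp
    finally show ?case .
  qed
  have c2: "summable (\<lambda>i. 2 * c (i + n))" for n
    using c by (intro summable_mult summable_ignore_initial_segment)
  have bound: "(\<Sum>u\<in>A. cmod (h u)) \<le> (\<Sum>i. 2 * c (i + n))" if A: "finite A" "A \<subseteq> T n" for A n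
  proof -
    obtain f where f: "\<And>u. u \<notin> T (f u)" using exhaust by metis
    define N where "N = Max (insert 0 (f ` A))"
    have "A \<inter> T (n + N) = {}"
    proof (intro equals0I)
      fix u assume u: "u \<in> A \<inter> T (n + N)"
      then have "f u \<le> N" using A unfolding N_def by (intro Max_ge) auto
      then have "T (n + N) \<subseteq> T (f u)" by (intro mono) simp
      then show False using u f by blast
    qed
    then have "(\<Sum>u\<in>A. cmod (h u)) \<le> (\<Sum>i<N. 2 * c (i + n))" using part A by blast
    also have "\<dots> \<le> (\<Sum>i. 2 * c (i + n))" using c0 by (intro sum_le_suminf c2) auto
    finally show ?thesis .
  qed
  show abs: "(\<lambda>u. norm (h u)) summable_on T n" for n
    by (rule nonneg_bdd_above_summable_on) (auto intro!: bdd_aboveI bound)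
  have "cmod (infsum h (T n)) \<le> (\<Sum>i. 2 * c (i + n))" for n
    using norm_infsum_bound[OF abs] infsum_le_finite_sums[OF abs bound] by (rule order_trans)
  moreover have "(\<lambda>n. \<Sum>i. 2 * c (i + n)) \<longlonglongrightarrow> 0"
  proof -
    have s: "summable (\<lambda>i. 2 * c i)" using c by (rule summable_mult)
    have "(\<lambda>n. (\<Sum>i. 2 * c i) - (\<Sum>i<n. 2 * c i)) \<longlonglongrightarrow> (\<Sum>i. 2 * c i) - (\<Sum>i. 2 * c i)"
      by (intro tendsto_diff tendsto_const summable_LIMSEQ s)
    then show ?thesis by (simp add: suminf_minus_initial_segment[OF s])
  qed
  ultimately show "(\<lambda>n. infsum h (T n)) \<longlonglongrightarrow> 0"
    by (rule Lim_null_comparison[OF always_eventually[OF allI]])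
qed

lemma tendsto_0_mult_bounded:
  fixes f g :: "'a \<Rightarrow> complex"
  assumes "(f \<longlongrightarrow> 0) F" "\<And>n. cmod (g n) \<le> B"
  shows "((\<lambda>n. g n * f n) \<longlongrightarrow> 0) F"
proof (rule Lim_null_comparison)
  show "\<forall>\<^sub>F n in F. cmod (g n * f n) \<le> B * cmod (f n)"
    by (intro always_eventually allI) (simp add: norm_mult mult_right_mono assms(2))
  have "((\<lambda>n. B * cmod (f n)) \<longlongrightarrow> B * 0) F"
    using assms(1) by (intro tendsto_mult tendsto_const tendsto_norm_zero)
  then show "((\<lambda>n. B * cmod (f n)) \<longlongrightarrow> 0) F" by simp
qed

context markoff_map begin

lemma gap_commute:
  assumes "\<bar>vdet v w\<bar> = 1" shows "gap w v = gap v w"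
  unfolding gap_def diff_sym[OF assms] by (simp add: mult.commute)

text \<open>The recurrence along the fan is solved by
  \<open>A * l ^ n + (Y 0 - A) * (1 / l) ^ n\<close>, where \<open>A\<close> is the growth
  coefficient divided by \<open>l - 1 / l\<close>; it is nonzero by
  \<open>growth_coeff_nonzero\<close>.\<close>

lemma neighbours_limit:
  assumes "\<bar>vdet v w\<bar> = 1"
  obtains A where "A \<noteq> 0" "(\<lambda>n. \<phi> (((+) v ^^ n) w) / ev v ^ n) \<longlonglongrightarrow> A"
proof -
  define l Y a A where "l = ev v" and "Y = (\<lambda>n. \<phi> (((+) v ^^ n) w))"
    and "a = \<phi> (v + w) - \<phi> w / ev v" and "A = a / (l - 1 / l)"
  have l: "l \<noteq> 0" "cmod l > 1" using ev_gt_1[OF primitive_if_vdet[OF assms]] by (auto simp: l_def)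
  have "l\<^sup>2 \<noteq> 1" using l(2) by (metis norm_one norm_power one_less_power less_irrefl pos2)
  then have ll: "l - 1 / l \<noteq> 0" using l by (simp add: field_simps power2_eq_square)
  have a: "a \<noteq> 0" using growth_coeff_nonzero[OF assms] by (simp add: a_def)
  have rec: "Y (Suc n) = Y n / l + l ^ n * a" for n
    using neighbours_growth[OF assms, of n] by (simp add: Y_def a_def l_def algebra_simps)
  have Aa: "a = A * (l - 1 / l)" using ll by (simp add: A_def)
  have Y: "Y n = A * l ^ n + (Y 0 - A) * (1 / l) ^ n" for n
  proof (induction n)
    case (Suc n)
    then show ?case unfolding rec Suc Aa using l(1) by (simp add: field_simps)
  qed simp
  have "Y n / l ^ n = A + (Y 0 - A) * (1 / l\<^sup>2) ^ n" for n
    unfolding Y[of n] using l(1) by (simp add: field_simps power2_eq_square power_mult_distrib)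
  moreover have "(\<lambda>n. A + (Y 0 - A) * (1 / l\<^sup>2) ^ n) \<longlonglongrightarrow> A + (Y 0 - A) * 0"
    using l by (intro tendsto_add tendsto_mult tendsto_const LIMSEQ_power_zero)
      (simp add: norm_divide norm_power one_less_power)
  ultimately have "(\<lambda>n. Y n / l ^ n) \<longlonglongrightarrow> A" by simp
  moreover have "A \<noteq> 0" using a ll by (simp add: A_def)
  ultimately show ?thesis using that by (simp add: Y_def l_def)
qed

lemma neighbours_lower_bound:
  assumes "\<bar>vdet v w\<bar> = 1"
  obtains c where "c > 0" "\<forall>\<^sub>F n in sequentially. c * cmod (ev v) ^ n \<le> cmod (\<phi> (((+) v ^^ n) w))"
proof -
  obtain A where A: "A \<noteq> 0" "(\<lambda>n. \<phi> (((+) v ^^ n) w) / ev v ^ n) \<longlonglongrightarrow> A"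
    using neighbours_limit[OF assms] by blast
  have "(\<lambda>n. cmod (\<phi> (((+) v ^^ n) w) / ev v ^ n)) \<longlonglongrightarrow> cmod A"
    using A(2) by (rule tendsto_norm)
  moreover have "cmod A / 2 < cmod A" using A by simp
  ultimately have "\<forall>\<^sub>F n in sequentially. cmod A / 2 < cmod (\<phi> (((+) v ^^ n) w) / ev v ^ n)"
    by (rule order_tendstoD(1))
  then have "\<forall>\<^sub>F n in sequentially. cmod A / 2 * cmod (ev v) ^ n \<le> cmod (\<phi> (((+) v ^^ n) w))"
  proof eventually_elim
    case (elim n)
    have "cmod (ev v) ^ n > 0" by simp
    then show ?case using elim by (simp add: norm_divide norm_power field_simps)
  qed
  then show ?thesis using A(1) that[of "cmod A / 2"] by simp
qed

lemma neighbours_at_top: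
  assumes "\<bar>vdet v w\<bar> = 1"
  shows "filterlim (\<lambda>n. cmod (\<phi> (((+) v ^^ n) w))) at_top sequentially"
proof -
  obtain c where c: "c > 0" "\<forall>\<^sub>F n in sequentially. c * cmod (ev v) ^ n \<le> cmod (\<phi> (((+) v ^^ n) w))"
    using neighbours_lower_bound[OF assms] by blast
  have "filterlim (\<lambda>n. cmod (ev v ^ n)) at_top sequentially"
    using ev_gt_1[OF primitive_if_vdet[OF assms]]
    by (rule filterlim_compose[OF filterlim_norm_at_top filterlim_realpow_sequentially_gt1])
  then have "filterlim (\<lambda>n. cmod (ev v) ^ n) at_top sequentially" by (simp add: norm_power)
  then have "filterlim (\<lambda>n. c * cmod (ev v) ^ n) at_top sequentially"
    using c(1) by (intro filterlim_tendsto_pos_mult_at_top[OF tendsto_const])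
  then show ?thesis using c(2) by (rule filterlim_at_top_mono)
qed

text \<open>Consecutive values along the fan have ratio tending to \<open>1 / l\<close>, so the
  numerator of \<open>gap\<close> tends to \<open>1 + (E - 1) / (x * l)\<close>. This equals
  \<open>\<kappa> x\<close>, because \<open>x * l = 1 + l\<^sup>2\<close>; the other factor
  \<open>\<kappa>\<close> tends to 1 because its argument tends to infinity.\<close>

lemma gap_tendsto_1:
  assumes d: "\<bar>vdet v w\<bar> = 1"
  shows "(\<lambda>n. gap v (((+) v ^^ n) w)) \<longlonglongrightarrow> 1"
proof -
  define l Y x where "l = ev v" and "Y = (\<lambda>n. \<phi> (((+) v ^^ n) w))" and "x = \<phi> v"
  have v: "primitive v" using primitive_if_vdet[OF d] .
  have l: "l \<noteq> 0" by (simp add: l_def)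
  have Y0: "Y n \<noteq> 0" for n unfolding Y_def
    by (intro nonzero primitive_if_vdet'[of v]) (simp add: d)
  obtain A where A: "A \<noteq> 0" "(\<lambda>n. Y n / l ^ n) \<longlonglongrightarrow> A"
    using neighbours_limit[OF d] unfolding l_def Y_def by blast
  have "(\<lambda>n. (Y n / l ^ n) / (Y (Suc n) / l ^ Suc n) / l) \<longlonglongrightarrow> A / A / l"
    by (rule tendsto_divide[OF tendsto_divide[OF A(2) LIMSEQ_Suc[OF A(2)] A(1)] tendsto_const l])
  moreover have "(Y n / l ^ n) / (Y (Suc n) / l ^ Suc n) / l = Y n / Y (Suc n)" for n
    using l Y0 by (simp add: divide_simps)
  ultimately have ratio: "(\<lambda>n. Y n / Y (Suc n)) \<longlonglongrightarrow> 1 / l" using A(1) by simp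
  have "filterlim (\<lambda>n. cmod (Y n)) at_top sequentially"
    using neighbours_at_top[OF d] unfolding Y_def .
  then have top: "filterlim (\<lambda>n. cmod (Y (Suc n))) at_top sequentially"
    by (simp only: filterlim_sequentially_Suc[of "\<lambda>n. cmod (Y n)"])
  have "(\<lambda>n. 1 / (Y (Suc n) * eigen (Y (Suc n)))) \<longlonglongrightarrow> 0"
  proof (rule Lim_null_comparison)
    have "cmod (1 / (Y (Suc n) * eigen (Y (Suc n)))) \<le> inverse (cmod (Y (Suc n)))" for n
      using norm_eigen_ge_1[of "Y (Suc n)"] Y0[of "Suc n"]
      by (simp add: norm_divide norm_mult divide_simps)
    then show "\<forall>\<^sub>F n in sequentially. cmod (1 / (Y (Suc n) * eigen (Y (Suc n)))) \<le> inverse (cmod (Y (Suc n)))"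
      by simp
    show "(\<lambda>n. inverse (cmod (Y (Suc n)))) \<longlonglongrightarrow> 0"
      using top by (rule tendsto_inverse_0_at_top)
  qed
  then have "(\<lambda>n. 1 + (E - 1) * (1 / (Y (Suc n) * eigen (Y (Suc n))))) \<longlonglongrightarrow> 1 + (E - 1) * 0"
    by (intro tendsto_add tendsto_mult[OF tendsto_const] tendsto_const)
  then have \<kappa>Y: "(\<lambda>n. \<kappa> (Y (Suc n))) \<longlonglongrightarrow> 1" by (simp add: \<kappa>_def one_plus_eigen_sq)
  have \<kappa>x: "\<kappa> x \<noteq> 0" "\<kappa> x = 1 + (E - 1) * (1 / l) / x"
    using \<kappa>_nonzero[OF v] by (auto simp: x_def \<kappa>_def one_plus_eigen_sq l_def mult.commute)
  have "(\<lambda>n. (1 + (E - 1) * (Y n / Y (Suc n)) / x) / (\<kappa> x * \<kappa> (Y (Suc n)))) \<longlonglongrightarrow>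
      (1 + (E - 1) * (1 / l) / x) / (\<kappa> x * 1)"
  proof (rule tendsto_divide)
    show "(\<lambda>n. 1 + (E - 1) * (Y n / Y (Suc n)) / x) \<longlonglongrightarrow> 1 + (E - 1) * (1 / l) / x"
      using nonzero[OF v]
      by (intro tendsto_add tendsto_const tendsto_divide[OF _ tendsto_const] tendsto_mult[OF tendsto_const ratio])
        (simp add: x_def)
    show "(\<lambda>n. \<kappa> x * \<kappa> (Y (Suc n))) \<longlonglongrightarrow> \<kappa> x * 1"
      by (rule tendsto_mult[OF tendsto_const \<kappa>Y])
  qed (use \<kappa>x in simp)
  moreover have "(1 + (E - 1) * (Y n / Y (Suc n)) / x) / (\<kappa> x * \<kappa> (Y (Suc n))) = gap v (((+) v ^^ Suc n) w)" for n
  proof -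
    have "\<phi> (v - ((+) v ^^ Suc n) w) = \<phi> (((+) v ^^ Suc n) w - v)"
      using diff_sym[of v "((+) v ^^ Suc n) w"] d by simp
    then have "\<phi> (v - ((+) v ^^ Suc n) w) = Y n" by (simp add: Y_def)
    then show ?thesis by (simp add: gap_def Y_def x_def mult.commute)
  qed
  ultimately have "(\<lambda>n. gap v (((+) v ^^ Suc n) w)) \<longlonglongrightarrow> 1" using \<kappa>x by simp
  then show ?thesis by (rule LIMSEQ_imp_Suc)
qed

text \<open>The quotient of \<open>exp (infsum h (T n))\<close> by \<open>g n\<close> does not
  depend on \<open>n\<close>: the block and the point removed contribute the same factors to both.
  It tends to 1, since the sums over the tails tend to 0 and \<open>g\<close> tends to 1.\<close>

lemma conv_exhaustion:
  assumes T: "\<And>n. T n = insert (p n) (B n \<union> T (Suc n))"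
    and disj: "\<And>n. p n \<notin> B n" "\<And>n. p n \<notin> T (Suc n)" "\<And>n. B n \<inter> T (Suc n) = {}"
    and exhaust: "\<And>u. \<exists>n. u \<notin> T n"
    and B: "\<And>n A. finite A \<Longrightarrow> A \<subseteq> B n \<Longrightarrow> (\<Sum>u\<in>A. cmod (h u)) \<le> c n"
    and p: "\<And>n. cmod (h (p n)) \<le> c n" "\<And>n. primitive (p n)" and c: "summable c"
    and Bg: "\<And>n. (\<lambda>u. norm (h u)) summable_on B n" "\<And>n. exp (infsum h (B n)) = gB n"
    and g: "\<And>n. g n = g (Suc n) * F (\<phi> (p n)) * gB n" "\<And>n. g n \<noteq> 0" "g \<longlonglongrightarrow> 1"
  shows "(\<lambda>u. norm (h u)) summable_on T 0 \<and> exp (infsum h (T 0)) = g 0"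
proof -
  note ex = infsum_exhaustion[OF T disj exhaust B p(1) c]
  have step: "exp (infsum h (T n)) / g n = exp (infsum h (T (Suc n))) / g (Suc n)" for n
  proof -
    have s: "h summable_on B n" "h summable_on T (Suc n)"
      using Bg(1) ex(1) by (auto intro: abs_summable_summable)
    have "infsum h (T n) = h (p n) + infsum h (B n \<union> T (Suc n))"
      unfolding T[of n] using s disj[of n] by (intro infsum_insert summable_on_Un_disjoint) auto
    also have "infsum h (B n \<union> T (Suc n)) = infsum h (B n) + infsum h (T (Suc n))"
      using s disj by (intro infsum_Un_disjoint)
    finally have "exp (infsum h (T n)) = F (\<phi> (p n)) * gB n * exp (infsum h (T (Suc n)))"
      by (simp add: exp_add exp_h[OF p(2)] Bg(2))
    then show ?thesis using g(1)[of n] g(2)[of n] g(2)[of "Suc n"] by (auto simp: field_simps)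
  qed
  have const: "exp (infsum h (T n)) / g n = exp (infsum h (T 0)) / g 0" for n
    by (induction n) (use step in auto)
  have "(\<lambda>n. exp (infsum h (T n)) / g n) \<longlonglongrightarrow> exp 0 / 1"
    by (intro tendsto_divide tendsto_exp ex(2) g(3)) auto
  moreover have "(\<lambda>n. exp (infsum h (T n)) / g n) = (\<lambda>_. exp (infsum h (T 0)) / g 0)"
    using const by (rule ext)
  ultimately have "exp (infsum h (T 0)) / g 0 = 1" by (simp add: LIMSEQ_const_iff)
  then show ?thesis using g(2)[of 0] ex(1) by simp
qed

text \<open>The values along the fan grow at least like the powers of \<open>cmod (ev v)\<close>, so
  a geometric series bounds both the weights of consecutive neighbours and the values of
  \<open>h\<close>. The comparison with \<open>2 * cmod (\<phi> v)\<close> prepares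
  \<open>opposite_small\<close>.\<close>

lemma neighbours_eventually_large:
  assumes d: "\<bar>vdet v w\<bar> = 1"
  obtains N c where "summable c"
    "\<And>n. n \<ge> N \<Longrightarrow> \<M> \<le> cmod (\<phi> (((+) v ^^ n) w))"
    "\<And>n. n \<ge> N \<Longrightarrow> 2 * cmod (\<phi> v) \<le> cmod (\<phi> (((+) v ^^ n) w))"
    "\<And>n. n \<ge> N \<Longrightarrow> \<C> / (cmod (\<phi> (((+) v ^^ Suc n) w)) * cmod (\<phi> (((+) v ^^ n) w))) \<le> c n"
    "\<And>n. n \<ge> N \<Longrightarrow> cmod (h (((+) v ^^ Suc n) w)) \<le> c n"
proof -
  define y where "y n = cmod (\<phi> (((+) v ^^ n) w))" for n
  define \<rho> where "\<rho> = cmod (ev v)"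
  have \<rho>: "\<rho> > 1" using ev_gt_1[OF primitive_if_vdet[OF d]] by (simp add: \<rho>_def)
  obtain c where c: "c > 0" "\<forall>\<^sub>F n in sequentially. c * \<rho> ^ n \<le> y n"
    using neighbours_lower_bound[OF d] unfolding y_def \<rho>_def by blast
  have top: "filterlim y at_top sequentially"
    using neighbours_at_top[OF d] unfolding y_def .
  have "\<forall>\<^sub>F n in sequentially. c * \<rho> ^ n \<le> y n \<and> \<M> \<le> y n \<and> 2 * cmod (\<phi> v) \<le> y n"
    using c(2) top by (intro eventually_conj) (auto simp: filterlim_at_top)
  then obtain N where N: "\<And>n. n \<ge> N \<Longrightarrow> c * \<rho> ^ n \<le> y n \<and> \<M> \<le> y n \<and> 2 * cmod (\<phi> v) \<le> y n"
    unfolding eventually_sequentially by blast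
  define e where "e n = \<C> / c\<^sup>2 * (1 / \<rho>\<^sup>2) ^ n" for n
  have "1 < \<rho>\<^sup>2" using \<rho> by (simp add: one_less_power)
  then have "summable (\<lambda>n. (1 / \<rho>\<^sup>2) ^ n)" using \<rho> by (intro summable_geometric) simp
  then have e: "summable e" unfolding e_def by (rule summable_mult)
  have C0: "\<C> \<ge> 0" by (simp add: \<C>_def)
  have lower: "\<C> / (a * b) \<le> e n" if "c * \<rho> ^ n \<le> a" "c * \<rho> ^ n \<le> b" for a b n
  proof -
    have pos: "c * \<rho> ^ n > 0" using c \<rho> by simp
    have "(c * \<rho> ^ n) * (c * \<rho> ^ n) \<le> a * b" using that pos by (intro mult_mono) auto
    moreover have "0 < a * b * ((c * \<rho> ^ n) * (c * \<rho> ^ n))"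
      using pos that by (intro mult_pos_pos[of "a * b"] mult_pos_pos[of a] mult_pos_pos[of "c * \<rho> ^ n"]) linarith+
    ultimately have "\<C> / (a * b) \<le> \<C> / ((c * \<rho> ^ n) * (c * \<rho> ^ n))"
      using C0 by (intro divide_left_mono)
    also have "\<dots> = e n" by (simp add: e_def power_mult_distrib power2_eq_square power_divide)
    finally show ?thesis .
  qed
  have low: "c * \<rho> ^ n \<le> y (Suc n)" if "n \<ge> N" for n
  proof -
    have "c * \<rho> ^ n \<le> c * \<rho> ^ Suc n" using c \<rho> by (intro mult_left_mono power_increasing) auto
    also have "\<dots> \<le> y (Suc n)" using N[of "Suc n"] that by simp
    finally show ?thesis .
  qed
  have hb: "cmod (h (((+) v ^^ Suc n) w)) \<le> e n" if "n \<ge> N" for n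
  proof -
    have "\<M> \<le> cmod (\<phi> (((+) v ^^ Suc n) w))" using N[of "Suc n"] that by (simp add: y_def)
    note m = \<M>_ge[OF this]
    have p: "primitive (((+) v ^^ Suc n) w)" by (rule primitive_if_vdet'[of v]) (simp add: d)
    have "cmod (h (((+) v ^^ Suc n) w)) \<le> 16 * cmod (E - 1 / E) / (y (Suc n) * y (Suc n))"
      using norm_h_large(1)[OF m(2) m(6) p] by (simp add: y_def power2_eq_square)
    also have "\<dots> \<le> \<C> / (y (Suc n) * y (Suc n))"
      by (intro divide_right_mono) (auto simp: \<C>_def)
    also have "\<dots> \<le> e n" using low[OF that] by (intro lower)
    finally show ?thesis .
  qed
  show ?thesis
  proof (rule that[OF e, of N])
    fix n assume n: "n \<ge> N"
    show "\<M> \<le> cmod (\<phi> (((+) v ^^ n) w))" "2 * cmod (\<phi> v) \<le> cmod (\<phi> (((+) v ^^ n) w))"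
      using N[OF n] by (auto simp: y_def)
    show "cmod (h (((+) v ^^ Suc n) w)) \<le> e n" by (rule hb[OF n])
    show "\<C> / (cmod (\<phi> (((+) v ^^ Suc n) w)) * cmod (\<phi> (((+) v ^^ n) w))) \<le> e n"
      using lower[of n "y (Suc n)" "y n"] low[OF n] N[OF n] by (simp add: y_def)
  qed
qed

text \<open>For consecutive members \<open>u'\<close> and \<open>u\<close> of a fan the opposite
  vertex \<open>u - u'\<close> is the centre of the fan. Its fixed value is eventually negligible,
  so the values grow across the edge and the sector between the two neighbours is steep.\<close>

lemma opposite_small:
  assumes d: "\<bar>vdet u u'\<bar> = 1" and "\<M> \<le> cmod (\<phi> u)" "2 * cmod (\<phi> (u - u')) \<le> cmod (\<phi> u')"
  shows "cmod (\<phi> (u - u')) \<le> cmod (\<phi> (u + u'))"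
proof -
  have "1 * cmod (\<phi> u') \<le> cmod (\<phi> u) * cmod (\<phi> u')"
    using \<M>_ge(1)[OF assms(2)] by (intro mult_right_mono) auto
  moreover have "cmod (\<phi> u) * cmod (\<phi> u') \<le> cmod (\<phi> (u + u')) + cmod (\<phi> (u - u'))"
    using edge_abs[OF d] norm_triangle_ineq[of "\<phi> (u + u')" "\<phi> (u - u')"] by (simp add: norm_mult)
  ultimately show ?thesis using assms(3) by linarith
qed

lemma vdet_funpow_right: "vdet u (((+) v ^^ n) w) = vdet u w + int n * vdet u v"
  by (induction n) (auto simp: algebra_simps)

text \<open>For \<open>vdet v u > 0\<close> the determinant of \<open>u\<close> with
  \<open>w + n v\<close> decreases by at least 1 at each step of the fan, so it cannot stay
  positive.\<close>

lemma not_in_sector_fan: "\<exists>n. u \<notin> sector v (((+) v ^^ (n + N)) w)"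
proof (rule ccontr)
  assume "\<not> ?thesis"
  then have "u \<in> sector v (((+) v ^^ (n + N)) w)" for n by blast
  then have "vdet v u > 0" "vdet u w + int (n + N) * vdet u v > 0" for n
    by (auto simp: sector_def vdet_funpow_right simp del: of_nat_add)
  then have "vdet v u \<ge> 1" "int (nat \<bar>vdet u w\<bar> + N) * vdet v u < vdet u w"
    using vdet_swap[of u v] by (force simp del: of_nat_add)+
  moreover from this(1) have "int (nat \<bar>vdet u w\<bar> + N) * 1 \<le> int (nat \<bar>vdet u w\<bar> + N) * vdet v u"
    by (intro mult_left_mono) auto
  moreover have "vdet u w \<le> int (nat \<bar>vdet u w\<bar> + N) * 1" by simp
  ultimately show False by linarith
qed

lemma not_in_sector_fan': "\<exists>n. u \<notin> sector (((+) w ^^ (n + N)) v) w"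
proof -
  obtain n where n: "- u \<notin> sector w (((+) w ^^ (n + N)) v)" using not_in_sector_fan by blast
  have "u \<notin> sector (((+) w ^^ (n + N)) v) w"
    using n vdet_swap[of u w] vdet_swap[of u "((+) w ^^ (n + N)) v"] by (auto simp: sector_def)
  then show ?thesis by blast
qed

text \<open>Up to the neighbours of \<open>v\<close>, the sector between \<open>v\<close> and a
  distant neighbour is the union of the sectors between consecutive neighbours further out, all of
  which are steep. Thus no path of subdivisions that always turns around \<open>v\<close> can remain
  divergent.\<close>

lemma conv_fan_left:
  assumes d: "vdet v w = 1" shows "\<exists>N. conv v (((+) v ^^ N) w)"
proof -
  have d': "\<bar>vdet v w\<bar> = 1" using d by simp
  obtain N c where c: "summable c"
    and big: "\<And>n. n \<ge> N \<Longrightarrow> \<M> \<le> cmod (\<phi> (((+) v ^^ n) w))"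
    "\<And>n. n \<ge> N \<Longrightarrow> 2 * cmod (\<phi> v) \<le> cmod (\<phi> (((+) v ^^ n) w))"
    and cb: "\<And>n. n \<ge> N \<Longrightarrow> \<C> / (cmod (\<phi> (((+) v ^^ Suc n) w)) * cmod (\<phi> (((+) v ^^ n) w))) \<le> c n"
    "\<And>n. n \<ge> N \<Longrightarrow> cmod (h (((+) v ^^ Suc n) w)) \<le> c n"
    using neighbours_eventually_large[OF d'] by metis
  define W where "W n = ((+) v ^^ (n + N)) w" for n
  have dW: "vdet v (W n) = 1" "vdet (W n) v = -1" for n using d vdet_swap[of w v] by (auto simp: W_def)
  have WS: "W (Suc n) = v + W n" for n by (simp add: W_def)
  have steep: "steep (v + W n) (W n)" for n
  proof -
    have "cmod (\<phi> (v + W n - W n)) \<le> cmod (\<phi> (v + W n + W n))"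
      using big(1)[of "Suc n + N"] big(2)[of "n + N"] dW
      by (intro opposite_small) (auto simp: W_def)
    then show ?thesis using big(1)[of "Suc n + N"] big(1)[of "n + N"] dW by (simp add: steep_def W_def)
  qed
  note split = sector_split[OF dW(1), folded WS] sector_split_disjoint[OF dW(1), folded WS]
  have "(\<lambda>u. norm (h u)) summable_on sector v (W 0) \<and> exp (infsum h (sector v (W 0))) = gap v (W 0)"
  proof (rule conv_exhaustion[where T = "\<lambda>n. sector v (W n)" and p = "\<lambda>n. W (Suc n)" and
        B = "\<lambda>n. sector (W (Suc n)) (W n)" and c = "\<lambda>n. c (n + N)" and
        gB = "\<lambda>n. gap (W (Suc n)) (W n)" and g = "\<lambda>n. gap v (W n)"]; (intro allI)?)
    fix n u and A :: "(int \<times> int) set"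
    have steep': "steep (W (Suc n)) (W n)" using steep by (simp add: WS)
    show "sector v (W n) = insert (W (Suc n)) (sector (W (Suc n)) (W n) \<union> sector v (W (Suc n)))"
      using split(1)[of n] by blast
    show "W (Suc n) \<notin> sector (W (Suc n)) (W n)" "W (Suc n) \<notin> sector v (W (Suc n))"
      "sector (W (Suc n)) (W n) \<inter> sector v (W (Suc n)) = {}" using split(2-4)[of n] by blast+
    show "\<exists>n. u \<notin> sector v (W n)" unfolding W_def by (rule not_in_sector_fan)
    show "cmod (h (W (Suc n))) \<le> c (n + N)" using cb(2)[of "n + N"] by (simp add: W_def)
    show "primitive (W (Suc n))" using primitive_if_vdet'[of v] dW by simp
    show "summable (\<lambda>n. c (n + N))" using c by (rule summable_ignore_initial_segment)
    show "(\<lambda>u. norm (h u)) summable_on sector (W (Suc n)) (W n)" by (rule steep_abs_summable(1)[OF steep'])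
    show "exp (infsum h (sector (W (Suc n)) (W n))) = gap (W (Suc n)) (W n)"
      using conv_if_steep[OF steep'] by (simp add: conv_def)
    show "gap v (W n) = gap v (W (Suc n)) * F (\<phi> (W (Suc n))) * gap (W (Suc n)) (W n)"
      unfolding WS by (rule gap_split[OF dW(1)])
    show "gap v (W n) \<noteq> 0" by (rule gap_nonzero) (simp add: dW)
    show "(\<lambda>n. gap v (W n)) \<longlonglongrightarrow> 1"
      unfolding W_def by (rule LIMSEQ_ignore_initial_segment) (rule gap_tendsto_1[OF d'])
    assume "finite A" "A \<subseteq> sector (W (Suc n)) (W n)"
    then have "(\<Sum>u\<in>A. cmod (h u)) \<le> \<C> * weight (W (Suc n)) (W n)" by (rule steep_finite_sum[OF steep'])
    also have "\<dots> \<le> c (n + N)" using cb(1)[of "n + N"] by (simp add: weight_def W_def)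
    finally show "(\<Sum>u\<in>A. cmod (h u)) \<le> c (n + N)" .
  qed
  then show ?thesis by (intro exI[of _ N]) (simp add: conv_def W_def)
qed

text \<open>The mirror image of \<open>conv_fan_left\<close>. Bases are oriented, so here the steep
  sectors have the nearer neighbour on the left, and the opposite vertex at their edge is
  \<open>- w\<close>.\<close>

lemma conv_fan_right:
  assumes d: "vdet v w = 1" shows "\<exists>N. conv (((+) w ^^ N) v) w"
proof -
  have d': "\<bar>vdet w v\<bar> = 1" using d vdet_swap[of w v] by simp
  obtain N c where c: "summable c"
    and big: "\<And>n. n \<ge> N \<Longrightarrow> \<M> \<le> cmod (\<phi> (((+) w ^^ n) v))"
    "\<And>n. n \<ge> N \<Longrightarrow> 2 * cmod (\<phi> w) \<le> cmod (\<phi> (((+) w ^^ n) v))"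
    and cb: "\<And>n. n \<ge> N \<Longrightarrow> \<C> / (cmod (\<phi> (((+) w ^^ Suc n) v)) * cmod (\<phi> (((+) w ^^ n) v))) \<le> c n"
    "\<And>n. n \<ge> N \<Longrightarrow> cmod (h (((+) w ^^ Suc n) v)) \<le> c n"
    using neighbours_eventually_large[OF d'] by metis
  define V where "V n = ((+) w ^^ (n + N)) v" for n
  have dV: "vdet (V n) w = 1" "vdet w (V n) = -1" for n using d vdet_swap[of w v] by (auto simp: V_def)
  have VS: "V (Suc n) = V n + w" for n by (simp add: V_def add.commute)
  have steep': "steep (V n) (V (Suc n))" for n
  proof -
    have "cmod (\<phi> (w + V n - V n)) \<le> cmod (\<phi> (w + V n + V n))"
      using big(1)[of "Suc n + N"] big(2)[of "n + N"] dV
      by (intro opposite_small) (auto simp: V_def)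
    moreover have "\<phi> (V n - (V n + w)) = \<phi> w"
      using minus[of w] primitive_if_vdet[of w v] d' by simp
    ultimately have "cmod (\<phi> (V n - V (Suc n))) \<le> cmod (\<phi> (V n + V (Suc n)))"
      by (simp add: VS add_ac)
    then show ?thesis using big(1)[of "Suc n + N"] big(1)[of "n + N"] dV by (simp add: steep_def VS) (simp add: V_def add.commute)
  qed
  note split = sector_split[OF dV(1), folded VS] sector_split_disjoint[OF dV(1), folded VS]
  have "(\<lambda>u. norm (h u)) summable_on sector (V 0) w \<and> exp (infsum h (sector (V 0) w)) = gap (V 0) w"
  proof (rule conv_exhaustion[where T = "\<lambda>n. sector (V n) w" and p = "\<lambda>n. V (Suc n)" and
        B = "\<lambda>n. sector (V n) (V (Suc n))" and c = "\<lambda>n. c (n + N)" and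
        gB = "\<lambda>n. gap (V n) (V (Suc n))" and g = "\<lambda>n. gap (V n) w"]; (intro allI)?)
    fix n u and A :: "(int \<times> int) set"
    note steep' = steep'[of n]
    show "sector (V n) w = insert (V (Suc n)) (sector (V n) (V (Suc n)) \<union> sector (V (Suc n)) w)"
      using split(1)[of n] by blast
    show "V (Suc n) \<notin> sector (V n) (V (Suc n))" "V (Suc n) \<notin> sector (V (Suc n)) w"
      "sector (V n) (V (Suc n)) \<inter> sector (V (Suc n)) w = {}" using split(2-4)[of n] by blast+
    show "\<exists>n. u \<notin> sector (V n) w" unfolding V_def by (rule not_in_sector_fan')
    show "cmod (h (V (Suc n))) \<le> c (n + N)" using cb(2)[of "n + N"] by (simp add: V_def)
    show "primitive (V (Suc n))" using primitive_if_vdet[of _ w] dV by simp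
    show "summable (\<lambda>n. c (n + N))" using c by (rule summable_ignore_initial_segment)
    show "(\<lambda>u. norm (h u)) summable_on sector (V n) (V (Suc n))" by (rule steep_abs_summable(1)[OF steep'])
    show "exp (infsum h (sector (V n) (V (Suc n)))) = gap (V n) (V (Suc n))"
      using conv_if_steep[OF steep'] by (simp add: conv_def)
    show "gap (V n) w = gap (V (Suc n)) w * F (\<phi> (V (Suc n))) * gap (V n) (V (Suc n))"
      unfolding VS using gap_split[OF dV(1), of n] by (simp add: mult_ac)
    show "gap (V n) w \<noteq> 0" by (rule gap_nonzero) (simp add: dV)
    have "gap (V n) w = gap w (V n)" for n by (rule gap_commute) (simp add: dV)
    moreover have "(\<lambda>n. gap w (V n)) \<longlonglongrightarrow> 1"
      unfolding V_def by (rule LIMSEQ_ignore_initial_segment) (rule gap_tendsto_1[OF d'])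
    ultimately show "(\<lambda>n. gap (V n) w) \<longlonglongrightarrow> 1" by simp
    assume "finite A" "A \<subseteq> sector (V n) (V (Suc n))"
    then have "(\<Sum>u\<in>A. cmod (h u)) \<le> \<C> * weight (V n) (V (Suc n))" by (rule steep_finite_sum[OF steep'])
    also have "\<dots> \<le> c (n + N)" using cb(1)[of "n + N"] by (simp add: weight_def V_def mult.commute)
    finally show "(\<Sum>u\<in>A. cmod (h u)) \<le> c (n + N)" .
  qed
  then show ?thesis by (intro exI[of _ N]) (simp add: conv_def V_def)
qed

end

text \<open>Along a path in the tree on which the values descend forever without leaving the region where
  they exceed \<open>2\<close> in modulus, the opposite values at each edge become asymptotically equal. At a turn of
  the path this forces the squares of the values towards \<open>4\<close>, hence \<open>\<mu> = 4\<close>.\<close>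

lemma endless_descent:
  fixes x y z z' :: "nat \<Rightarrow> complex"
  assumes edge: "\<And>n. z n + z' n = x n * y n"
    and vertex: "\<And>n. (x n)\<^sup>2 + (y n)\<^sup>2 + (z n)\<^sup>2 - x n * y n * z n = \<mu>"
    and large: "\<And>n. cmod (x n) > 2" "\<And>n. cmod (y n) > 2"
    and descent: "\<And>n. cmod (z n) < cmod (z' n)"
    and left: "\<And>n. L n \<Longrightarrow> x (Suc n) = x n \<and> y (Suc n) = z n \<and> z' (Suc n) = y n"
    and right: "\<And>n. \<not> L n \<Longrightarrow> x (Suc n) = z n \<and> y (Suc n) = y n \<and> z' (Suc n) = x n"
    and inf: "\<And>n. \<exists>m\<ge>n. L m" "\<And>n. \<exists>m\<ge>n. \<not> L m"
  shows "\<mu> = 4"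
proof -
  \<comment> \<open>These are the moduli on the triangle that is about to be left. The next triangle
    replaces \<open>z'\<close> by \<open>z\<close>, so \<open>S\<close> decreases by
    \<open>\<delta> n\<close>; being bounded below, it converges and \<open>\<delta>\<close> tends
    to 0.\<close>
  define S where "S n = cmod (x n) + cmod (y n) + cmod (z' n)" for n
  define \<delta> where "\<delta> n = cmod (z' n) - cmod (z n)" for n
  have S_Suc: "S (Suc n) = S n - \<delta> n" for n
    using left[of n] right[of n] by (cases "L n") (auto simp: S_def \<delta>_def)
  have dec: "decseq S" using descent by (intro decseq_SucI) (simp add: S_Suc \<delta>_def less_imp_le)
  obtain s where s: "S \<longlonglongrightarrow> s"
    using decseq_convergent[OF dec, of 0] by (auto simp: S_def)
  have S0: "S n \<le> S 0" for n using dec by (simp add: decseq_def)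
  have "(\<lambda>n. S n - S (Suc n)) \<longlonglongrightarrow> s - s" by (intro tendsto_diff s LIMSEQ_Suc[OF s])
  then have \<delta>0: "\<delta> \<longlonglongrightarrow> 0" by (simp add: S_Suc)
  have bd: "cmod (x n) \<le> S 0" "cmod (y n) \<le> S 0" "cmod (z' n) \<le> S 0" "cmod (z n) \<le> S 0" for n
  proof -
    have "0 \<le> cmod (x n)" "0 \<le> cmod (y n)" "0 \<le> cmod (z' n)" by simp_all
    then show "cmod (x n) \<le> S 0" "cmod (y n) \<le> S 0" "cmod (z' n) \<le> S 0" "cmod (z n) \<le> S 0"
      using S0[of n] descent[of n] unfolding S_def[of n] by linarith+
  qed
  \<comment> \<open>By the descent at the next step, \<open>z n\<close> is smaller in modulus than
    the end of the edge that it replaces; the other end exceeds 2.\<close>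
  have zxy: "2 * cmod (z n) \<le> cmod (x n * y n)" for n
  proof (cases "L n")
    case True
    have e: "x n * z n = z (Suc n) + y n" "cmod (z (Suc n)) < cmod (y n)"
      using left[OF True] edge[of "Suc n"] descent[of "Suc n"] by auto
    have "2 * cmod (z n) \<le> cmod (x n) * cmod (z n)" using large(1)[of n] by (intro mult_right_mono) auto
    also have "\<dots> < 2 * cmod (y n)"
      using e norm_triangle_ineq[of "z (Suc n)" "y n"] by (simp flip: norm_mult)
    also have "\<dots> \<le> cmod (x n) * cmod (y n)" using large(1)[of n] by (intro mult_right_mono) auto
    finally show ?thesis by (simp add: norm_mult)
  next
    case False
    have e: "z n * y n = z (Suc n) + x n" "cmod (z (Suc n)) < cmod (x n)"
      using right[OF False] edge[of "Suc n"] descent[of "Suc n"] by auto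
    have "cmod (z n) * 2 \<le> cmod (z n) * cmod (y n)" using large(2)[of n] by (intro mult_left_mono) auto
    also have "\<dots> < cmod (x n) * 2"
      using e norm_triangle_ineq[of "z (Suc n)" "x n"] by (simp flip: norm_mult)
    also have "\<dots> \<le> cmod (x n) * cmod (y n)" using large(2)[of n] by (intro mult_left_mono) auto
    finally show ?thesis by (simp add: norm_mult)
  qed
  \<comment> \<open>By \<open>zxy\<close> the sum of the opposite values has modulus at least
    \<open>2 * cmod (z n)\<close>. As the moduli of \<open>z n\<close> and \<open>z' n\<close> are
    almost equal, the parallelogram law leaves little room for their difference.\<close>
  have par: "(cmod (z' n - z n))\<^sup>2 \<le> 4 * S 0 * \<delta> n" for n
  proof -
    have "(cmod (z n + z' n))\<^sup>2 + (cmod (z' n - z n))\<^sup>2 = 2 * (cmod (z n))\<^sup>2 + 2 * (cmod (z' n))\<^sup>2"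
      unfolding cmod_power2 by (simp add: power2_eq_square algebra_simps)
    moreover have "(2 * cmod (z n))\<^sup>2 \<le> (cmod (z n + z' n))\<^sup>2"
      unfolding edge using zxy by (intro power_mono) auto
    ultimately have "(cmod (z' n - z n))\<^sup>2 \<le> 2 * (cmod (z' n))\<^sup>2 - 2 * (cmod (z n))\<^sup>2"
      by (simp add: power_mult_distrib)
    also have "\<dots> = 2 * (cmod (z' n) + cmod (z n)) * \<delta> n"
      by (simp add: \<delta>_def power2_eq_square algebra_simps)
    also have "\<dots> \<le> 2 * (S 0 + S 0) * \<delta> n"
      using bd[of n] descent[of n] by (intro mult_right_mono mult_left_mono add_mono) (auto simp: \<delta>_def)
    finally show ?thesis by simp
  qed
  have "(\<lambda>n. (cmod (z' n - z n))\<^sup>2) \<longlonglongrightarrow> 0"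
  proof (rule Lim_null_comparison)
    show "\<forall>\<^sub>F n in sequentially. norm ((cmod (z' n - z n))\<^sup>2) \<le> 4 * S 0 * \<delta> n" using par by simp
    have "(\<lambda>n. 4 * S 0 * \<delta> n) \<longlonglongrightarrow> 4 * S 0 * 0" by (intro tendsto_mult tendsto_const \<delta>0)
    then show "(\<lambda>n. 4 * S 0 * \<delta> n) \<longlonglongrightarrow> 0" by simp
  qed
  then have "(\<lambda>n. sqrt ((cmod (z' n - z n))\<^sup>2)) \<longlonglongrightarrow> sqrt 0" by (rule tendsto_real_sqrt)
  then have zz: "(\<lambda>n. z' n - z n) \<longlonglongrightarrow> 0" by (simp add: tendsto_norm_zero_iff)
  define p q where "p n = z n - x n * y n / 2" and "q n = z' n - x n * y n / 2" for n
  have pq: "p n = - (1 / 2) * (z' n - z n)" "q n = (1 / 2) * (z' n - z n)" for n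
    unfolding p_def q_def edge[of n, symmetric] by (auto simp: field_simps)
  have "(\<lambda>n. - (1 / 2) * (z' n - z n)) \<longlonglongrightarrow> - (1 / 2) * 0" "(\<lambda>n. (1 / 2) * (z' n - z n)) \<longlonglongrightarrow> (1 / 2) * 0"
    by (intro tendsto_mult tendsto_const zz)+
  then have p: "p \<longlonglongrightarrow> 0" and q: "q \<longlonglongrightarrow> 0" unfolding pq[abs_def] by simp_all
  define A where "A = {n. L n \<and> \<not> L (Suc n)}"
  have "\<exists>m\<ge>n. m \<in> A" for n
  proof -
    obtain m where m: "m \<ge> n" "L m" using inf(1) by blast
    define j where "j = (LEAST j. m \<le> j \<and> \<not> L j)"
    have j: "m \<le> j \<and> \<not> L j" using LeastI_ex[of "\<lambda>j. m \<le> j \<and> \<not> L j"] inf(2)[of m] unfolding j_def by blast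
    then obtain i where i: "j = Suc i" "m \<le> i" using m by (cases j) (auto simp: le_Suc_eq)
    have "L i" using not_less_Least[of i "\<lambda>j. m \<le> j \<and> \<not> L j"] i unfolding j_def[symmetric] by auto
    then show ?thesis using i j m by (auto simp: A_def intro!: exI[of _ i])
  qed
  then have fr: "\<exists>\<^sub>F n in sequentially. n \<in> A" unfolding frequently_sequentially by simp
  \<comment> \<open>Limits along this filter are limits through those times at which a left turn is
    followed by a right turn.\<close>
  define G where "G = inf sequentially (principal A)"
  have G: "G \<noteq> bot" using fr unfolding G_def trivial_limit_def eventually_inf_principal frequently_def by simp
  have Gle: "G \<le> sequentially" by (simp add: G_def)
  have evA: "\<forall>\<^sub>F n in G. n \<in> A" by (simp add: G_def eventually_inf_principal)
  have lim: "(f \<longlongrightarrow> l) G" if "f \<longlonglongrightarrow> l" for f :: "nat \<Rightarrow> complex" and l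
    using that Gle by (rule tendsto_mono[rotated])
  \<comment> \<open>Near such a turn, opposite values are almost equal at three consecutive edges.
    The four relations \<open>e1\<close> to \<open>e4\<close> express the values through each other;
    elimination gives \<open>l1\<close> and \<open>l2\<close>.\<close>
  have e1: "((\<lambda>n. z n - x n * y n / 2) \<longlongrightarrow> 0) G" using lim[OF p] by (simp add: p_def[abs_def])
  have e2: "((\<lambda>n. y n - x n * z n / 2) \<longlongrightarrow> 0) G"
    using lim[OF LIMSEQ_Suc[OF q]]
    by (rule Lim_transform_eventually) (use evA left in \<open>auto simp: q_def A_def elim!: eventually_mono\<close>)
  have e3: "((\<lambda>n. x n - z (Suc n) * z n / 2) \<longlongrightarrow> 0) G"
    using lim[OF LIMSEQ_Suc[OF LIMSEQ_Suc[OF q]]]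
    by (rule Lim_transform_eventually)
      (use evA left right in \<open>auto simp: q_def A_def elim!: eventually_mono\<close>)
  have e4: "((\<lambda>n. z (Suc n) - x n * z n / 2) \<longlongrightarrow> 0) G"
    using lim[OF LIMSEQ_Suc[OF p]]
    by (rule Lim_transform_eventually) (use evA left in \<open>auto simp: p_def A_def elim!: eventually_mono\<close>)
  note mult0 = tendsto_0_mult_bounded
  have bd2: "cmod (x n / 2) \<le> S 0" "cmod (z n / 2) \<le> S 0" for n
    unfolding norm_divide norm_numeral using bd(1,4)[of n] norm_ge_zero[of "x n"] by linarith+
  have "((\<lambda>n. (z n - x n * y n / 2) + x n / 2 * (y n - x n * z n / 2)) \<longlongrightarrow> 0 + 0) G"
    by (intro tendsto_add e1 mult0[OF e2 bd2(1)])
  moreover have "(z n - x n * y n / 2) + x n / 2 * (y n - x n * z n / 2) = z n * (1 - (x n)\<^sup>2 / 4)" for n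
    by (simp add: field_simps power2_eq_square)
  ultimately have l1: "((\<lambda>n. z n * (1 - (x n)\<^sup>2 / 4)) \<longlongrightarrow> 0) G" by simp
  have "((\<lambda>n. (x n - z (Suc n) * z n / 2) + z n / 2 * (z (Suc n) - x n * z n / 2)) \<longlongrightarrow> 0 + 0) G"
    by (intro tendsto_add e3 mult0[OF e4 bd2(2)])
  moreover have "(x n - z (Suc n) * z n / 2) + z n / 2 * (z (Suc n) - x n * z n / 2) = x n * (1 - (z n)\<^sup>2 / 4)" for n
    by (simp add: field_simps power2_eq_square)
  ultimately have l2: "((\<lambda>n. x n * (1 - (z n)\<^sup>2 / 4)) \<longlongrightarrow> 0) G" by simp
  have zbig: "cmod (z n) > 2" if "n \<in> A" for n using that left[of n] large(2)[of "Suc n"] by (simp add: A_def)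
  have cancel: "((\<lambda>n. b n) \<longlongrightarrow> 0) G" if "((\<lambda>n. a n * b n) \<longlongrightarrow> 0) G" "\<And>n. n \<in> A \<Longrightarrow> cmod (a n) > 2"
    for a b :: "nat \<Rightarrow> complex"
  proof (rule Lim_null_comparison)
    show "\<forall>\<^sub>F n in G. cmod (b n) \<le> cmod (a n * b n)"
      using evA
    proof eventually_elim
      case (elim n)
      then show ?case using that(2)[of n] mult_right_mono[of 1 "cmod (a n)" "cmod (b n)"] by (simp add: norm_mult)
    qed
    show "((\<lambda>n. cmod (a n * b n)) \<longlongrightarrow> 0) G" using that(1) by (rule tendsto_norm_zero)
  qed
  have x4: "((\<lambda>n. 1 - (x n)\<^sup>2 / 4) \<longlongrightarrow> 0) G" by (rule cancel[OF l1 zbig])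
  have z4: "((\<lambda>n. 1 - (z n)\<^sup>2 / 4) \<longlongrightarrow> 0) G" by (rule cancel[OF l2 large(1)])
  \<comment> \<open>Completing the square with respect to \<open>y n\<close> in the vertex relation
    writes the constant \<open>\<mu> - 4\<close> in terms of quantities that tend to 0.\<close>
  have "((\<lambda>n. (y n - x n * z n / 2) * (y n - x n * z n / 2) - 4 * ((1 - (x n)\<^sup>2 / 4) * (1 - (z n)\<^sup>2 / 4)))
      \<longlongrightarrow> 0 * 0 - 4 * (0 * 0)) G"
    by (intro tendsto_diff tendsto_mult tendsto_const e2 x4 z4)
  moreover have "(y n - x n * z n / 2) * (y n - x n * z n / 2) - 4 * ((1 - (x n)\<^sup>2 / 4) * (1 - (z n)\<^sup>2 / 4)) = \<mu> - 4" for n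
    unfolding vertex[of n, symmetric] by (simp add: field_simps power2_eq_square)
  ultimately have "((\<lambda>n. \<mu> - 4) \<longlongrightarrow> 0) G" by simp
  then show ?thesis using G by (simp add: tendsto_const_iff)
qed

lemma unbounded_if_growth:
  fixes a :: "nat \<Rightarrow> real"
  assumes mono: "\<And>n. a n \<le> a (Suc n)" and "a 0 > 0" "r > 1"
    and growth: "\<And>n. P n \<Longrightarrow> r * a n \<le> a (Suc n)" and inf: "\<And>n. \<exists>m\<ge>n. P m"
  shows "\<exists>n. \<forall>m\<ge>n. K \<le> a m"
proof -
  have inc: "a n \<le> a m" if "n \<le> m" for n m using lift_Suc_mono_le[of a, OF mono that] .
  have "\<exists>n. r ^ J * a 0 \<le> a n" for J
  proof (induction J)
    case (Suc J)
    then obtain n where n: "r ^ J * a 0 \<le> a n" by blast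
    obtain m where m: "m \<ge> n" "P m" using inf by blast
    have "r * (r ^ J * a 0) \<le> r * a m" using n inc[OF m(1)] \<open>r > 1\<close> by (intro mult_left_mono) auto
    then show ?case using growth[OF m(2)] by (intro exI[of _ "Suc m"]) (simp add: mult.assoc)
  qed auto
  moreover obtain J where "K / a 0 < r ^ J" using real_arch_pow[OF \<open>r > 1\<close>] by blast
  ultimately obtain n where "r ^ J * a 0 \<le> a n" "K \<le> r ^ J * a 0"
    using \<open>a 0 > 0\<close> by (metis less_imp_le pos_divide_less_eq)
  then show ?thesis using inc by (intro exI[of _ n]) (meson order_trans)
qed

text \<open>Members of the inner sector are positive combinations of \<open>v'\<close> and
  \<open>w'\<close>. A coordinate could vanish only if it vanished for both \<open>v'\<close> and
  \<open>w'\<close>, which their determinant 1 excludes.\<close>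

lemma sector_mono:
  assumes "vdet v w = 1" "vdet v' w' = 1"
    and "vdet v v' \<ge> 0" "vdet v' w \<ge> 0" "vdet v w' \<ge> 0" "vdet w' w \<ge> 0"
  shows "sector v' w' \<subseteq> sector v w"
proof
  fix u assume u: "u \<in> sector v' w'"
  define a b where "a = vdet u w'" and "b = vdet v' u"
  have ab: "a > 0" "b > 0" using u by (auto simp: sector_def a_def b_def)
  have "u = (a * fst v' + b * fst w', a * snd v' + b * snd w')"
    unfolding a_def b_def by (rule vdet_cramer[OF assms(2)])
  then have e: "vdet v u = a * vdet v v' + b * vdet v w'" "vdet u w = a * vdet v' w + b * vdet w' w"
    by (auto simp: vdet_def algebra_simps)
  have d: "1 = vdet v' w * vdet v w' - vdet v v' * vdet w' w"
    using vdet_cramer_det[OF assms(1), of v' w'] assms(2) by simp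
  have "vdet v u \<noteq> 0" "vdet u w \<noteq> 0"
    using ab assms(3-) d unfolding e by (auto simp: add_nonneg_eq_0_iff)
  moreover have "vdet v u \<ge> 0" "vdet u w \<ge> 0"
    using ab assms(3-) unfolding e by auto
  ultimately show "u \<in> sector v w" using u by (auto simp: sector_def)
qed

context markoff_map begin

lemma \<mu>_neq_4: "\<mu> \<noteq> 4"
proof
  assume "\<mu> = 4"
  then have "E * 4 = - (E - 1)\<^sup>2" using \<mu>_eq by simp
  then have "(E + 1)\<^sup>2 = 0" by algebra
  then have "E = -1" by (simp add: eq_neg_iff_add_eq_0)
  then show False using E1 by simp
qed

text \<open>If the values decrease across every edge of the path, \<open>endless_descent\<close>
  applies. Otherwise one edge is crossed without decrease, and then so are all later ones. From
  there on, each left turn multiplies the modulus at the right end by a fixed factor above 1, and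
  each right turn does so at the left end, so both eventually exceed \<open>\<M>\<close>.\<close>

lemma no_bad_path:
  assumes det: "\<And>n. vdet (V n) (W n) = 1"
    and left: "\<And>n. L n \<Longrightarrow> V (Suc n) = V n \<and> W (Suc n) = V n + W n"
    and right: "\<And>n. \<not> L n \<Longrightarrow> V (Suc n) = V n + W n \<and> W (Suc n) = W n"
    and large: "\<And>n. cmod (\<phi> (V n)) > 2" "\<And>n. cmod (\<phi> (W n)) > 2"
    and inf: "\<And>n. \<exists>m\<ge>n. L m" "\<And>n. \<exists>m\<ge>n. \<not> L m"
  shows "\<exists>n. steep (V n) (W n)"
proof (cases "\<exists>n. cmod (\<phi> (V n - W n)) \<le> cmod (\<phi> (V n + W n))")
  case False
  have "\<mu> = 4"
  proof (rule endless_descent[where x = "\<lambda>n. \<phi> (V n)" and y = "\<lambda>n. \<phi> (W n)" and z = "\<lambda>n. \<phi> (V n + W n)"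
        and z' = "\<lambda>n. \<phi> (V n - W n)" and L = L])
    fix n
    have d: "\<bar>vdet (V n) (W n)\<bar> = 1" using det by simp
    show "\<phi> (V n + W n) + \<phi> (V n - W n) = \<phi> (V n) * \<phi> (W n)" by (rule edge_abs[OF d])
    show "(\<phi> (V n))\<^sup>2 + (\<phi> (W n))\<^sup>2 + (\<phi> (V n + W n))\<^sup>2 - \<phi> (V n) * \<phi> (W n) * \<phi> (V n + W n) = \<mu>"
      by (rule vertex_abs[OF d])
    show "L n \<Longrightarrow> \<phi> (V (Suc n)) = \<phi> (V n) \<and> \<phi> (W (Suc n)) = \<phi> (V n + W n) \<and> \<phi> (V (Suc n) - W (Suc n)) = \<phi> (W n)"
      using left[of n] minus[of "W n"] primitive_if_vdet'[OF d] by simp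
    show "\<not> L n \<Longrightarrow> \<phi> (V (Suc n)) = \<phi> (V n + W n) \<and> \<phi> (W (Suc n)) = \<phi> (W n) \<and> \<phi> (V (Suc n) - W (Suc n)) = \<phi> (V n)"
      using right[of n] by simp
    show "cmod (\<phi> (V n + W n)) < cmod (\<phi> (V n - W n))" using False by (meson not_less)
  qed (use large inf in auto)
  then show ?thesis using \<mu>_neq_4 by simp
next
  case True
  then obtain n0 where n0: "cmod (\<phi> (V n0 - W n0)) \<le> cmod (\<phi> (V n0 + W n0))" by blast
  have out: "cmod (\<phi> (V (n + n0) - W (n + n0))) \<le> cmod (\<phi> (V (n + n0) + W (n + n0)))" for n
  proof (induction n)
    case (Suc n)
    have d: "\<bar>vdet (V (n + n0)) (W (n + n0))\<bar> = 1" using det by simp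
    show ?case
    proof (cases "L (n + n0)")
      case True
      then show ?thesis using left[OF True] outward_step(2)[OF d Suc] large(1)[of "n + n0"] by (simp add: less_imp_le)
    next
      case False
      then show ?thesis using right[OF False] outward_step'(2)[OF d Suc] large(2)[of "n + n0"] by (simp add: less_imp_le)
    qed
  qed (use n0 in simp)
  define x y where "x n = cmod (\<phi> (V (n + n0)))" and "y n = cmod (\<phi> (W (n + n0)))" for n
  have x2: "x n > 2" and y2: "y n > 2" for n using large by (auto simp: x_def y_def)
  have L: "x (Suc n) = x n \<and> x n * y n / 2 \<le> y (Suc n)" if "L (n + n0)" for n
    using left[OF that] outward_growth[OF _ out[of n]] det[of "n + n0"] by (simp add: x_def y_def)
  have R: "y (Suc n) = y n \<and> x n * y n / 2 \<le> x (Suc n)" if "\<not> L (n + n0)" for n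
    using right[OF that] outward_growth[OF _ out[of n]] det[of "n + n0"] by (simp add: x_def y_def)
  have xm: "x n \<le> x (Suc n)" and ym: "y n \<le> y (Suc n)" for n
  proof -
    have "2 * y n \<le> x n * y n" "x n * 2 \<le> x n * y n"
      using x2[of n] y2[of n] by (auto intro!: mult_right_mono mult_left_mono)
    then show "x n \<le> x (Suc n)" "y n \<le> y (Suc n)"
      using L[of n] R[of n] by (cases "L (n + n0)"; force)+
  qed
  have x0: "x 0 \<le> x n" and y0: "y 0 \<le> y n" for n
    using lift_Suc_mono_le[of x, OF xm] lift_Suc_mono_le[of y, OF ym] by auto
  have inf': "\<exists>m\<ge>n. L (m + n0)" "\<exists>m\<ge>n. \<not> L (m + n0)" for n
  proof -
    obtain m m' where m: "m \<ge> n + n0" "L m" "m' \<ge> n + n0" "\<not> L m'" using inf by metis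
    show "\<exists>m\<ge>n. L (m + n0)" using m(1,2) by (intro exI[of _ "m - n0"]) auto
    show "\<exists>m\<ge>n. \<not> L (m + n0)" using m(3,4) by (intro exI[of _ "m' - n0"]) auto
  qed
  have "\<exists>n. \<forall>m\<ge>n. \<M> \<le> y m"
  proof (rule unbounded_if_growth[of y "x 0 / 2" "\<lambda>n. L (n + n0)"])
    fix n assume "L (n + n0)"
    then have "x n * y n / 2 \<le> y (Suc n)" using L by blast
    moreover have "x 0 * y n \<le> x n * y n" using x0 y2[of n] by (intro mult_right_mono) auto
    ultimately show "x 0 / 2 * y n \<le> y (Suc n)" by simp
  qed (use ym y2[of 0] x2[of 0] inf' in auto)
  moreover have "\<exists>n. \<forall>m\<ge>n. \<M> \<le> x m"
  proof (rule unbounded_if_growth[of x "y 0 / 2" "\<lambda>n. \<not> L (n + n0)"])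
    fix n assume "\<not> L (n + n0)"
    then have "x n * y n / 2 \<le> x (Suc n)" using R by blast
    moreover have "x n * y 0 \<le> x n * y n" using y0 x2[of n] by (intro mult_left_mono) auto
    ultimately show "y 0 / 2 * x n \<le> x (Suc n)" by (simp add: mult.commute)
  qed (use xm y2[of 0] x2[of 0] inf' in auto)
  ultimately obtain n n' where "\<forall>m\<ge>n. \<M> \<le> y m" "\<forall>m\<ge>n'. \<M> \<le> x m" by blast
  then have "\<M> \<le> y (max n n')" "\<M> \<le> x (max n n')" by auto
  then have "steep (V (max n n' + n0)) (W (max n n' + n0))"
    using out det by (simp add: steep_def x_def y_def)
  then show ?thesis by blast
qed

text \<open>An argument in the style of Koenig's lemma: a sector violating \<open>conv\<close> has a
  half violating it. The fan lemmas force the resulting path to turn both ways infinitely often, and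
  by finiteness its ends eventually have values beyond 2; by \<open>no_bad_path\<close> it reaches a
  steep sector, where \<open>conv\<close> holds.\<close>

lemma conv_if_finite:
  assumes det0: "vdet v w = 1" and fin: "finite {u \<in> sector v w. cmod (\<phi> u) \<le> 2}"
  shows "conv v w"
proof (rule ccontr)
  assume nc: "\<not> conv v w"
  define step where "step = (\<lambda>(a, b). if \<not> conv a (a + b) then (a, a + b) else (a + b, b))"
  define P where "P n = (step ^^ n) (v, w)" for n
  define V W where "V n = fst (P n)" and "W n = snd (P n)" for n
  define L where "L n \<longleftrightarrow> \<not> conv (V n) (V n + W n)" for n
  have left: "V (Suc n) = V n \<and> W (Suc n) = V n + W n" if "L n" for n
    using that by (auto simp: L_def V_def W_def P_def step_def case_prod_unfold)
  have right: "V (Suc n) = V n + W n \<and> W (Suc n) = W n" if "\<not> L n" for n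
    using that by (auto simp: L_def V_def W_def P_def step_def case_prod_unfold)
  have 0: "V 0 = v" "W 0 = w" by (auto simp: V_def W_def P_def)
  have det: "vdet (V n) (W n) = 1" for n
  proof (induction n)
    case (Suc n)
    then show ?case using left[of n] right[of n] by (cases "L n") auto
  qed (simp add: 0 det0)
  have ncn: "\<not> conv (V n) (W n)" for n
  proof (induction n)
    case (Suc n)
    show ?case
    proof (cases "L n")
      case True then show ?thesis using left[OF True] by (simp add: L_def)
    next
      case False
      then show ?thesis using right[OF False] conv_split[OF det] Suc by (auto simp: L_def)
    qed
  qed (simp add: 0 nc)
  have infL: "\<exists>m\<ge>n. L m" for n
  proof (rule ccontr)
    assume "\<not> ?thesis"
    then have "\<not> L m" if "m \<ge> n" for m using that by blast
    then have "V (j + n) = ((+) (W n) ^^ j) (V n) \<and> W (j + n) = W n" for j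
      using right by (induction j) (auto simp: add.commute)
    then show False using conv_fan_right[OF det[of n]] ncn by metis
  qed
  have infR: "\<exists>m\<ge>n. \<not> L m" for n
  proof (rule ccontr)
    assume "\<not> ?thesis"
    then have "L m" if "m \<ge> n" for m using that by blast
    then have "W (j + n) = ((+) (V n) ^^ j) (W n) \<and> V (j + n) = V n" for j
      using left by (induction j) (auto simp: add.commute)
    then show False using conv_fan_left[OF det[of n]] ncn by metis
  qed
  define U where "U n = V n + W n" for n
  have nest: "sector (V (Suc n)) (W (Suc n)) \<subseteq> sector (V n) (W n)" "U n \<notin> sector (V (Suc n)) (W (Suc n))" for n
    using left[of n] right[of n] sector_split[OF det[of n]] sector_split_disjoint[OF det[of n]]
    by (cases "L n"; auto simp: U_def)+
  have nest': "sector (V m) (W m) \<subseteq> sector (V n) (W n)" if "n \<le> m" for n m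
    using lift_Suc_antimono_le[of "\<lambda>n. sector (V n) (W n)", OF nest(1) that] .
  have Uin: "U n \<in> sector (V n) (W n)" for n unfolding U_def by (rule add_in_sector[OF det])
  have "U m \<noteq> U n" if "n < m" for n m
    using nest(2)[of n] Uin[of m] nest'[of "Suc n" m] that by auto
  then have "inj U" by (intro injI) (metis linorder_neqE_nat)
  moreover have "U n \<in> sector v w" for n using Uin[of n] nest'[of 0 n] 0 by auto
  ultimately have "finite {n. cmod (\<phi> (U n)) \<le> 2}"
    by (intro finite_imageD[OF finite_subset[OF _ fin], of U]) (auto intro: inj_on_subset)
  then obtain n1 where "\<forall>n\<in>{n. cmod (\<phi> (U n)) \<le> 2}. n < n1" by (meson finite_nat_set_iff_bounded)
  then have n1: "cmod (\<phi> (U n)) > 2" if "n \<ge> n1" for n using that by (meson leD mem_Collect_eq not_le)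
  \<comment> \<open>After a left step the right end is the vector \<open>U\<close> just inserted,
    and later it is only ever replaced by newer such vectors; the same holds for the left end after
    a right step. Beyond \<open>n1\<close> all of them carry values above 2.\<close>
  obtain l r where lr: "l \<ge> n1" "L l" "r \<ge> n1" "\<not> L r" using infL infR by metis
  have Wbig: "cmod (\<phi> (W (n + Suc l))) > 2" for n
  proof (induction n)
    case 0 then show ?case using left[OF lr(2)] n1[OF lr(1)] by (simp add: U_def)
  next
    case (Suc n)
    then show ?case using left[of "n + Suc l"] right[of "n + Suc l"] n1[of "n + Suc l"] lr(1)
      by (cases "L (n + Suc l)") (auto simp: U_def)
  qed
  have Vbig: "cmod (\<phi> (V (n + Suc r))) > 2" for n
  proof (induction n)
    case 0 then show ?case using right[OF lr(4)] n1[OF lr(3)] by (simp add: U_def)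
  next
    case (Suc n)
    then show ?case using left[of "n + Suc r"] right[of "n + Suc r"] n1[of "n + Suc r"] lr(3)
      by (cases "L (n + Suc r)") (auto simp: U_def)
  qed
  define k where "k = Suc l + Suc r"
  have "\<exists>n. steep (V (n + k)) (W (n + k))"
  proof (rule no_bad_path[where L = "\<lambda>n. L (n + k)"])
    fix n
    show "vdet (V (n + k)) (W (n + k)) = 1" by (rule det)
    show "L (n + k) \<Longrightarrow> V (Suc n + k) = V (n + k) \<and> W (Suc n + k) = V (n + k) + W (n + k)"
      using left[of "n + k"] by simp
    show "\<not> L (n + k) \<Longrightarrow> V (Suc n + k) = V (n + k) + W (n + k) \<and> W (Suc n + k) = W (n + k)"
      using right[of "n + k"] by simp
    have e: "n + k = (n + Suc l) + Suc r" "n + k = (n + Suc r) + Suc l" by (simp_all add: k_def)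
    show "cmod (\<phi> (V (n + k))) > 2" unfolding e(1) by (rule Vbig)
    show "cmod (\<phi> (W (n + k))) > 2" unfolding e(2) by (rule Wbig)
    obtain m m' where m: "m \<ge> n + k" "L m" "m' \<ge> n + k" "\<not> L m'" using infL infR by metis
    show "\<exists>m\<ge>n. L (m + k)" using m(1,2) by (intro exI[of _ "m - k"]) auto
    show "\<exists>m\<ge>n. \<not> L (m + k)" using m(3,4) by (intro exI[of _ "m' - k"]) auto
  qed
  then show False using conv_if_steep ncn by blast
qed

text \<open>The tree is descended from the outer to the inner basis, and each step splits off the
  half that does not contain the inner sector; \<open>conv_if_finite\<close> applies to that half.
  Working with the difference is essential, since the inner sector may contain infinitely many small
  values.\<close>

lemma gap_telescope:
  assumes "vdet v w = 1" "vdet v' w' = 1"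
    and "vdet v v' \<ge> 0" "vdet v' w \<ge> 0" "vdet v w' \<ge> 0" "vdet w' w \<ge> 0"
    and "finite {u \<in> sector v w - sector v' w'. cmod (\<phi> u) \<le> 2}"
  shows "(\<lambda>u. norm (h u)) summable_on sector v w - sector v' w' \<and>
    exp (infsum h (sector v w - sector v' w')) * gap v' w' = gap v w"
  using assms
proof (induction "nat (vdet v v' + vdet v' w + vdet v w' + vdet w' w)" arbitrary: v w rule: less_induct)
  case less
  define p q r s where "p = vdet v' w" and "q = vdet w' w" and "r = vdet v v'" and "s = vdet v w'"
  have nn: "p \<ge> 0" "q \<ge> 0" "r \<ge> 0" "s \<ge> 0" using less.prems by (auto simp: p_def q_def r_def s_def)
  have d: "p * s - r * q = 1"
    using vdet_cramer_det[OF less.prems(1), of v' w'] less.prems(2) by (simp add: p_def q_def r_def s_def)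
  have cv: "v' = (p * fst v + r * fst w, p * snd v + r * snd w)"
    "w' = (q * fst v + s * fst w, q * snd v + s * snd w)"
    unfolding p_def q_def r_def s_def using vdet_cramer[OF less.prems(1)] by blast+
  have parts: "sector v w - sector v' w' = insert (v + w) (sector v (v + w) \<union> sector (v + w) w) - sector v' w'"
    using sector_split[OF less.prems(1)] by simp
  note dj = sector_split_disjoint[OF less.prems(1)]
  have pr: "primitive (v + w)" using add_in_sector[OF less.prems(1)] by (simp add: sector_def)
  have combine: ?case
    if D: "sector v w - sector v' w' = insert (v + w) (A \<union> B)" "v + w \<notin> A \<union> B" "A \<inter> B = {}"
      and A: "(\<lambda>u. norm (h u)) summable_on A" "exp (infsum h A) * g = g1"
      and B: "(\<lambda>u. norm (h u)) summable_on B" "exp (infsum h B) = g2"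
      and g: "gap v w = g1 * F (\<phi> (v + w)) * g2" "gap v' w' = g" for A B g g1 g2
  proof -
    have AB: "(\<lambda>u. norm (h u)) summable_on A \<union> B" using A(1) B(1) D(3) by (rule summable_on_Un_disjoint)
    then have "(\<lambda>u. norm (h u)) summable_on insert (v + w) (A \<union> B)" using D(2) by (simp add: summable_on_insert_iff)
    moreover have "infsum h (insert (v + w) (A \<union> B)) = h (v + w) + infsum h (A \<union> B)"
      using AB D(2) by (intro infsum_insert) (auto intro: abs_summable_summable)
    moreover have "infsum h (A \<union> B) = infsum h A + infsum h B"
      using A(1) B(1) D(3) by (intro infsum_Un_disjoint) (auto intro: abs_summable_summable)
    ultimately show ?thesis using A(2) B(2) g unfolding D(1)
      by (simp add: exp_add exp_h[OF pr] mult_ac)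
  qed
  \<comment> \<open>The vectors \<open>v'\<close> and \<open>w'\<close> have the coordinates
    \<open>(p, r)\<close> and \<open>(q, s)\<close>. In a nonnegative matrix of determinant 1 other
    than the identity one row dominates the other, so both vectors lie in the same closed half of
    the cone.\<close>
  consider "r = 0" "q = 0" | "p \<ge> r" "q \<ge> s" | "p \<le> r" "q \<le> s"
  proof (cases "r = 0 \<and> q = 0")
    case False
    have "\<not> (p > r \<and> q < s)"
    proof
      assume "p > r \<and> q < s"
      then have "(r + 1) * (q + 1) \<le> p * s" using nn by (intro mult_mono) auto
      then have "r + q \<le> 0" using d by (simp add: algebra_simps)
      then show False using nn False by auto
    qed
    moreover have "\<not> (p < r \<and> q > s)"
    proof
      assume "p < r \<and> q > s"
      then have "p * s \<le> r * q" using nn by (intro mult_mono) auto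
      then show False using d by simp
    qed
    ultimately show ?thesis using that by linarith
  qed (use that in blast)
  then show ?case
  proof cases
    case 1
    then have "p * s = 1" using d by simp
    then have "p = 1" "s = 1" using nn by (auto simp: zmult_eq_1_iff)
    then have "v' = v" "w' = w" using cv 1 by auto
    then show ?thesis by simp
  next
    case 2
    have rs: "r + s > 0" using d nn by (cases "r = 0"; cases "s = 0") auto
    have sub: "sector v' w' \<subseteq> sector v (v + w)"
      using less.prems(1,2) nn 2 vdet_swap[of v' v] vdet_swap[of w' v]
      by (intro sector_mono) (auto simp: p_def q_def r_def s_def)
    have fin: "finite {u \<in> sector v (v + w) - sector v' w'. cmod (\<phi> u) \<le> 2}"
      "finite {u \<in> sector (v + w) w. cmod (\<phi> u) \<le> 2}"
      using sector_split[OF less.prems(1)] sub dj by (auto intro!: finite_subset[OF _ less.prems(7)])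
    have IH: "(\<lambda>u. norm (h u)) summable_on sector v (v + w) - sector v' w' \<and>
        exp (infsum h (sector v (v + w) - sector v' w')) * gap v' w' = gap v (v + w)"
      using less.prems(1,2) nn 2 rs vdet_swap[of v' v] vdet_swap[of w' v] fin(1)
      by (intro less.hyps) (auto simp: p_def q_def r_def s_def)
    have "conv (v + w) w" using less.prems(1) fin(2) by (intro conv_if_finite) auto
    then show ?thesis using IH sub dj sector_split[OF less.prems(1)] gap_split[OF less.prems(1)]
      by (intro combine[where A = "sector v (v + w) - sector v' w'" and B = "sector (v + w) w"
            and g = "gap v' w'" and ?g1.0 = "gap v (v + w)" and ?g2.0 = "gap (v + w) w"])
        (auto simp: conv_def)
  next
    case 3
    have pq: "p + q > 0" using d nn by (cases "p = 0"; cases "q = 0") auto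
    have sub: "sector v' w' \<subseteq> sector (v + w) w"
      using less.prems(1,2) nn 3 vdet_swap[of v' w] vdet_swap[of w' w]
      by (intro sector_mono) (auto simp: p_def q_def r_def s_def)
    have fin: "finite {u \<in> sector (v + w) w - sector v' w'. cmod (\<phi> u) \<le> 2}"
      "finite {u \<in> sector v (v + w). cmod (\<phi> u) \<le> 2}"
      using sector_split[OF less.prems(1)] sub dj by (auto intro!: finite_subset[OF _ less.prems(7)])
    have IH: "(\<lambda>u. norm (h u)) summable_on sector (v + w) w - sector v' w' \<and>
        exp (infsum h (sector (v + w) w - sector v' w')) * gap v' w' = gap (v + w) w"
      using less.prems(1,2) nn 3 pq vdet_swap[of v' w] vdet_swap[of w' w] fin(1)
      by (intro less.hyps) (auto simp: p_def q_def r_def s_def)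
    have "conv v (v + w)" using less.prems(1) fin(2) by (intro conv_if_finite) auto
    then show ?thesis using IH sub dj sector_split[OF less.prems(1)] gap_split[OF less.prems(1)]
      by (intro combine[where A = "sector (v + w) w - sector v' w'" and B = "sector v (v + w)"
            and g = "gap v' w'" and ?g1.0 = "gap (v + w) w" and ?g2.0 = "gap v (v + w)"])
        (auto simp: conv_def)
  qed
qed

end

section \<open>A fundamental domain for a hyperbolic matrix\<close>

definition mact :: "int ^ 2 ^ 2 \<Rightarrow> int \<times> int \<Rightarrow> int \<times> int" where
  "mact H u = (H $ 1 $ 1 * fst u + H $ 1 $ 2 * snd u, H $ 2 $ 1 * fst u + H $ 2 $ 2 * snd u)"

definition same_up_to_sign :: "int \<times> int \<Rightarrow> int \<times> int \<Rightarrow> bool" where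
  "same_up_to_sign u u' \<longleftrightarrow> u' = u \<or> u' = - u"

text \<open>Equality of orbits up to sign under the cyclic group generated by \<open>H\<close>. Two
  natural exponents replace one integer exponent, so that no inverse matrix is needed.\<close>

definition orbit_rel :: "int ^ 2 ^ 2 \<Rightarrow> int \<times> int \<Rightarrow> int \<times> int \<Rightarrow> bool" where
  "orbit_rel H u u' \<longleftrightarrow> (\<exists>n m. same_up_to_sign ((mact H ^^ n) u) ((mact H ^^ m) u'))"

lemma mact_simps [simp]:
  "mact H (u + v) = mact H u + mact H v" "mact H (u - v) = mact H u - mact H v"
  "mact H (- u) = - mact H u" "mact (- H) u = - mact H u"
  by (auto simp: mact_def algebra_simps)

lemma vdet_mact: "vdet (mact H u) (mact H v) = det H * vdet u v"
  by (simp add: vdet_def mact_def det_2 algebra_simps)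

lemma vdet_mact_trace: "vdet (mact H v) w + vdet v (mact H w) = trace H * vdet v w"
  by (simp add: vdet_def mact_def trace_def sum_2 algebra_simps)

lemma funpow_mact_minus [simp]: "(mact H ^^ n) (- u) = - (mact H ^^ n) u"
  by (induction n) auto

lemma funpow_mact_uminus_matrix: "same_up_to_sign ((mact H ^^ n) u) ((mact (- H) ^^ n) u)"
  by (induction n) (auto simp: same_up_to_sign_def)

lemma mact_surj: "det H = 1 \<Longrightarrow> \<exists>u. mact H u = v"
proof
  assume "det H = 1"
  then have "H $ 1 $ 1 * H $ 2 $ 2 = 1 + H $ 1 $ 2 * H $ 2 $ 1" by (simp add: det_2)
  then have "H $ 1 $ 1 * H $ 2 $ 2 * fst v = (1 + H $ 1 $ 2 * H $ 2 $ 1) * fst v"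
    "H $ 1 $ 1 * H $ 2 $ 2 * snd v = (1 + H $ 1 $ 2 * H $ 2 $ 1) * snd v" by simp_all
  then show "mact H (H $ 2 $ 2 * fst v - H $ 1 $ 2 * snd v, H $ 1 $ 1 * snd v - H $ 2 $ 1 * fst v) = v"
    by (simp add: mact_def prod_eq_iff algebra_simps)
qed

lemma mact_inj: "det H = 1 \<Longrightarrow> mact H u = mact H v \<Longrightarrow> u = v"
proof -
  assume H: "det H = 1" and e: "mact H u = mact H v"
  have z: "mact H (u - v) = 0" using e by simp
  define x where "x = u - v"
  have "vdet x y = 0" for y
    using vdet_mact[of H x y] z H by (simp add: x_def vdet_def)
  from this[of "(1, 0)"] this[of "(0, 1)"] have "x = 0" by (simp add: vdet_def prod_eq_iff)
  then show "u = v" by (simp add: x_def)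
qed

lemma funpow_mact_inj: "det H = 1 \<Longrightarrow> (mact H ^^ n) u = (mact H ^^ n) v \<Longrightarrow> u = v"
  by (induction n) (auto dest: mact_inj)

lemma primitive_mact:
  assumes "det H = 1" "primitive u" shows "primitive (mact H u)"
proof -
  obtain w where "vdet u w = 1" using ex_vdet_eq_1[OF assms(2)] by blast
  then have "vdet (mact H u) (mact H w) = 1" using assms by (simp add: vdet_mact)
  then show ?thesis by (intro primitive_if_vdet[of _ "mact H w"]) simp
qed

lemma primitive_funpow_mact: "det H = 1 \<Longrightarrow> primitive u \<Longrightarrow> primitive ((mact H ^^ n) u)"
  by (induction n) (auto intro: primitive_mact)

text \<open>A primitive vector parallel to its image has eigenvalue 1 or -1. As the determinant is
  1, the other eigenvalue is the same, and the trace would be 2 or -2.\<close>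

lemma hyperbolic_no_eigenvector:
  assumes "det H = 1" "\<bar>trace H\<bar> > 2" "primitive u"
  shows "vdet u (mact H u) \<noteq> 0"
proof
  assume z: "vdet u (mact H u) = 0"
  obtain w where w: "vdet u w = 1" using ex_vdet_eq_1[OF assms(3)] by blast
  have "mact H u = u \<or> mact H u = - u"
    using primitive_parallel[OF primitive_mact[OF assms(1,3)] assms(3)] z vdet_swap[of u "mact H u"] by simp
  then obtain e :: int where e: "\<bar>e\<bar> = 1" "\<And>x. vdet (mact H u) x = e * vdet u x"
    by (metis abs_minus abs_one mult_1 mult_minus1 vdet_simps(5))
  have "e * vdet u (mact H w) = 1" using e(2)[of "mact H w"] vdet_mact[of H u w] assms(1) w by simp
  then have "vdet u (mact H w) = e" using e(1) by (auto simp: abs_if split: if_splits)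
  moreover have "e * vdet u w + vdet u (mact H w) = trace H"
    using vdet_mact_trace[of H u w] e(2)[of w] w by simp
  ultimately have "trace H = 2 * e" using w by simp
  then show False using assms(2) e(1) by (simp add: abs_mult)
qed

text \<open>Here \<open>x\<close> and \<open>y\<close> are the values of an indefinite form on a
  basis, \<open>B\<close> is its mixed coefficient, and \<open>x + y + e * B\<close> is its value on
  the sum or difference of the basis vectors. The positive discriminant makes
  \<open>\<bar>B\<bar>\<close> larger than the smaller of \<open>\<bar>x\<bar>\<close> and
  \<open>\<bar>y\<bar>\<close>. With \<open>e * B\<close> of sign opposite to \<open>x\<close>,
  either the sign changes or the new modulus is
  \<open>\<bar>x\<bar> + \<bar>y\<bar> - \<bar>B\<bar>\<close>.\<close>

lemma descent_step:
  fixes x y B :: int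
  assumes "x * y > 0" "B\<^sup>2 - 4 * (x * y) > 0"
  shows "\<exists>e\<in>{1, -1}. (x + y + e * B) * x > 0 \<longrightarrow> \<bar>x + y + e * B\<bar> < max \<bar>x\<bar> \<bar>y\<bar>"
proof -
  define m where "m = min \<bar>x\<bar> \<bar>y\<bar>"
  have m: "0 < m" "m * m \<le> x * y"
  proof -
    show "0 < m" using assms(1) by (auto simp: m_def)
    then have "m * m \<le> \<bar>x\<bar> * \<bar>y\<bar>" by (intro mult_mono) (auto simp: m_def)
    then show "m * m \<le> x * y" using assms(1) by (simp add: abs_mult[symmetric])
  qed
  then have "m\<^sup>2 < \<bar>B\<bar>\<^sup>2" using assms by (simp add: power2_eq_square)
  then have B: "m < \<bar>B\<bar>" by (rule power2_less_imp_less) simp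
  have signs: "x > 0 \<and> y > 0 \<or> x < 0 \<and> y < 0" using assms(1) by (auto simp: zero_less_mult_iff)
  show ?thesis
  proof (cases "(x > 0) = (B > 0)")
    case True
    then show ?thesis using B m signs by (intro bexI[of _ "-1"]) (auto simp: m_def zero_less_mult_iff)
  next
    case False
    then show ?thesis using B m signs by (intro bexI[of _ 1]) (auto simp: m_def zero_less_mult_iff)
  qed
qed

text \<open>The quadratic form \<open>u \<mapsto> vdet u (mact H u)\<close> is indefinite; reducing it leads to a basis on which
  it changes sign, and in such a basis \<open>H\<close> has positive entries.\<close>

lemma ex_indefinite_basis:
  assumes H: "det H = 1" "\<bar>trace H\<bar> > 2"
  shows "\<exists>v w. vdet v w = 1 \<and> vdet v (mact H v) > 0 \<and> vdet w (mact H w) < 0"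
proof -
  define Q where "Q u = vdet u (mact H u)" for u
  have mixed: "\<exists>v w. vdet v w = 1 \<and> Q v > 0 \<and> Q w < 0" if "vdet v w = 1" "Q v * Q w < 0" for v w
  proof (cases "Q v > 0")
    case True
    then show ?thesis using that by (intro exI[of _ v] exI[of _ w]) (auto simp: mult_less_0_iff)
  next
    case False
    then show ?thesis using that vdet_swap[of w v]
      by (intro exI[of _ w] exI[of _ "- v"]) (auto simp: mult_less_0_iff Q_def)
  qed
  have nz: "Q u \<noteq> 0" if "primitive u" for u unfolding Q_def by (rule hyperbolic_no_eigenvector[OF H that])
  have "\<exists>v w. vdet v w = 1 \<and> Q v > 0 \<and> Q w < 0" if "vdet v w = 1" for v w
    using that
  proof (induction "nat (\<bar>Q v\<bar> + \<bar>Q w\<bar>)" arbitrary: v w rule: less_induct)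
    case less
    have nzv: "Q v \<noteq> 0" "Q w \<noteq> 0"
      using nz primitive_if_vdet[of v w] primitive_if_vdet'[of v w] less.prems by auto
    show ?case
    proof (cases "Q v * Q w < 0")
      case True then show ?thesis by (rule mixed[OF less.prems])
    next
      case False
      then have pos: "Q v * Q w > 0" using nzv by (metis linorder_neqE mult_eq_0_iff)
      define B where "B = vdet v (mact H w) + vdet w (mact H v)"
      \<comment> \<open>The discriminant of the form is that of the characteristic polynomial of
        \<open>H\<close>, which is positive for a hyperbolic matrix.\<close>
      have "B\<^sup>2 - 4 * (Q v * Q w) = ((trace H)\<^sup>2 - 4 * det H) * (vdet v w)\<^sup>2"
        unfolding B_def Q_def vdet_def mact_def det_2 trace_def sum_2 fst_conv snd_conv by algebra
      moreover have "2\<^sup>2 < \<bar>trace H\<bar>\<^sup>2" by (rule power_strict_mono) (use H(2) in auto)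
      ultimately have "B\<^sup>2 - 4 * (Q v * Q w) > 0" using H(1) less.prems by simp
      from descent_step[OF pos this] obtain e where e: "e = 1 \<or> e = -1"
        "(Q v + Q w + e * B) * Q v > 0 \<longrightarrow> \<bar>Q v + Q w + e * B\<bar> < max \<bar>Q v\<bar> \<bar>Q w\<bar>" by blast
      define u where "u = (if e = 1 then v + w else v - w)"
      have Qu: "Q u = Q v + Q w + e * B" using e(1) by (auto simp: u_def Q_def B_def algebra_simps)
      have dv: "vdet v (if e = 1 then u else - u) = 1" "vdet u w = 1"
        using less.prems e(1) by (auto simp: u_def)
      have Qn: "Q (- u) = Q u" by (simp add: Q_def)
      have nzu: "Q u \<noteq> 0" using nz primitive_if_vdet[of u w] dv by simp
      show ?thesis
      proof (cases "Q u * Q v > 0")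
        case False
        then have "Q v * Q u < 0" using nzu nzv by (metis linorder_neqE mult.commute mult_eq_0_iff)
        then show ?thesis using mixed[OF dv(1)] Qn by (simp split: if_splits)
      next
        case True
        then have lt: "\<bar>Q u\<bar> < max \<bar>Q v\<bar> \<bar>Q w\<bar>" using e(2) Qu by simp
        show ?thesis
        proof (cases "\<bar>Q v\<bar> \<le> \<bar>Q w\<bar>")
          case True
          then show ?thesis using lt less.hyps[OF _ dv(1)] Qn by (simp split: if_splits)
        next
          case False
          then show ?thesis using lt less.hyps[OF _ dv(2)] by simp
        qed
      qed
    qed
  qed
  from this[of "(1, 0)" "(0, 1)"] show ?thesis by (simp add: vdet_def Q_def)
qed

section \<open>A matrix with positive entries acting on a cone\<close>

locale positive_basis =
  fixes G :: "int ^ 2 ^ 2" and v w :: "int \<times> int"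
  assumes det: "det G = 1" and tr: "trace G > 2" and vw: "vdet v w = 1"
    and Qv: "vdet v (mact G v) > 0" and Qw: "vdet w (mact G w) < 0"
begin

text \<open>The four numbers are the entries of the matrix of \<open>G\<close> in the basis
  \<open>v, w\<close>: \<open>G\<close> maps \<open>v\<close> to \<open>p v + r w\<close> and
  \<open>w\<close> to \<open>q v + s w\<close>.\<close>

definition p where "p = vdet (mact G v) w"
definition q where "q = vdet (mact G w) w"
definition r where "r = vdet v (mact G v)"
definition s where "s = vdet v (mact G w)"

lemma rq: "r > 0" "q > 0"
  using Qv Qw vdet_swap[of w "mact G w"] by (auto simp: r_def q_def)

text \<open>The product \<open>p * s = 1 + r * q\<close> is positive, so \<open>p\<close> and
  \<open>s\<close> have equal signs, and their sum is the trace.\<close>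

lemma ps: "p > 0" "s > 0"
proof -
  have "p * s - r * q = 1"
    using vdet_cramer_det[OF vw, of "mact G v" "mact G w"] vdet_mact[of G v w] det vw
    by (simp add: p_def q_def r_def s_def)
  moreover have "r * q > 0" using rq by simp
  ultimately have "p * s > 0" by linarith
  moreover have "p + s > 2" using vdet_mact_trace[of G v w] vw tr by (simp add: p_def s_def)
  ultimately show "p > 0" "s > 0" by (auto simp: zero_less_mult_iff)
qed

lemma coords_mact:
  "vdet (mact G u) w = p * vdet u w + q * vdet v u"
  "vdet v (mact G u) = r * vdet u w + s * vdet v u"
proof -
  have "mact G u = mact G (vdet u w * fst v + vdet v u * fst w, vdet u w * snd v + vdet v u * snd w)"
    using vdet_cramer[OF vw, of u] by simp
  also have "\<dots> = (vdet u w * fst (mact G v) + vdet v u * fst (mact G w),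
      vdet u w * snd (mact G v) + vdet v u * snd (mact G w))"
    by (simp add: mact_def algebra_simps)
  finally have e: "fst (mact G u) = vdet u w * fst (mact G v) + vdet v u * fst (mact G w)"
    "snd (mact G u) = vdet u w * snd (mact G v) + vdet v u * snd (mact G w)" by simp_all
  show "vdet (mact G u) w = p * vdet u w + q * vdet v u"
    unfolding p_def q_def vdet_def[of "mact G u"] e by (simp add: vdet_def algebra_simps)
  show "vdet v (mact G u) = r * vdet u w + s * vdet v u"
    unfolding r_def s_def vdet_def[of v "mact G u"] e by (simp add: vdet_def algebra_simps)
qed

lemma mact_in_sector_iff: "mact G u \<in> sector (mact G v) (mact G w) \<longleftrightarrow> u \<in> sector v w"
proof -
  have "primitive (mact G u) \<Longrightarrow> primitive u"
  proof -
    assume "primitive (mact G u)"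
    then obtain z where z: "vdet (mact G u) z = 1" using ex_vdet_eq_1 by blast
    obtain z' where "mact G z' = z" using mact_surj[OF det] by blast
    then have "vdet u z' = 1" using vdet_mact[of G u z'] z det by simp
    then show "primitive u" by (intro primitive_if_vdet[of _ z']) simp
  qed
  then show ?thesis using primitive_mact[OF det, of u] by (auto simp: sector_def vdet_mact det)
qed

lemma sector_image_subset: "sector (mact G v) (mact G w) \<subseteq> sector v w"
  using rq ps vw by (intro sector_mono) (auto simp: vdet_mact det p_def q_def r_def s_def)

text \<open>The outermost shell in the nested sequence of the images of the cone. The cones being
  open, it contains the images of \<open>v\<close> and \<open>w\<close> but not \<open>v\<close> and
  \<open>w\<close> themselves; thus the boundary rays are also counted once.\<close>

definition domain where "domain = sector v w - sector (mact G v) (mact G w)"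

lemma funpow_in_sector: "u \<in> sector v w \<Longrightarrow> (mact G ^^ n) u \<in> sector v w"
proof (induction n)
  case (Suc n)
  then have "mact G ((mact G ^^ n) u) \<in> sector (mact G v) (mact G w)"
    by (simp only: mact_in_sector_iff)
  then show ?case using sector_image_subset by auto
qed simp

lemma minus_notin_sector: "u \<in> sector v w \<Longrightarrow> - u \<notin> sector v w"
  by (auto simp: sector_def)

lemma domain_unique_aux:
  assumes "u \<in> domain" "u' \<in> domain" "same_up_to_sign ((mact G ^^ n) u) u'"
  shows "u = u'"
proof -
  have "(mact G ^^ n) u \<in> sector v w" using assms(1) by (intro funpow_in_sector) (auto simp: domain_def)
  then have e: "u' = (mact G ^^ n) u"
    using assms(2,3) minus_notin_sector[of "(mact G ^^ n) u"] unfolding same_up_to_sign_def domain_def by blast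
  show ?thesis
  proof (cases n)
    case (Suc m)
    have "(mact G ^^ m) u \<in> sector v w" using assms(1) by (intro funpow_in_sector) (auto simp: domain_def)
    then have "u' \<in> sector (mact G v) (mact G w)" using e Suc mact_in_sector_iff[of "(mact G ^^ m) u"] by simp
    then show ?thesis using assms(2) by (simp add: domain_def)
  qed (use e in simp)
qed

lemma domain_unique:
  assumes "u \<in> domain" "u' \<in> domain" "orbit_rel G u u'"
  shows "u = u'"
proof -
  have *: "x = y" if "x \<in> domain" "y \<in> domain" "n \<le> m"
    "same_up_to_sign ((mact G ^^ n) x) ((mact G ^^ m) y)" for x y n m
  proof -
    have "(mact G ^^ m) y = (mact G ^^ n) ((mact G ^^ (m - n)) y)"
      using that(3) by (metis comp_apply funpow_add le_add_diff_inverse)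
    then have r: "same_up_to_sign ((mact G ^^ (m - n)) y) x"
      using that(4) funpow_mact_inj[OF det, of n "(mact G ^^ (m - n)) y" x]
        funpow_mact_inj[OF det, of n "(mact G ^^ (m - n)) y" "- x"]
      by (auto simp: same_up_to_sign_def)
    show "x = y" using domain_unique_aux[OF that(2,1) r] by simp
  qed
  obtain n m where nm: "same_up_to_sign ((mact G ^^ n) u) ((mact G ^^ m) u')"
    using assms(3) unfolding orbit_rel_def by blast
  have sym: "same_up_to_sign ((mact G ^^ m) u') ((mact G ^^ n) u)" using nm by (auto simp: same_up_to_sign_def)
  show ?thesis
  proof (cases "n \<le> m")
    case True then show ?thesis using * assms nm by blast
  next
    case False then show ?thesis using *[of u' u m n] assms sym by simp
  qed
qed

lemma enters_sector_aux:
  assumes "primitive u" "vdet u w * vdet v u \<ge> 0"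
  shows "\<exists>n. \<exists>u1\<in>sector v w. same_up_to_sign ((mact G ^^ n) u) u1"
proof -
  define x y where "x = vdet u w" and "y = vdet v u"
  have pm: "primitive (mact G u)" using primitive_mact[OF det assms(1)] .
  have xy0: "x \<noteq> 0 \<or> y \<noteq> 0"
  proof (rule ccontr)
    assume "\<not> ?thesis"
    then have "u = (0, 0)" using vdet_cramer[OF vw, of u] by (simp add: x_def y_def)
    then show False using assms(1) by (simp add: primitive_def)
  qed
  consider "x > 0 \<and> y > 0" | "x < 0 \<and> y < 0" | "x \<ge> 0 \<and> y \<ge> 0 \<and> (x = 0 \<or> y = 0)" | "x \<le> 0 \<and> y \<le> 0 \<and> (x = 0 \<or> y = 0)"
  proof -
    have "x \<ge> 0 \<and> y \<ge> 0 \<or> x \<le> 0 \<and> y \<le> 0"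
      using assms(2) by (simp add: x_def y_def zero_le_mult_iff)
    then show ?thesis using that by (cases "x = 0"; cases "y = 0") (auto simp: order_le_less)
  qed
  then show ?thesis
  proof cases
    case 1
    then have "u \<in> sector v w" using assms(1) by (simp add: sector_def x_def y_def)
    then show ?thesis by (intro exI[of _ 0] bexI[of _ u]) (auto simp: same_up_to_sign_def)
  next
    case 2
    then have "- u \<in> sector v w" using assms(1) by (simp add: sector_def x_def y_def)
    then show ?thesis by (intro exI[of _ 0] bexI[of _ "- u"]) (auto simp: same_up_to_sign_def)
  next
    case 3
    then have "p * x + q * y > 0 \<and> r * x + s * y > 0" using xy0 rq ps by auto
    then have "mact G u \<in> sector v w" using pm coords_mact[of u] by (simp add: sector_def x_def y_def)
    then show ?thesis by (intro exI[of _ 1] bexI[of _ "mact G u"]) (auto simp: same_up_to_sign_def)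
  next
    case 4
    then have "p * x + q * y < 0 \<and> r * x + s * y < 0" using xy0 rq ps by (auto simp: mult_pos_neg)
    then have "- mact G u \<in> sector v w" using pm coords_mact[of u] by (simp add: sector_def x_def y_def)
    then show ?thesis by (intro exI[of _ 1] bexI[of _ "- mact G u"]) (auto simp: same_up_to_sign_def)
  qed
qed

text \<open>If the coordinates of \<open>u\<close> and of its image both have mixed signs, then
  \<open>u\<close> is recovered from the image by the inverse matrix, whose entries
  \<open>s, - q, - r, p\<close> add up the absolute values without cancellation. So the coordinate
  sum of the image is strictly smaller, and mixed signs cannot persist.\<close>

lemma enters_sector:
  assumes "primitive u"
  shows "\<exists>n. \<exists>u1\<in>sector v w. same_up_to_sign ((mact G ^^ n) u) u1"
  using assms
proof (induction "nat (\<bar>vdet u w\<bar> + \<bar>vdet v u\<bar>)" arbitrary: u rule: less_induct)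
  case less
  define x y where "x = vdet u w" and "y = vdet v u"
  define x' y' where "x' = p * x + q * y" and "y' = r * x + s * y"
  have pm: "primitive (mact G u)" using primitive_mact[OF det less.prems] .
  have c: "vdet (mact G u) w = x'" "vdet v (mact G u) = y'"
    using coords_mact by (auto simp: x'_def y'_def x_def y_def)
  show ?case
  proof (cases "x * y \<ge> 0")
    case True then show ?thesis using enters_sector_aux[OF less.prems] by (simp add: x_def y_def)
  next
    case False
    have "\<exists>n. \<exists>u1\<in>sector v w. same_up_to_sign ((mact G ^^ n) (mact G u)) u1"
    proof (cases "x' * y' \<ge> 0")
      case True then show ?thesis using enters_sector_aux[OF pm] c by simp
    next
      case ns: False
      have d: "p * s = 1 + r * q"
        using vdet_cramer_det[OF vw, of "mact G v" "mact G w"] vdet_mact[of G v w] det vw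
        by (simp add: p_def q_def r_def s_def)
      have inv: "x = s * x' - q * y'" "y = p * y' - r * x'"
        using d unfolding x'_def y'_def by algebra+
      have "x' > 0 \<and> y' < 0 \<or> x' < 0 \<and> y' > 0" using ns by (auto simp: not_le mult_less_0_iff)
      then have "\<bar>x\<bar> = s * \<bar>x'\<bar> + q * \<bar>y'\<bar> \<and> \<bar>y\<bar> = p * \<bar>y'\<bar> + r * \<bar>x'\<bar>"
      proof
        assume "x' > 0 \<and> y' < 0"
        moreover from this have "s * x' > 0" "q * y' < 0" "p * y' < 0" "r * x' > 0" using rq ps by (auto simp: mult_pos_neg)
        ultimately show ?thesis unfolding inv by auto
      next
        assume "x' < 0 \<and> y' > 0"
        moreover from this have "s * x' < 0" "q * y' > 0" "p * y' > 0" "r * x' < 0" using rq ps by (auto simp: mult_pos_neg)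
        ultimately show ?thesis unfolding inv by auto
      qed
      moreover have "s * \<bar>x'\<bar> \<ge> 1 * \<bar>x'\<bar>" "p * \<bar>y'\<bar> \<ge> 1 * \<bar>y'\<bar>" using ps by (intro mult_right_mono; simp)+
      moreover have "x' \<noteq> 0" "y' \<noteq> 0" using ns by auto
      then have "q * \<bar>y'\<bar> > 0" "r * \<bar>x'\<bar> > 0" using rq by simp_all
      ultimately have "\<bar>x'\<bar> + \<bar>y'\<bar> < \<bar>x\<bar> + \<bar>y\<bar>" by linarith
      then show ?thesis using c by (intro less.hyps pm) (simp add: x_def y_def)
    qed
    then show ?thesis by (metis funpow_simps_right(2) comp_apply)
  qed
qed

text \<open>Passing to the preimage under \<open>G\<close> strictly decreases the positive
  coordinate sum, so only finitely many preimages of \<open>u\<close> stay in the cone.\<close>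

lemma leaves_sector:
  assumes "u \<in> sector v w"
  shows "\<exists>n. \<exists>u'\<in>domain. (mact G ^^ n) u' = u"
  using assms
proof (induction "nat (vdet u w + vdet v u)" arbitrary: u rule: less_induct)
  case less
  show ?case
  proof (cases "u \<in> sector (mact G v) (mact G w)")
    case False
    then show ?thesis using less.prems by (intro exI[of _ 0] bexI[of _ u]) (auto simp: domain_def)
  next
    case True
    obtain u1 where u1: "mact G u1 = u" using mact_surj[OF det] by blast
    then have in1: "u1 \<in> sector v w" using True mact_in_sector_iff[of u1] by simp
    define x y where "x = vdet u1 w" and "y = vdet v u1"
    have xy: "x > 0" "y > 0" using in1 by (auto simp: sector_def x_def y_def)
    have "vdet u w = p * x + q * y" "vdet v u = r * x + s * y"
      using coords_mact[of u1] u1 by (auto simp: x_def y_def)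
    moreover have "p * x \<ge> 1 * x" "s * y \<ge> 1 * y" using ps xy by (intro mult_right_mono; simp)+
    moreover have "q * y > 0" "r * x > 0" using rq xy by auto
    ultimately have "x + y < vdet u w + vdet v u" by linarith
    then have "\<exists>n. \<exists>u'\<in>domain. (mact G ^^ n) u' = u1"
      using xy by (intro less.hyps in1) (simp add: x_def y_def)
    then obtain n u' where "u' \<in> domain" "(mact G ^^ n) u' = u1" by blast
    then show ?thesis using u1 by (intro exI[of _ "Suc n"] bexI[of _ u']) auto
  qed
qed

lemma domain_represents:
  assumes "primitive u" shows "\<exists>u'\<in>domain. orbit_rel G u u'"
proof -
  obtain n u1 where "u1 \<in> sector v w" "same_up_to_sign ((mact G ^^ n) u) u1" using enters_sector[OF assms] by blast
  moreover obtain m u' where "u' \<in> domain" "(mact G ^^ m) u' = u1" using leaves_sector calculation(1) by blast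
  ultimately show ?thesis unfolding orbit_rel_def by blast
qed

end

lemma orbit_rel_uminus: "orbit_rel (- H) = orbit_rel H"
proof -
  have *: "orbit_rel (- H) u u'" if "orbit_rel H u u'" for u u' and H :: "int ^ 2 ^ 2"
    using that funpow_mact_uminus_matrix[of _ H]
    unfolding orbit_rel_def same_up_to_sign_def by (metis minus_minus)
  show ?thesis using *[of H] *[of "- H"] by (intro ext) auto
qed

context markoff_map begin

text \<open>The fundamental domain is a difference of two sectors with the same gap, so the gaps cancel.\<close>

theorem sum_over_orbits:
  assumes H: "det H = 1" "\<bar>trace H\<bar> > 2" and inv: "\<And>u. primitive u \<Longrightarrow> \<phi> (mact H u) = \<phi> u"
  obtains D where "\<And>u. u \<in> D \<Longrightarrow> primitive u"
    "\<And>u. primitive u \<Longrightarrow> \<exists>u'\<in>D. orbit_rel H u u'"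
    "\<And>u u'. u \<in> D \<Longrightarrow> u' \<in> D \<Longrightarrow> orbit_rel H u u' \<Longrightarrow> u = u'"
    "finite {u \<in> D. cmod (\<phi> u) \<le> 2} \<Longrightarrow>
      (\<lambda>u. norm (h u)) summable_on D \<and> exp (infsum h D) = 1"
proof -
  \<comment> \<open>Changing the sign of \<open>H\<close> affects neither vectors up to sign nor
    \<open>\<phi>\<close>, and it makes the trace positive, as \<open>positive_basis\<close>
    requires.\<close>
  define G where "G = (if trace H > 0 then H else - H)"
  have G: "det G = 1" "trace G > 2"
    using H by (auto simp: G_def det_2 trace_def sum_2)
  have rel: "orbit_rel G = orbit_rel H" by (simp add: G_def orbit_rel_uminus)
  have invG: "\<phi> (mact G u) = \<phi> u" if "primitive u" for u
    using inv[OF that] minus[OF primitive_mact[OF H(1) that]] by (simp add: G_def)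
  obtain v w where vw: "vdet v w = 1" "vdet v (mact G v) > 0" "vdet w (mact G w) < 0"
    using ex_indefinite_basis[of G] G by auto
  interpret positive_basis G v w using G vw by unfold_locales
  have p: "primitive v" "primitive w" "primitive (v - w)"
    using primitive_if_vdet[of v w] primitive_if_vdet'[of v w] primitive_if_vdet[of "v - w" w] vw(1) by auto
  show ?thesis
  proof (rule that[of domain])
    show "\<And>u. u \<in> domain \<Longrightarrow> primitive u" by (auto simp: domain_def sector_def)
    show "\<And>u. primitive u \<Longrightarrow> \<exists>u'\<in>domain. orbit_rel H u u'" using domain_represents by (simp add: rel)
    show "\<And>u u'. u \<in> domain \<Longrightarrow> u' \<in> domain \<Longrightarrow> orbit_rel H u u' \<Longrightarrow> u = u'"
      using domain_unique by (simp add: rel)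
    assume "finite {u \<in> domain. cmod (\<phi> u) \<le> 2}"
    then have *: "(\<lambda>u. norm (h u)) summable_on domain \<and>
        exp (infsum h domain) * gap (mact G v) (mact G w) = gap v w"
      unfolding domain_def using vw(1) rq ps G
      by (intro gap_telescope) (auto simp: vdet_mact p_def q_def r_def s_def)
    have "gap (mact G v) (mact G w) = gap v w"
      using invG[OF p(1)] invG[OF p(2)] invG[OF p(3)] by (simp add: gap_def)
    moreover have "gap v w \<noteq> 0" using vw(1) by (intro gap_nonzero) simp
    ultimately show "(\<lambda>u. norm (h u)) summable_on domain \<and> exp (infsum h domain) = 1" using * by simp
  qed
qed

end

section \<open>Reduced words\<close>

definition letter_inv :: "'g \<times> bool \<Rightarrow> 'g \<times> bool" where
  "letter_inv l = (fst l, \<not> snd l)"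

definition word_inv :: "('g \<times> bool) list \<Rightarrow> ('g \<times> bool) list" where
  "word_inv w = rev (map letter_inv w)"

definition letter_val :: "('g, 'm) monoid_scheme \<Rightarrow> 'g \<times> bool \<Rightarrow> 'g" where
  "letter_val G l = (if snd l then fst l else inv\<^bsub>G\<^esub> (fst l))"

lemma letter_inv_simps [simp]: "letter_inv (letter_inv l) = l" "fst (letter_inv l) = fst l"
  "letter_inv l \<noteq> l" "l \<noteq> letter_inv l" "(letter_inv l = letter_inv l') = (l = l')"
  by (auto simp: letter_inv_def prod_eq_iff)

lemma word_inv_simps [simp]: "word_inv [] = []" "word_inv (word_inv w) = w"
  "word_inv (u @ w) = word_inv w @ word_inv u" "length (word_inv w) = length w"
  "word_inv (l # w) = word_inv w @ [letter_inv l]" "fst ` set (word_inv w) = fst ` set w"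
  by (auto simp: word_inv_def rev_map[symmetric] image_image comp_def)

lemma reduced_word_conv: "reduced_word w \<longleftrightarrow> successively (\<lambda>l m. m \<noteq> letter_inv l) w"
  unfolding reduced_word_def letter_inv_def
  by (rule successively_cong) (auto simp: prod_eq_iff)

lemma reduced_word_append:
  "reduced_word (u @ w) \<longleftrightarrow> reduced_word u \<and> reduced_word w \<and>
     (u = [] \<or> w = [] \<or> hd w \<noteq> letter_inv (last u))"
  unfolding reduced_word_conv by (auto simp: successively_append_iff)

lemma reduced_word_simps [simp]: "reduced_word []" "reduced_word [l]"
  "reduced_word (l # m # w) \<longleftrightarrow> m \<noteq> letter_inv l \<and> reduced_word (m # w)"
  by (simp_all add: reduced_word_conv)

lemma reduced_word_inv [simp]: "reduced_word (word_inv w) \<longleftrightarrow> reduced_word w"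
proof -
  have "letter_inv l \<noteq> letter_inv (letter_inv m) \<longleftrightarrow> m \<noteq> letter_inv l" for l m :: "'a \<times> bool" by auto
  then show ?thesis unfolding reduced_word_conv word_inv_def successively_rev successively_map by simp
qed

text \<open>Here \<open>s\<close> is the longest end of \<open>u\<close> whose inverse begins
  \<open>w\<close>; once it has been removed, the remaining parts can be joined without
  cancellation.\<close>

lemma reduced_cancel:
  assumes "reduced_word u" "reduced_word w"
  shows "\<exists>u' s w'. u = u' @ s \<and> w = word_inv s @ w' \<and> reduced_word (u' @ w')"
  using assms
proof (induction u arbitrary: w rule: rev_induct)
  case Nil
  show ?case by (rule exI[of _ "[]"], rule exI[of _ "[]"], rule exI[of _ w]) (use Nil in auto)
next
  case (snoc l u)
  show ?case
  proof (cases "w = [] \<or> hd w \<noteq> letter_inv l")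
    case True
    show ?thesis
      by (rule exI[of _ "u @ [l]"], rule exI[of _ "[]"], rule exI[of _ w])
        (use True snoc.prems reduced_word_append[of "[l]" w] in \<open>auto simp: reduced_word_append\<close>)
  next
    case False
    then obtain w0 where w0: "w = letter_inv l # w0" by (cases w) auto
    have "reduced_word u" "reduced_word w0"
      using snoc.prems w0 reduced_word_append[of "[letter_inv l]" w0] by (auto simp: reduced_word_append)
    then obtain u' s w' where "u = u' @ s" "w0 = word_inv s @ w'" "reduced_word (u' @ w')"
      using snoc.IH by blast
    then show ?thesis using w0
      by (intro exI[of _ u'] exI[of _ "s @ [l]"] exI[of _ w']) auto
  qed
qed

lemma reduced_word_no_self_inverse:
  assumes "reduced_word (s @ word_inv s)" shows "s = []"
proof (rule ccontr)
  assume "s \<noteq> []"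
  then have "hd (word_inv s) = letter_inv (last s)" by (simp add: word_inv_def hd_rev last_map)
  then show False using assms \<open>s \<noteq> []\<close> by (auto simp: reduced_word_append word_inv_def)
qed

context group begin

lemma word_val_simps [simp]: "word_val G [] = \<one>" "word_val G (l # w) = letter_val G l \<otimes> word_val G w"
  by (simp_all add: word_val_def letter_val_def case_prod_unfold)

lemma letter_val_closed [simp]: "fst l \<in> carrier G \<Longrightarrow> letter_val G l \<in> carrier G"
  by (simp add: letter_val_def)

lemma letter_val_inv [simp]: "fst l \<in> carrier G \<Longrightarrow> letter_val G (letter_inv l) = inv (letter_val G l)"
  by (simp add: letter_val_def letter_inv_def)

lemma word_val_closed [simp]: "fst ` set w \<subseteq> carrier G \<Longrightarrow> word_val G w \<in> carrier G"
  by (induction w) auto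

lemma word_val_append:
  "fst ` set u \<subseteq> carrier G \<Longrightarrow> fst ` set w \<subseteq> carrier G \<Longrightarrow>
    word_val G (u @ w) = word_val G u \<otimes> word_val G w"
  by (induction u) (auto simp: m_assoc)

lemma word_val_inv:
  "fst ` set w \<subseteq> carrier G \<Longrightarrow> word_val G (word_inv w) = inv (word_val G w)"
  by (induction w) (auto simp: word_val_append inv_mult_group)

lemma word_val_cancel:
  assumes "fst ` set (u @ s) \<subseteq> carrier G" "fst ` set (word_inv s @ w) \<subseteq> carrier G"
  shows "word_val G (u @ s) \<otimes> word_val G (word_inv s @ w) = word_val G (u @ w)"
proof -
  have c: "fst ` set u \<subseteq> carrier G" "fst ` set s \<subseteq> carrier G" "fst ` set w \<subseteq> carrier G"
    "fst ` set (word_inv s) \<subseteq> carrier G" using assms by (auto simp: image_Un)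
  then have v: "word_val G u \<in> carrier G" "word_val G s \<in> carrier G" "word_val G w \<in> carrier G" by simp_all
  have "inv (word_val G s) \<otimes> word_val G w \<in> carrier G" using v by simp
  then have "word_val G s \<otimes> (inv (word_val G s) \<otimes> word_val G w) = word_val G w"
    using v by (simp add: m_assoc[symmetric])
  then show ?thesis using c v by (simp add: word_val_append word_val_inv m_assoc)
qed

lemma generate_reduced_word:
  assumes "Y \<subseteq> carrier G" "g \<in> generate G Y"
  shows "\<exists>w. reduced_word w \<and> fst ` set w \<subseteq> Y \<and> word_val G w = g"
  using assms(2)
proof (induction rule: generate.induct)
  case one then show ?case by (intro exI[of _ "[]"]) simp
next
  case (incl h) then show ?case using assms by (intro exI[of _ "[(h, True)]"]) (auto simp: letter_val_def)
next
  case (inv h) then show ?case using assms by (intro exI[of _ "[(h, False)]"]) (auto simp: letter_val_def)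
next
  case (eng g h)
  then obtain u w where u: "reduced_word u" "fst ` set u \<subseteq> Y" "word_val G u = g"
    and w: "reduced_word w" "fst ` set w \<subseteq> Y" "word_val G w = h" by blast
  obtain u' s w' where c: "u = u' @ s" "w = word_inv s @ w'" "reduced_word (u' @ w')"
    using reduced_cancel[OF u(1) w(1)] by blast
  have "word_val G (u' @ w') = g \<otimes> h"
    using word_val_cancel[of u' s w'] u w c assms(1) by auto
  moreover have "fst ` set (u' @ w') \<subseteq> Y" using u w c by (auto simp: image_Un)
  ultimately show ?case using c(3) by blast
qed

lemma hom_eq_on_generate:
  assumes "group K" "\<theta> \<in> hom G K" "\<theta>' \<in> hom G K" "Y \<subseteq> carrier G" "\<And>y. y \<in> Y \<Longrightarrow> \<theta> y = \<theta>' y"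
    and "g \<in> generate G Y"
  shows "\<theta> g = \<theta>' g"
proof -
  interpret t: group_hom G K \<theta> using assms group_axioms by (simp add: group_hom_def group_hom_axioms_def)
  interpret t': group_hom G K \<theta>' using assms group_axioms by (simp add: group_hom_def group_hom_axioms_def)
  show ?thesis using assms(6)
  proof (induction rule: generate.induct)
    case (eng g h)
    then have "g \<in> carrier G" "h \<in> carrier G" using generate_in_carrier[OF assms(4)] by auto
    then show ?case using eng by simp
  qed (use assms in auto)
qed

end

section \<open>Normal forms in free groups\<close>

locale free_group = group G for G (structure) +
  fixes X assumes basis: "free_basis G X"
begin

lemma X_sub: "X \<subseteq> carrier G" and gen_X: "generate G X = carrier G"
  and word_val_nontrivial: "fst ` set w \<subseteq> X \<Longrightarrow> reduced_word w \<Longrightarrow> w \<noteq> [] \<Longrightarrow> word_val G w \<noteq> \<one>"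
  using basis by (auto simp: free_basis_def)

lemma word_in_carrier: "fst ` set w \<subseteq> X \<Longrightarrow> fst ` set w \<subseteq> carrier G"
  using X_sub by blast

text \<open>Cancelling between the inverse of \<open>u\<close> and \<open>w\<close> leaves a reduced
  word with trivial value. It must be empty, so everything has cancelled.\<close>

lemma reduced_word_unique:
  assumes "reduced_word u" "reduced_word w" "fst ` set u \<subseteq> X" "fst ` set w \<subseteq> X" "word_val G u = word_val G w"
  shows "u = w"
proof -
  have "reduced_word (word_inv u)" using assms by simp
  from reduced_cancel[OF this assms(2)] obtain u' s w' where
    c: "word_inv u = u' @ s" "w = word_inv s @ w'" "reduced_word (u' @ w')" by blast
  have sub: "fst ` set (u' @ s) \<subseteq> X" "fst ` set (word_inv s @ w') \<subseteq> X"
    using assms by (simp_all flip: c(1,2))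
  have "word_val G (u' @ w') = word_val G (word_inv u) \<otimes> word_val G w"
    unfolding c(1,2) using sub by (intro word_val_cancel[symmetric] word_in_carrier)
  also have "\<dots> = \<one>" using assms X_sub by (simp add: word_val_inv word_in_carrier)
  finally have "u' @ w' = []" using word_val_nontrivial[of "u' @ w'"] c(3) sub by (auto simp: image_Un)
  then have "word_inv u = s" "w = word_inv s" using c by auto
  then show ?thesis by auto
qed

definition nf where "nf g = (THE w. reduced_word w \<and> fst ` set w \<subseteq> X \<and> word_val G w = g)"

lemma nf:
  assumes "g \<in> carrier G"
  shows "reduced_word (nf g)" "fst ` set (nf g) \<subseteq> X" "word_val G (nf g) = g"
proof -
  have "\<exists>!w. reduced_word w \<and> fst ` set w \<subseteq> X \<and> word_val G w = g"
    using generate_reduced_word[OF X_sub, of g] assms gen_X reduced_word_unique by auto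
  from theI'[OF this] show "reduced_word (nf g)" "fst ` set (nf g) \<subseteq> X" "word_val G (nf g) = g"
    unfolding nf_def by auto
qed

lemma nf_eq: "reduced_word w \<Longrightarrow> fst ` set w \<subseteq> X \<Longrightarrow> nf (word_val G w) = w"
  using nf[of "word_val G w"] word_in_carrier[of w] by (intro reduced_word_unique) auto

lemma nf_one [simp]: "nf \<one> = []"
  using nf_eq[of "[]"] by simp

lemma nf_basis: "x \<in> X \<Longrightarrow> nf x = [(x, True)]"
  using nf_eq[of "[(x, True)]"] X_sub by (auto simp: letter_val_def)

lemma nf_inv: "g \<in> carrier G \<Longrightarrow> nf (inv g) = word_inv (nf g)"
  using nf_eq[of "word_inv (nf g)"] nf[of g] word_in_carrier[of "nf g"] by (simp add: word_val_inv)

lemma nf_mult: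
  assumes "g \<in> carrier G" "h \<in> carrier G"
  obtains u s w where "nf g = u @ s" "nf h = word_inv s @ w" "nf (g \<otimes> h) = u @ w" "reduced_word (u @ w)"
proof -
  obtain u s w where c: "nf g = u @ s" "nf h = word_inv s @ w" "reduced_word (u @ w)"
    using reduced_cancel[OF nf(1)[OF assms(1)] nf(1)[OF assms(2)]] by blast
  have sub: "fst ` set (u @ s) \<subseteq> X" "fst ` set (word_inv s @ w) \<subseteq> X"
    using nf(2)[OF assms(1)] nf(2)[OF assms(2)] by (simp_all flip: c(1,2))
  have "word_val G (u @ w) = g \<otimes> h"
    using word_val_cancel[OF word_in_carrier[OF sub(1)] word_in_carrier[OF sub(2)]] nf(3) assms
    by (simp flip: c(1,2))
  moreover have "fst ` set (u @ w) \<subseteq> X" using sub by (auto simp: image_Un)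
  ultimately show ?thesis using nf_eq[OF c(3)] c that by simp
qed

definition extend where
  "extend K s g = word_val K (map (\<lambda>l. (s (fst l), snd l)) (nf g))"

text \<open>The universal property. By \<open>nf_mult\<close> the normal form of a product arises by
  cancelling a word against its inverse, and the images of these two words cancel in
  \<open>K\<close> as well.\<close>

lemma extend_hom:
  assumes "group K" "s ` X \<subseteq> carrier K"
  shows "extend K s \<in> hom G K" "\<And>x. x \<in> X \<Longrightarrow> extend K s x = s x"
proof -
  interpret K: group K by fact
  define m where "m = (\<lambda>l :: 'a \<times> bool. (s (fst l), snd l))"
  have minv: "map m (word_inv w) = word_inv (map m w)" for w
    by (induction w) (auto simp: m_def letter_inv_def)
  have sub: "fst ` set (map m w) \<subseteq> carrier K" if "fst ` set w \<subseteq> X" for w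
  proof -
    have "fst ` set (map m w) = s ` fst ` set w" by (auto simp: m_def image_image)
    then show ?thesis using that assms(2) by blast
  qed
  show "extend K s \<in> hom G K"
  proof (rule homI)
    fix g assume "g \<in> carrier G"
    then show "extend K s g \<in> carrier K"
      unfolding extend_def m_def[symmetric] by (intro K.word_val_closed sub nf)
  next
    fix g h assume gh: "g \<in> carrier G" "h \<in> carrier G"
    then obtain u t w where c: "nf g = u @ t" "nf h = word_inv t @ w" "nf (g \<otimes> h) = u @ w"
      using nf_mult by metis
    have "fst ` set (u @ t) \<subseteq> X" "fst ` set (word_inv t @ w) \<subseteq> X"
      using nf(2)[OF gh(1)] nf(2)[OF gh(2)] by (simp_all flip: c(1,2))
    then have "fst ` set (map m u @ map m t) \<subseteq> carrier K" "fst ` set (word_inv (map m t) @ map m w) \<subseteq> carrier K"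
      using sub[of "u @ t"] sub[of "word_inv t @ w"] by (simp_all only: map_append minv)
    from K.word_val_cancel[OF this]
    show "extend K s (g \<otimes> h) = extend K s g \<otimes>\<^bsub>K\<^esub> extend K s h"
      unfolding extend_def m_def[symmetric] c by (simp add: minv)
  qed
  fix x assume "x \<in> X"
  then show "extend K s x = s x"
    using assms(2) by (auto simp: extend_def nf_basis letter_val_def)
qed

text \<open>Three elements of a free basis would be images of the generators \<open>a\<close>, \<open>b\<close> under homomorphisms to
  \<open>\<int>\<close> that realise the three unit vectors.\<close>

lemma basis_card_le_2:
  assumes "a \<in> carrier G" "b \<in> carrier G" "generate G {a, b} = carrier G"
    and "x \<in> X" "y \<in> X" "z \<in> X" "x \<noteq> y" "y \<noteq> z" "x \<noteq> z"
  shows False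
proof -
  define t where "t u = extend integer_group (\<lambda>g. if g = u then 1 else 0)" for u
  have t: "t u \<in> hom G integer_group" "\<And>g. g \<in> X \<Longrightarrow> t u g = (if g = u then 1 else 0)" for u
    unfolding t_def by (intro extend_hom; simp)+
  have lin: "\<exists>m n. \<forall>u. t u g = m * t u a + n * t u b" if "g \<in> carrier G" for g
  proof -
    have "g \<in> generate G {a, b}" using that assms by simp
    then show ?thesis
    proof (induction rule: generate.induct)
      case one
      have "t u \<one> = 0" for u
        using hom_one[OF t(1)[of u] group_axioms] by simp
      then show ?case by (intro exI[of _ 0]) simp
    next
      case (incl h)
      then consider "h = a" | "h = b" by auto
      then show ?case
      proof cases
        case 1 show ?thesis by (rule exI[of _ 1], rule exI[of _ 0]) (use 1 in simp)
      next
        case 2 show ?thesis by (rule exI[of _ 0], rule exI[of _ 1]) (use 2 in simp)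
      qed
    next
      case (inv h)
      have e: "t u (inv h) = - t u h" for u
      proof -
        interpret group_hom G integer_group "t u"
          using t group_axioms by (simp add: group_hom_def group_hom_axioms_def)
        show ?thesis using inv assms hom_inv[of h] by auto
      qed
      from inv consider "h = a" | "h = b" by auto
      then show ?case
      proof cases
        case 1 show ?thesis by (rule exI[of _ "-1"], rule exI[of _ 0]) (use 1 e in simp)
      next
        case 2 show ?thesis by (rule exI[of _ 0], rule exI[of _ "-1"]) (use 2 e in simp)
      qed
    next
      case (eng g h)
      then obtain m n m' n' where "\<forall>u. t u g = m * t u a + n * t u b" "\<forall>u. t u h = m' * t u a + n' * t u b" by blast
      moreover have "t u (g \<otimes> h) = t u g + t u h" for u
        using hom_mult[OF t(1)[of u], of g h] eng.hyps generate_in_carrier[of "{a, b}"] assms by auto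
      ultimately show ?case by (intro exI[of _ "m + m'"] exI[of _ "n + n'"]) (simp add: algebra_simps)
    qed
  qed
  have c: "x \<in> carrier G" "y \<in> carrier G" "z \<in> carrier G" using assms X_sub by auto
  obtain m1 n1 m2 n2 m3 n3 where l: "\<And>u. t u x = m1 * t u a + n1 * t u b"
    "\<And>u. t u y = m2 * t u a + n2 * t u b" "\<And>u. t u z = m3 * t u a + n3 * t u b"
    using lin c by metis
  have e: "m1 * t x a + n1 * t x b = 1" "m1 * t y a + n1 * t y b = 0" "m1 * t z a + n1 * t z b = 0"
    "m2 * t x a + n2 * t x b = 0" "m2 * t y a + n2 * t y b = 1" "m2 * t z a + n2 * t z b = 0"
    "m3 * t x a + n3 * t x b = 0" "m3 * t y a + n3 * t y b = 0" "m3 * t z a + n3 * t z b = 1"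
    using l[of x] l[of y] l[of z] t(2) assms by auto
  \<comment> \<open>The determinant of a 3 by 3 matrix that factors through rank two vanishes; by
    \<open>e\<close> this matrix is the identity.\<close>
  have "(m1 * t x a + n1 * t x b) * ((m2 * t y a + n2 * t y b) * (m3 * t z a + n3 * t z b)
        - (m2 * t z a + n2 * t z b) * (m3 * t y a + n3 * t y b))
      - (m1 * t y a + n1 * t y b) * ((m2 * t x a + n2 * t x b) * (m3 * t z a + n3 * t z b)
        - (m2 * t z a + n2 * t z b) * (m3 * t x a + n3 * t x b))
      + (m1 * t z a + n1 * t z b) * ((m2 * t x a + n2 * t x b) * (m3 * t y a + n3 * t y b)
        - (m2 * t y a + n2 * t y b) * (m3 * t x a + n3 * t x b)) = 0"
    by (simp add: algebra_simps)
  then show False unfolding e by simp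
qed

end

section \<open>Nielsen reduction\<close>

lemma append_eq_append_prefix:
  "u @ s = p @ q \<Longrightarrow> length u \<le> length p \<Longrightarrow> \<exists>t. p = u @ t \<and> s = t @ q"
proof (induction u arbitrary: p)
  case (Cons x u)
  then obtain p' where "p = x # p'" by (cases p) auto
  then show ?case using Cons by auto
qed simp

text \<open>The first and last letters are mutually inverse and the middle part is again its own
  inverse; stripping letters leads to two adjacent letters that cancel.\<close>

lemma reduced_self_inverse: "reduced_word w \<Longrightarrow> word_inv w = w \<Longrightarrow> w = []"
proof (induction w rule: length_induct)
  case (1 w)
  show ?case
  proof (cases w)
    case (Cons l t)
    show ?thesis
    proof (cases t rule: rev_cases)
      case Nil then show ?thesis using 1 Cons by simp
    next
      case (snoc t' m)
      have w: "w = [l] @ t' @ [m]" using Cons snoc by simp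
      then have e: "letter_inv m = l" "word_inv t' = t'" using 1(3) by auto
      have "reduced_word t'"
        using 1(2) reduced_word_append[of "[l]" "t' @ [m]"] reduced_word_append[of t' "[m]"] w by simp
      then have "t' = []" using 1(1) e w by simp
      then show ?thesis using 1(2) w e by auto
    qed
  qed simp
qed

section \<open>Nielsen moves on pairs\<close>

context group begin

lemma cancel_left [simp]:
  "g \<in> carrier G \<Longrightarrow> h \<in> carrier G \<Longrightarrow> inv g \<otimes> (g \<otimes> h) = h"
  "g \<in> carrier G \<Longrightarrow> h \<in> carrier G \<Longrightarrow> g \<otimes> (inv g \<otimes> h) = h"
  by (simp_all add: m_assoc[symmetric])

inductive nielsen_step :: "'a \<times> 'a \<Rightarrow> 'a \<times> 'a \<Rightarrow> bool" where
  rotate: "g \<in> carrier G \<Longrightarrow> h \<in> carrier G \<Longrightarrow> nielsen_step (g, h) (h, inv g)"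
| shear: "g \<in> carrier G \<Longrightarrow> h \<in> carrier G \<Longrightarrow> nielsen_step (g, h) (g, g \<otimes> h)"
| shear_inv: "g \<in> carrier G \<Longrightarrow> h \<in> carrier G \<Longrightarrow> nielsen_step (g, h) (g, inv g \<otimes> h)"
| conj: "g \<in> carrier G \<Longrightarrow> h \<in> carrier G \<Longrightarrow> k \<in> carrier G \<Longrightarrow>
    nielsen_step (g, h) (k \<otimes> g \<otimes> inv k, k \<otimes> h \<otimes> inv k)"

abbreviation nielsen :: "'a \<times> 'a \<Rightarrow> 'a \<times> 'a \<Rightarrow> bool" where "nielsen \<equiv> nielsen_step\<^sup>*\<^sup>*"

lemma nielsen_carrier:
  "nielsen p p' \<Longrightarrow> fst p \<in> carrier G \<Longrightarrow> snd p \<in> carrier G \<Longrightarrow> fst p' \<in> carrier G \<and> snd p' \<in> carrier G"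
  by (induction rule: rtranclp_induct) (auto elim!: nielsen_step.cases)

lemma nielsen_rotate:
  assumes "nielsen p (g, h)" "g \<in> carrier G" "h \<in> carrier G"
  shows "nielsen p (h, inv g)" "nielsen p (inv g, inv h)" "nielsen p (inv h, g)"
proof -
  show 1: "nielsen p (h, inv g)" using assms by (meson rotate rtranclp.rtrancl_into_rtrancl)
  show 2: "nielsen p (inv g, inv h)" using 1 assms rotate[of h "inv g"] by (simp add: rtranclp.rtrancl_into_rtrancl)
  show "nielsen p (inv h, g)" using 2 assms rotate[of "inv g" "inv h"] by (simp add: rtranclp.rtrancl_into_rtrancl)
qed

lemma nielsen_step_sym: "nielsen_step p p' \<Longrightarrow> nielsen p' p"
proof (induction rule: nielsen_step.induct)
  case (rotate g h)
  then show ?case using nielsen_rotate(3)[of "(h, inv g)" h "inv g"] by simp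
next
  case (shear g h)
  then show ?case using shear_inv[of g "g \<otimes> h"] by auto
next
  case (shear_inv g h)
  then show ?case using shear[of g "inv g \<otimes> h"] by auto
next
  case (conj g h k)
  then show ?case using nielsen_step.conj[of "k \<otimes> g \<otimes> inv k" "k \<otimes> h \<otimes> inv k" "inv k"]
    by (auto simp: m_assoc)
qed

lemma nielsen_sym: "nielsen p p' \<Longrightarrow> nielsen p' p"
  by (induction rule: rtranclp_induct) (auto dest: nielsen_step_sym)

lemma nielsen_shears:
  assumes p: "nielsen p (g, h)" and gh: "g \<in> carrier G" "h \<in> carrier G"
  shows "nielsen p (g, g \<otimes> h)" "nielsen p (g, inv g \<otimes> h)" "nielsen p (g \<otimes> h, h)" "nielsen p (inv h \<otimes> g, h)"
proof -
  show "nielsen p (g, g \<otimes> h)" using p shear[OF gh] by (rule rtranclp.rtrancl_into_rtrancl)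
  show "nielsen p (g, inv g \<otimes> h)" using p shear_inv[OF gh] by (rule rtranclp.rtrancl_into_rtrancl)
  have r: "nielsen p (h, inv g)" by (rule nielsen_rotate[OF p gh])
  then have "nielsen p (h, inv h \<otimes> inv g)" using shear_inv[of h "inv g"] gh by (simp add: rtranclp.rtrancl_into_rtrancl)
  from nielsen_rotate(3)[OF this] gh show "nielsen p (g \<otimes> h, h)" by (simp add: inv_mult_group)
  have "nielsen p (h, h \<otimes> inv g)" using r shear[of h "inv g"] gh by (simp add: rtranclp.rtrancl_into_rtrancl)
  from nielsen_rotate(3)[OF this] gh have "nielsen p (g \<otimes> inv h, h)" by (simp add: inv_mult_group)
  moreover have "nielsen_step (g \<otimes> inv h, h) (inv h \<otimes> g, h)"
    using conj[of "g \<otimes> inv h" h "inv h"] gh by (simp add: m_assoc)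
  ultimately show "nielsen p (inv h \<otimes> g, h)" by (rule rtranclp.rtrancl_into_rtrancl)
qed

lemma nielsen_conj:
  "nielsen p (g, h) \<Longrightarrow> g \<in> carrier G \<Longrightarrow> h \<in> carrier G \<Longrightarrow> k \<in> carrier G \<Longrightarrow>
    nielsen p (k \<otimes> g \<otimes> inv k, k \<otimes> h \<otimes> inv k)"
  by (meson conj rtranclp.rtrancl_into_rtrancl)

lemma conj_hom: "k \<in> carrier G \<Longrightarrow> (\<lambda>g. k \<otimes> g \<otimes> inv k) \<in> hom G G"
  by (rule homI) (auto simp: m_assoc)

lemma generate_pair_mono:
  assumes "Y \<subseteq> carrier G" "g \<in> generate G Y" "h \<in> generate G Y" "generate G {g, h} = carrier G"
  shows "generate G Y = carrier G"
proof -
  have "generate G {g, h} \<subseteq> generate G Y"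
    using assms by (intro generate_subgroup_incl generate_is_subgroup) auto
  then show ?thesis using assms generate_incl[OF assms(1)] by auto
qed

lemma nielsen_step_generate:
  "nielsen_step p p' \<Longrightarrow> generate G {fst p, snd p} = carrier G \<Longrightarrow> generate G {fst p', snd p'} = carrier G"
proof (induction rule: nielsen_step.induct)
  case (rotate g h)
  have "inv (inv g) \<in> generate G {h, inv g}" by (rule generate.inv) simp
  then show ?case
    by (intro generate_pair_mono[of "{_, _}" g h, OF _ _ _ rotate(3)[unfolded fst_conv snd_conv]])
      (use rotate(1,2) in \<open>auto intro: generate.incl\<close>)
next
  case (shear g h)
  have "inv g \<otimes> (g \<otimes> h) \<in> generate G {g, g \<otimes> h}"
    by (intro generate.eng generate.inv generate.incl) auto
  then show ?case
    by (intro generate_pair_mono[of "{_, _}" g h, OF _ _ _ shear(3)[unfolded fst_conv snd_conv]])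
      (use shear(1,2) in \<open>auto intro: generate.incl\<close>)
next
  case (shear_inv g h)
  have "g \<otimes> (inv g \<otimes> h) \<in> generate G {g, inv g \<otimes> h}"
    by (intro generate.eng generate.incl) auto
  then show ?case
    by (intro generate_pair_mono[of "{_, _}" g h, OF _ _ _ shear_inv(3)[unfolded fst_conv snd_conv]])
      (use shear_inv(1,2) in \<open>auto intro: generate.incl\<close>)
next
  case (conj g h k)
  interpret c: group_hom G G "\<lambda>g. k \<otimes> g \<otimes> inv k"
    using conj_hom[OF conj(3)] group_axioms by (simp add: group_hom_def group_hom_axioms_def)
  have "(\<lambda>g. k \<otimes> g \<otimes> inv k) ` generate G {g, h} = generate G ((\<lambda>g. k \<otimes> g \<otimes> inv k) ` {g, h})"
    using conj by (intro c.generate_img[symmetric]) auto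
  moreover have "(\<lambda>g. k \<otimes> g \<otimes> inv k) ` carrier G = carrier G"
  proof (intro equalityI subsetI)
    fix x assume "x \<in> carrier G"
    then show "x \<in> (\<lambda>g. k \<otimes> g \<otimes> inv k) ` carrier G"
      using conj by (intro image_eqI[of _ _ "inv k \<otimes> x \<otimes> k"]) (auto simp: m_assoc)
  qed (use conj in auto)
  ultimately show ?case using conj by simp
qed

lemma nielsen_generate:
  "nielsen p p' \<Longrightarrow> generate G {fst p, snd p} = carrier G \<Longrightarrow> generate G {fst p', snd p'} = carrier G"
  by (induction rule: rtranclp_induct) (auto dest: nielsen_step_generate)

end

section \<open>Cancellation and Nielsen reduction\<close>

context free_group begin

definition len where "len g = length (nf g)"

text \<open>The number of letters that each factor loses in the product
  \<open>g \<otimes> h\<close>, i.e. the Gromov product of \<open>inv g\<close> and \<open>h\<close>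
  for the word metric.\<close>

definition canc where "canc g h = (len g + len h - len (g \<otimes> h)) div 2"

lemma nf_mult_canc:
  assumes "g \<in> carrier G" "h \<in> carrier G"
  obtains u s w where "nf g = u @ s" "nf h = word_inv s @ w" "nf (g \<otimes> h) = u @ w" "reduced_word (u @ w)"
    "length s = canc g h" "len g + len h = len (g \<otimes> h) + 2 * canc g h"
proof -
  obtain u s w where c: "nf g = u @ s" "nf h = word_inv s @ w" "nf (g \<otimes> h) = u @ w" "reduced_word (u @ w)"
    using nf_mult[OF assms] by metis
  moreover have l: "length s = canc g h" using c(1-3) by (simp add: canc_def len_def)
  moreover have "len g + len h = len (g \<otimes> h) + 2 * canc g h"
    unfolding l[symmetric] using c(1-3) by (simp add: len_def)
  ultimately show ?thesis using that by blast
qed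

lemma len_inv: "g \<in> carrier G \<Longrightarrow> len (inv g) = len g"
  by (simp add: len_def nf_inv)

lemma len_eq_0: "g \<in> carrier G \<Longrightarrow> len g = 0 \<longleftrightarrow> g = \<one>"
  using nf(3)[of g] by (auto simp: len_def)

lemma len_mult_le:
  assumes "g \<in> carrier G" "h \<in> carrier G" shows "len (g \<otimes> h) \<le> len g + len h"
proof -
  have "len g + len h = len (g \<otimes> h) + 2 * canc g h" using nf_mult_canc[OF assms] by metis
  then show ?thesis by simp
qed

lemma len_word_val_le: "fst ` set w \<subseteq> X \<Longrightarrow> len (word_val G w) \<le> length w"
proof (induction w)
  case (Cons l w)
  have "len (letter_val G l) = 1" using nf_eq[of "[l]"] Cons.prems X_sub by (auto simp: len_def)
  then show ?case using Cons len_mult_le[of "letter_val G l" "word_val G w"] X_sub word_in_carrier[of w] by auto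
qed (simp add: len_def)

text \<open>If at least half of \<open>g\<close> cancelled in its square, the overlap
  \<open>t\<close> of the two cancelled parts would be its own inverse and hence empty. Then the
  normal form consists of two mutually inverse halves, which forces it to be empty.\<close>

lemma canc_self_less:
  assumes g: "g \<in> carrier G" "g \<noteq> \<one>" shows "2 * canc g g < len g"
proof (rule ccontr)
  assume n: "\<not> ?thesis"
  obtain u s w where c: "nf g = u @ s" "nf g = word_inv s @ w" "reduced_word (u @ w)" "length s = canc g g"
    using nf_mult_canc[OF g(1) g(1)] by metis
  have "length u \<le> length (word_inv s)" using n c(4) arg_cong[OF c(1), of length] by (simp add: len_def)
  then obtain t where t: "word_inv s = u @ t" "s = t @ w"
    using append_eq_append_prefix[of u s "word_inv s" w] c(1,2) by auto
  have "word_inv w @ word_inv t = u @ t" using t by (metis word_inv_simps(3))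
  moreover have "length (word_inv t) = length t" by simp
  ultimately have e: "word_inv w = u" "word_inv t = t" by (metis append_eq_append_conv)+
  have "reduced_word t" using nf(1)[OF g(1)] c(1) t(2) by (simp add: reduced_word_append)
  then have "t = []" using e by (intro reduced_self_inverse)
  moreover have "w = []" using reduced_word_no_self_inverse[of u] c(3) e(1) by (metis word_inv_simps(1,2))
  ultimately have "nf g = []" using c(2) t by simp
  then show False using len_eq_0[OF g(1)] g(2) by (simp add: len_def)
qed

text \<open>In a product of letters each of which keeps an uncancelled middle part, no letter disappears.\<close>

lemma length_le_len_word_val:
  assumes Y: "Y \<subseteq> carrier G"
    and c1: "\<And>l m. fst l \<in> Y \<Longrightarrow> fst m \<in> Y \<Longrightarrow> m \<noteq> letter_inv l \<Longrightarrow>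
      canc (letter_val G l) (letter_val G m) < len (letter_val G l) \<and>
      canc (letter_val G l) (letter_val G m) < len (letter_val G m)"
    and c2: "\<And>l m n. fst l \<in> Y \<Longrightarrow> fst m \<in> Y \<Longrightarrow> fst n \<in> Y \<Longrightarrow> m \<noteq> letter_inv l \<Longrightarrow> n \<noteq> letter_inv m \<Longrightarrow>
      canc (letter_val G l) (letter_val G m) + canc (letter_val G m) (letter_val G n) < len (letter_val G m)"
    and w: "reduced_word w" "fst ` set w \<subseteq> Y"
  shows "length w \<le> len (word_val G w)"
proof -
  define c where "c w l = (if w = [] then 0 else canc (letter_val G (last w)) (letter_val G l))" for w l
  \<comment> \<open>Invariant: the normal form ends in what the last letter keeps after cancellation
    with its predecessor, and the part \<open>p\<close> before it has at least one letter for every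
    earlier factor.\<close>
  have main: "\<exists>p. nf (word_val G (w @ [l])) = p @ drop (c w l) (nf (letter_val G l)) \<and> length w \<le> length p"
    if "reduced_word (w @ [l])" "fst ` set (w @ [l]) \<subseteq> Y" for w l
    using that
  proof (induction w arbitrary: l rule: rev_induct)
    case Nil
    then show ?case using Y by (auto simp: c_def)
  next
    case (snoc k w)
    have kl: "fst k \<in> Y" "fst l \<in> Y" "l \<noteq> letter_inv k"
      using snoc.prems by (auto simp: reduced_word_append)
    have r: "reduced_word (w @ [k])" "fst ` set (w @ [k]) \<subseteq> Y"
      using snoc.prems by (auto simp: reduced_word_append)
    define W gk gl where "W = word_val G (w @ [k])" and "gk = letter_val G k" and "gl = letter_val G l"
    have cl: "W \<in> carrier G" "gk \<in> carrier G" "gl \<in> carrier G"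
      using word_val_closed[OF order_trans[OF r(2) Y]] kl Y by (auto simp: W_def gk_def gl_def)
    have Wl: "word_val G ((w @ [k]) @ [l]) = W \<otimes> gl"
      using word_val_append[OF order_trans[OF r(2) Y], of "[l]"] kl Y cl by (auto simp: W_def gl_def)
    obtain p where p: "nf W = p @ drop (c w k) (nf gk)" "length w \<le> length p"
      using snoc.IH[OF r] by (auto simp: W_def gk_def)
    obtain u s v where d: "nf gk = u @ s" "nf gl = word_inv s @ v" "reduced_word (u @ v)" "length s = canc gk gl"
      using nf_mult_canc[OF cl(2,3)] by metis
    have "c w k + canc gk gl < len gk"
    proof (cases "w = []")
      case True
      then show ?thesis using c1[OF kl] by (simp add: c_def gk_def gl_def)
    next
      case False
      then have "fst (last w) \<in> Y" "k \<noteq> letter_inv (last w)"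
        using r last_in_set[OF False] by (auto simp: reduced_word_append image_subset_iff)
      then show ?thesis using c2[of "last w" k l] kl False by (simp add: c_def gk_def gl_def)
    qed
    then have cu: "c w k < length u" using d by (simp add: len_def)
    define T where "T = drop (c w k) u"
    have T: "T \<noteq> []" using cu by (simp add: T_def)
    have nfW: "nf W = (p @ T) @ s" using p(1) d(1) cu by (simp add: T_def)
    have "reduced_word (p @ T)" using nf(1)[OF cl(1)] reduced_word_append[of "p @ T" s] unfolding nfW by blast
    moreover have "reduced_word (T @ v)"
      using d(3) reduced_word_append[of "take (c w k) u" "T @ v"] by (simp add: T_def flip: append_assoc)
    ultimately have red: "reduced_word ((p @ T) @ v)" using T by (auto simp: reduced_word_append)
    have sub: "fst ` set ((p @ T) @ s) \<subseteq> X" "fst ` set (word_inv s @ v) \<subseteq> X"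
      using nf(2)[OF cl(1)] nf(2)[OF cl(3)] by (simp_all only: nfW d(2))
    have "word_val G ((p @ T) @ v) = W \<otimes> gl"
      using word_val_cancel[OF word_in_carrier[OF sub(1)] word_in_carrier[OF sub(2)]] nf(3) cl
      by (simp only: flip: nfW d(2))
    moreover have "fst ` set ((p @ T) @ v) \<subseteq> X" using sub by (auto simp: image_Un)
    ultimately have nfp: "nf (W \<otimes> gl) = (p @ T) @ v" using nf_eq[OF red] by simp
    have v: "v = drop (canc gk gl) (nf gl)" using d by simp
    show ?case
    proof (intro exI conjI)
      show "nf (word_val G ((w @ [k]) @ [l])) = (p @ T) @ drop (c (w @ [k]) l) (nf (letter_val G l))"
        unfolding Wl nfp by (simp add: c_def v flip: gk_def gl_def)
      show "length (w @ [k]) \<le> length (p @ T)" using p(2) T by (cases T) auto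
    qed
  qed
  show ?thesis
  proof (cases w rule: rev_cases)
    case (snoc w0 l)
    obtain p where p: "nf (word_val G w) = p @ drop (c w0 l) (nf (letter_val G l))" "length w0 \<le> length p"
      using main[of w0 l] w snoc by auto
    have "c w0 l < len (letter_val G l)"
    proof (cases "w0 = []")
      case True
      then show ?thesis using c1[of l l] w snoc by (auto simp: c_def)
    next
      case False
      then have "fst (last w0) \<in> Y" "l \<noteq> letter_inv (last w0)" "fst l \<in> Y"
        using w snoc last_in_set[OF False] by (auto simp: reduced_word_append image_subset_iff)
      then show ?thesis using c1[of "last w0" l] False by (simp add: c_def)
    qed
    then show ?thesis using p snoc by (simp add: len_def)
  qed simp
qed

text \<open>A pair of minimal total length under Nielsen moves and conjugation is Nielsen reduced: if a letter
  \<open>h\<close> were cancelled completely between two copies of \<open>g\<close>, then multiplying \<open>g\<close> by \<open>h\<close> and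
  conjugating would shorten the pair.\<close>

theorem nielsen_reduction:
  assumes uv: "u \<in> carrier G" "v \<in> carrier G" "generate G {u, v} = carrier G"
    and nontrivial: "\<And>x y. nielsen (u, v) (x, y) \<Longrightarrow> x \<noteq> \<one> \<and> y \<noteq> \<one>"
  shows "\<exists>x y. nielsen (u, v) (x, y) \<and> X \<subseteq> {x, y, inv x, inv y}"
proof -
  obtain p where p: "nielsen (u, v) p"
    "\<And>q. nielsen (u, v) q \<Longrightarrow> len (fst p) + len (snd p) \<le> len (fst q) + len (snd q)"
    using ex_has_least_nat[of "nielsen (u, v)" "(u, v)" "\<lambda>q. len (fst q) + len (snd q)"] by auto
  define T where "T = len (fst p) + len (snd p)"
  have T: "T \<le> len x + len y" if "nielsen (u, v) (x, y)" for x y using p(2)[OF that] by (simp add: T_def)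
  define mn where "mn x y \<longleftrightarrow> nielsen (u, v) (x, y) \<and> len x + len y = T" for x y
  have mn_carrier: "x \<in> carrier G" "y \<in> carrier G" if "mn x y" for x y
    using nielsen_carrier[of "(u, v)" "(x, y)"] that uv by (auto simp: mn_def)
  have rot: "mn y (inv x)" "mn (inv x) (inv y)" "mn (inv y) x" if "mn x y" for x y
    using that nielsen_rotate[of "(u, v)" x y] mn_carrier[OF that] by (auto simp: mn_def len_inv)
  define mixed where "mixed g h \<longleftrightarrow> g \<in> carrier G \<and> h \<in> carrier G \<and> (mn g h \<or> mn (inv g) h)" for g h
  have mixedD: "len g \<le> len (g \<otimes> h) \<and> len h \<le> len (g \<otimes> h) \<and> len g + len h = T \<and>
      (\<forall>k\<in>carrier G. T \<le> len (k \<otimes> (g \<otimes> h) \<otimes> inv k) + len (k \<otimes> h \<otimes> inv k))" if m: "mixed g h" for g h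
  proof -
    have gh: "g \<in> carrier G" "h \<in> carrier G" using m by (auto simp: mixed_def)
    consider "mn g h" | "mn (inv g) h" using m by (auto simp: mixed_def)
    then show ?thesis
    proof cases
      case 1
      then have r: "nielsen (u, v) (g, h)" "len g + len h = T" by (auto simp: mn_def)
      note sh = nielsen_shears[OF r(1) gh]
      have "T \<le> len g + len (g \<otimes> h)" "T \<le> len (g \<otimes> h) + len h" using T sh by blast+
      moreover have "T \<le> len (k \<otimes> (g \<otimes> h) \<otimes> inv k) + len (k \<otimes> h \<otimes> inv k)" if "k \<in> carrier G" for k
        using T nielsen_conj[OF sh(3) _ _ that] gh by blast
      ultimately show ?thesis using r(2) by auto
    next
      case 2
      then have r: "nielsen (u, v) (inv g, h)" "len g + len h = T" using gh by (auto simp: mn_def len_inv)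
      note sh = nielsen_shears[OF r(1) _ gh(2)]
      have s: "nielsen (u, v) (inv g, g \<otimes> h)" "nielsen (u, v) (inv (g \<otimes> h), h)"
        using sh(2,4) gh by (simp_all add: inv_mult_group)
      have "T \<le> len (inv g) + len (g \<otimes> h)" "T \<le> len (inv (g \<otimes> h)) + len h" using T s by blast+
      moreover have "T \<le> len (k \<otimes> (g \<otimes> h) \<otimes> inv k) + len (k \<otimes> h \<otimes> inv k)" if k: "k \<in> carrier G" for k
      proof -
        have "T \<le> len (k \<otimes> inv (g \<otimes> h) \<otimes> inv k) + len (k \<otimes> h \<otimes> inv k)"
          using T nielsen_conj[OF s(2) _ _ k] gh by blast
        moreover have "k \<otimes> inv (g \<otimes> h) \<otimes> inv k = inv (k \<otimes> (g \<otimes> h) \<otimes> inv k)"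
          using gh k by (simp add: inv_mult_group m_assoc)
        ultimately show ?thesis using gh k by (simp add: len_inv)
      qed
      ultimately show ?thesis using r(2) gh by (auto simp: len_inv)
    qed
  qed
  obtain x y where xy: "p = (x, y)" by (cases p)
  have m0: "mn x y" using p(1) xy by (simp add: mn_def T_def)
  note xyc = mn_carrier[OF m0]
  have mixedI: "mixed (letter_val G l) (letter_val G m)" if "fst l \<in> {x, y}" "fst m \<in> {x, y}" "fst l \<noteq> fst m" for l m
    using that m0 rot[OF m0] xyc by (cases l; cases m) (auto simp: mixed_def letter_val_def)
  have carr: "letter_val G l \<in> carrier G" if "fst l \<in> {x, y}" for l using that xyc by auto
  have nt: "letter_val G l \<noteq> \<one>" if "fst l \<in> {x, y}" for l
    using that nontrivial[of x y] p(1) xy xyc by (auto simp: letter_val_def)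
  \<comment> \<open>For letters from different generators, minimality says that the product is no
    shorter than either factor, so at most half of each is cancelled. For a repeated letter,
    \<open>canc_self_less\<close> gives the strict bound.\<close>
  have half: "2 * canc (letter_val G l) (letter_val G m) \<le> len (letter_val G l)"
    "2 * canc (letter_val G l) (letter_val G m) \<le> len (letter_val G m)"
    "fst l = fst m \<Longrightarrow> 2 * canc (letter_val G l) (letter_val G m) < len (letter_val G m)"
    if lm: "fst l \<in> {x, y}" "fst m \<in> {x, y}" "m \<noteq> letter_inv l" for l m
  proof -
    show 3: "fst l = fst m \<Longrightarrow> 2 * canc (letter_val G l) (letter_val G m) < len (letter_val G m)"
    proof -
      assume "fst l = fst m"
      then have "m = l" using lm(3) by (auto simp: letter_inv_def prod_eq_iff)
      then show ?thesis using canc_self_less[OF carr nt] lm by simp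
    qed
    have "2 * canc (letter_val G l) (letter_val G m) \<le> len (letter_val G l) \<and>
      2 * canc (letter_val G l) (letter_val G m) \<le> len (letter_val G m)"
    proof (cases "fst l = fst m")
      case True
      then have "m = l" using lm(3) by (auto simp: letter_inv_def prod_eq_iff)
      then show ?thesis using 3[OF True] by simp
    next
      case False
      have "len (letter_val G l) + len (letter_val G m)
          = len (letter_val G l \<otimes> letter_val G m) + 2 * canc (letter_val G l) (letter_val G m)"
        using nf_mult_canc[OF carr[OF lm(1)] carr[OF lm(2)]] by metis
      then show ?thesis using mixedD[OF mixedI[OF lm(1,2) False]] by linarith
    qed
    then show "2 * canc (letter_val G l) (letter_val G m) \<le> len (letter_val G l)"
      "2 * canc (letter_val G l) (letter_val G m) \<le> len (letter_val G m)" by auto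
  qed
  have pos: "len (letter_val G l) > 0" if "fst l \<in> {x, y}" for l
    using len_eq_0[OF carr[OF that]] nt[OF that] by simp
  have N2: "canc (letter_val G l) (letter_val G m) + canc (letter_val G m) (letter_val G n) < len (letter_val G m)"
    if lmn: "fst l \<in> {x, y}" "fst m \<in> {x, y}" "fst n \<in> {x, y}" "m \<noteq> letter_inv l" "n \<noteq> letter_inv m" for l m n
  proof (rule ccontr)
    assume neg: "\<not> ?thesis"
    define gl gm gn where "gl = letter_val G l" and "gm = letter_val G m" and "gn = letter_val G n"
    note gd = gl_def gm_def gn_def
    have cl: "gl \<in> carrier G" "gm \<in> carrier G" "gn \<in> carrier G" using carr lmn by (auto simp: gd)
    note h1 = half[OF lmn(1,2,4), folded gd] note h2 = half[OF lmn(2,3,5), folded gd]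
    have eq: "2 * canc gl gm = len gm" "2 * canc gm gn = len gm"
      using h1(2) h2(1) neg by (auto simp: gd)
    have ne: "fst l \<noteq> fst m" using h1(3) eq by auto
    have ne': "fst m \<noteq> fst n"
    proof
      assume e: "fst m = fst n"
      then have "n = m" using lmn(5) by (auto simp: letter_inv_def prod_eq_iff)
      then show False using h2(3)[OF e] eq by (simp add: gd)
    qed
    have "fst l = fst n" using ne ne' lmn by auto
    then consider "n = l" | "n = letter_inv l" by (auto simp: letter_inv_def prod_eq_iff)
    moreover obtain a s b where d1: "nf gl = a @ s" "nf gm = word_inv s @ b" "length s = canc gl gm"
      using nf_mult_canc[OF cl(1,2)] by metis
    moreover obtain a' s' b' where d2: "nf gm = a' @ s'" "nf gn = word_inv s' @ b'" "length s' = canc gm gn"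
      using nf_mult_canc[OF cl(2,3)] by metis
    ultimately show False
    proof cases
      \<comment> \<open>When the two neighbours of the letter are mutually inverse, the two
        cancelled halves match up and the normal form of \<open>gm\<close> would be
        \<open>word_inv s @ s\<close>, which is not reduced.\<close>
      case 2
      note d1 d2
      have ls: "length s = length s'" using d1(3) d2(3) eq by simp
      have "length b = length s'" using arg_cong[OF d1(2), of length] d1(3) eq ls by (simp add: len_def)
      moreover have "word_inv s @ b = a' @ s'" by (rule trans[OF d1(2)[symmetric] d2(1)])
      ultimately have "b = s'"
        using append_eq_append_conv[where us = b and vs = s' and xs = "word_inv s" and ys = a'] by blast
      then have m: "nf gm = word_inv s @ s'" using d1(2) by (rule subst)
      have "gn = inv gl" using 2 cl lmn xyc by (auto simp: gd)
      then have "nf gn = word_inv s @ word_inv a" using nf_inv[OF cl(1)] d1(1) by simp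
      then have "word_inv s = word_inv s'" using d2(2) ls by (metis append_eq_append_conv word_inv_simps(4))
      then have "reduced_word (word_inv s @ word_inv (word_inv s))" using nf(1)[OF cl(2)] m by (metis word_inv_simps(2))
      then have "word_inv s = []" by (rule reduced_word_no_self_inverse)
      then show False using eq d1(3) pos[OF lmn(2)] by (auto simp: gd dest: arg_cong[of _ _ length])
    next
      \<comment> \<open>When both neighbours are equal, \<open>gl\<close> is
        \<open>inv S' \<otimes> M \<otimes> S\<close> and \<open>gm\<close> is
        \<open>inv S \<otimes> S'\<close>. The pair formed by \<open>gl \<otimes> gm\<close> and
        \<open>gm\<close>, conjugated by \<open>S'\<close>, becomes \<open>M\<close> and
        \<open>S' \<otimes> inv S\<close>; its total length is at most \<open>len gl\<close>, less
        than the minimum \<open>T\<close>.\<close>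
      case 1
      note d1 d2
      have ls: "length s = length s'" using d1(3) d2(3) eq by simp
      have "length b = length s'" using arg_cong[OF d1(2), of length] d1(3) eq ls by (simp add: len_def)
      moreover have "word_inv s @ b = a' @ s'" by (rule trans[OF d1(2)[symmetric] d2(1)])
      ultimately have "b = s'"
        using append_eq_append_conv[where us = b and vs = s' and xs = "word_inv s" and ys = a'] by blast
      then have m: "nf gm = word_inv s @ s'" using d1(2) by (rule subst)
      have l: "nf gl = word_inv s' @ b'" using d2(2) 1 by (simp add: gd)
      have "length (word_inv s') \<le> length a"
        using h1(1) d1(1,3) ls arg_cong[OF d1(1), of length] by (simp add: len_def)
      then obtain t where t: "a = word_inv s' @ t"
        using append_eq_append_prefix[of "word_inv s'" b' a s] d1(1) l by auto
      have nl: "nf gl = word_inv s' @ (t @ s)" using d1(1) t by simp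
      have sub: "fst ` set s \<subseteq> X" "fst ` set s' \<subseteq> X" "fst ` set t \<subseteq> X"
        using nf(2)[OF cl(1)] nf(2)[OF cl(2)] unfolding nl m by (auto simp: image_Un)
      note subc = sub[THEN word_in_carrier]
      define S S' M where "S = word_val G s" and "S' = word_val G s'" and "M = word_val G t"
      have c: "S \<in> carrier G" "S' \<in> carrier G" "M \<in> carrier G" using subc by (auto simp: S_def S'_def M_def)
      have "fst ` set (t @ s) \<subseteq> carrier G" using subc by (auto simp: image_Un)
      then have gl: "gl = inv S' \<otimes> (M \<otimes> S)" and gm: "gm = inv S \<otimes> S'"
        using nf(3)[OF cl(1)] nf(3)[OF cl(2)] subc unfolding nl m
        by (simp_all add: word_val_append word_val_inv S_def S'_def M_def)
      have "T \<le> len (S' \<otimes> (gl \<otimes> gm) \<otimes> inv S') + len (S' \<otimes> gm \<otimes> inv S')"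
        using mixedD[OF mixedI[OF lmn(1,2) ne]] c(2) by (simp add: gd)
      moreover have "S' \<otimes> (gl \<otimes> gm) \<otimes> inv S' = M" using c by (simp add: gl gm m_assoc)
      moreover have "S' \<otimes> gm \<otimes> inv S' = word_val G (s' @ word_inv s)"
        using c subc by (simp add: gm m_assoc word_val_append word_val_inv S_def S'_def)
      moreover have "len (word_val G (s' @ word_inv s)) \<le> length (s' @ word_inv s)"
        using sub by (intro len_word_val_le) (auto simp: image_Un)
      moreover have "len M \<le> length t" unfolding M_def by (rule len_word_val_le[OF sub(3)])
      moreover have "len gl = length s' + length t + length s" unfolding len_def nl by simp
      moreover have "len gl + len gm = T" using mixedD[OF mixedI[OF lmn(1,2) ne]] by (simp add: gd)
      moreover have "len gm > 0" using pos[OF lmn(2)] by (simp add: gd)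
      ultimately show False by simp
    qed
  qed
  have gen: "generate G {x, y} = carrier G" using nielsen_generate[OF p(1)] uv xy by simp
  have "z \<in> {x, y, inv x, inv y}" if z: "z \<in> X" for z
  proof -
    have "z \<in> generate G {x, y}" using z X_sub gen by auto
    then obtain w where w: "reduced_word w" "fst ` set w \<subseteq> {x, y}" "word_val G w = z"
      using generate_reduced_word[of "{x, y}"] xyc by auto
    have "length w \<le> len (word_val G w)"
    proof (rule length_le_len_word_val[of "{x, y}"])
      fix l m assume lm: "fst l \<in> {x, y}" "fst m \<in> {x, y}" "m \<noteq> letter_inv l"
      show "canc (letter_val G l) (letter_val G m) < len (letter_val G l) \<and>
          canc (letter_val G l) (letter_val G m) < len (letter_val G m)"
        using half(1,2)[OF lm] pos[OF lm(1)] pos[OF lm(2)] by linarith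
    qed (use N2 w xyc in auto)
    then have "length w \<le> 1" using w(3) nf_basis[OF z] by (simp add: len_def)
    moreover have "w \<noteq> []" using w(3) nf_basis[OF z] nf_one by auto
    ultimately obtain l where "w = [l]" by (cases w) auto
    then show ?thesis using w(2,3) xyc by (auto simp: letter_val_def split: if_splits)
  qed
  then show ?thesis using p(1) xy by blast
qed

end

section \<open>Free bases of rank two\<close>

text \<open>The rotation and the shears generate the matrices of determinant 1. The Euclidean
  algorithm runs on the second coordinate of \<open>v\<close>: after division with remainder, the
  pair \<open>- w', v\<close> has a smaller one, and a rotation followed by shears leads
  back.\<close>

lemma det_1_induct:
  assumes base: "P (1, 0) (0, 1)"
    and rotate: "\<And>v w. P v w \<Longrightarrow> P w (- v)"
    and shear: "\<And>v w. P v w \<Longrightarrow> P v (v + w)" "\<And>v w. P v w \<Longrightarrow> P v (w - v)"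
    and "vdet v w = 1"
  shows "P v w"
proof -
  have shears: "P v (w + (n * fst v, n * snd v))" if p: "P v w" for v w :: "int \<times> int" and n :: int
  proof (induction n rule: int_induct[of _ 0])
    case base
    then show ?case using p by (simp add: zero_prod_def[symmetric])
  next
    case (step1 i)
    have "v + (w + (i * fst v, i * snd v)) = w + ((i + 1) * fst v, (i + 1) * snd v)"
      by (simp add: prod_eq_iff algebra_simps)
    then show ?case using shear(1)[OF step1(2)] by metis
  next
    case (step2 i)
    have "w + (i * fst v, i * snd v) - v = w + ((i - 1) * fst v, (i - 1) * snd v)"
      by (simp add: prod_eq_iff algebra_simps)
    then show ?case using shear(2)[OF step2(2)] by metis
  qed
  show ?thesis using assms(5)
  proof (induction "nat \<bar>snd v\<bar>" arbitrary: v w rule: less_induct)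
    case less
    show ?case
    proof (cases "snd v = 0")
      case True
      then have "fst v * snd w = 1" using less.prems by (simp add: vdet_def)
      then have "fst v = 1 \<and> snd w = 1 \<or> fst v = -1 \<and> snd w = -1" by (auto simp: zmult_eq_1_iff)
      then show ?thesis
      proof
        assume e: "fst v = 1 \<and> snd w = 1"
        have "P (1, 0) ((0, 1) + (fst w * fst (1::int, 0::int), fst w * snd (1::int, 0::int)))"
          by (rule shears[OF base])
        moreover have "v = (1, 0)" "w = (0, 1) + (fst w * fst (1::int, 0::int), fst w * snd (1::int, 0::int))"
          using e True by (auto simp: prod_eq_iff)
        ultimately show ?thesis by metis
      next
        assume e: "fst v = -1 \<and> snd w = -1"
        have "P (- (1, 0)) (- (0, 1))" by (rule rotate[OF rotate[OF base]])
        from shears[OF this, of "- fst w"] have "P (-1, 0) (fst w, -1)" by simp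
        moreover have "v = (-1, 0)" "w = (fst w, -1)" using e True by (auto simp: prod_eq_iff)
        ultimately show ?thesis by metis
      qed
    next
      case False
      define n w' where "n = snd w div snd v" and "w' = w - (n * fst v, n * snd v)"
      have "snd w' = snd w mod snd v" by (simp add: w'_def n_def minus_div_mult_eq_mod)
      then have lt: "\<bar>snd (- w')\<bar> < \<bar>snd v\<bar>" using False by (simp add: abs_mod_less)
      have "vdet v w' = 1"
        using less.prems by (simp add: w'_def vdet_def algebra_simps)
      then have "vdet (- w') v = 1" using vdet_swap[of v w'] by simp
      then have "P (- w') v" using lt by (intro less.hyps) auto
      from shears[OF rotate[OF this], of n] show ?thesis by (simp add: w'_def)
    qed
  qed
qed

section \<open>Marked pairs in the free group of rank two\<close>

locale rank_two = group G for G (structure) +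
  fixes a b assumes free: "free_basis G {a, b}" and neq: "a \<noteq> b"

sublocale rank_two \<subseteq> free_group G "{a, b}"
  using free by unfold_locales

context rank_two begin

lemma ab_carrier [simp]: "a \<in> carrier G" "b \<in> carrier G"
  using X_sub by auto

text \<open>The exponent sums of \<open>a\<close> and \<open>b\<close>, that is, the image in the
  abelianization.\<close>

definition hvec :: "'a \<Rightarrow> int \<times> int" where
  "hvec g = (extend integer_group (\<lambda>x. if x = a then 1 else 0) g, extend integer_group (\<lambda>x. if x = b then 1 else 0) g)"

lemma hvec_mult: "g \<in> carrier G \<Longrightarrow> h \<in> carrier G \<Longrightarrow> hvec (g \<otimes> h) = hvec g + hvec h"
  using hom_mult[OF extend_hom(1)[OF group_integer_group]] by (simp add: hvec_def)

lemma hvec_one: "hvec \<one> = 0"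
  using hvec_mult[of \<one> \<one>] by simp

lemma hvec_inv: "g \<in> carrier G \<Longrightarrow> hvec (inv g) = - hvec g"
  using hvec_mult[of g "inv g"] by (simp add: hvec_one eq_neg_iff_add_eq_0 add.commute)

lemma hvec_ab: "hvec a = (1, 0)" "hvec b = (0, 1)"
  using extend_hom(2)[OF group_integer_group] neq by (simp_all add: hvec_def)

lemma hvec_conj: "g \<in> carrier G \<Longrightarrow> k \<in> carrier G \<Longrightarrow> hvec (k \<otimes> g \<otimes> inv k) = hvec g"
  by (simp add: hvec_mult hvec_inv)

lemmas hvec_simps = hvec_mult hvec_inv hvec_one hvec_ab hvec_conj

lemma hvec_span:
  assumes "Y \<subseteq> carrier G" "g \<in> generate G Y" "\<And>y. y \<in> Y \<Longrightarrow> L (hvec y)"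
    "L 0" "\<And>v. L v \<Longrightarrow> L (- v)" "\<And>v w. L v \<Longrightarrow> L w \<Longrightarrow> L (v + w)"
  shows "L (hvec g)"
  using assms(2)
proof (induction rule: generate.induct)
  case (inv h)
  then show ?case using assms(1,3,5) by (metis hvec_inv subsetD)
next
  case (eng g h)
  then show ?case using assms(6) generate_in_carrier[OF assms(1)] by (metis hvec_mult)
qed (use assms in \<open>auto simp: hvec_one\<close>)

lemma nielsen_vdet:
  "nielsen p p' \<Longrightarrow> fst p \<in> carrier G \<Longrightarrow> snd p \<in> carrier G \<Longrightarrow>
    vdet (hvec (fst p')) (hvec (snd p')) = vdet (hvec (fst p)) (hvec (snd p))"
proof (induction rule: rtranclp_induct)
  case (step q q')
  have "vdet (hvec (fst q')) (hvec (snd q')) = vdet (hvec (fst q)) (hvec (snd q))"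
    using step(2)
  proof (cases rule: nielsen_step.cases)
    case (rotate g h)
    then show ?thesis using vdet_swap[of "hvec h" "hvec g"] by (simp add: hvec_simps)
  qed (simp_all add: hvec_simps)
  then show ?case using step by simp
qed simp

definition marked :: "'a \<Rightarrow> 'a \<Rightarrow> bool" where "marked g h \<longleftrightarrow> nielsen (a, b) (g, h)"

lemma marked_carrier: "marked g h \<Longrightarrow> g \<in> carrier G \<and> h \<in> carrier G"
  using nielsen_carrier[of "(a, b)" "(g, h)"] by (simp add: marked_def)

lemma marked_vdet: "marked g h \<Longrightarrow> vdet (hvec g) (hvec h) = 1"
  using nielsen_vdet[of "(a, b)" "(g, h)"] by (simp add: marked_def hvec_ab vdet_def)

lemma marked_moves:
  assumes "marked g h"
  shows "marked h (inv g)" "marked (inv g) (inv h)" "marked g (g \<otimes> h)" "marked g (inv g \<otimes> h)" "marked (g \<otimes> h) h"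
    "k \<in> carrier G \<Longrightarrow> marked (k \<otimes> g \<otimes> inv k) (k \<otimes> h \<otimes> inv k)"
proof -
  have c: "g \<in> carrier G" "h \<in> carrier G" using marked_carrier[OF assms] by auto
  note m = assms[unfolded marked_def]
  show "marked h (inv g)" "marked (inv g) (inv h)" unfolding marked_def by (rule nielsen_rotate[OF m c])+
  show "marked g (g \<otimes> h)" "marked g (inv g \<otimes> h)" "marked (g \<otimes> h) h"
    unfolding marked_def by (rule nielsen_shears[OF m c])+
  show "k \<in> carrier G \<Longrightarrow> marked (k \<otimes> g \<otimes> inv k) (k \<otimes> h \<otimes> inv k)"
    unfolding marked_def by (rule nielsen_conj[OF m c])
qed

lemma ex_marked:
  assumes "vdet v w = 1" shows "\<exists>g h. marked g h \<and> hvec g = v \<and> hvec h = w"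
  using assms
proof (induction v w rule: det_1_induct[rotated -1, consumes 1])
  case 1
  then show ?case by (intro exI[of _ a] exI[of _ b]) (simp add: marked_def hvec_ab)
next
  case (2 v w)
  then obtain g h where g: "marked g h" "hvec g = v" "hvec h = w" by blast
  then show ?case using marked_moves(1)[OF g(1)] marked_carrier[OF g(1)]
    by (intro exI[of _ h] exI[of _ "inv g"]) (simp add: hvec_simps)
next
  case (3 v w)
  then obtain g h where g: "marked g h" "hvec g = v" "hvec h = w" by blast
  show ?case using marked_moves(3)[OF g(1)] marked_carrier[OF g(1)] g(2,3)
    by (intro exI[of _ g] exI[of _ "g \<otimes> h"]) (simp add: hvec_simps)
next
  case (4 v w)
  then obtain g h where g: "marked g h" "hvec g = v" "hvec h = w" by blast
  show ?case using marked_moves(4)[OF g(1)] marked_carrier[OF g(1)] g(2,3)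
    by (intro exI[of _ g] exI[of _ "inv g \<otimes> h"]) (simp add: hvec_simps)
qed

text \<open>Canonical representatives of the bases of \<open>\<int>\<^sup>2\<close> whose two vectors lie in a common closed quadrant.
  Up to conjugation, every marked pair is canonical or a rotated canonical pair.\<close>

inductive canon :: "'a \<Rightarrow> 'a \<Rightarrow> bool" where
  base1: "canon a b"
| base2: "canon b (inv a)"
| base3: "canon (inv a) (inv b)"
| base4: "canon (inv b) a"
| left: "canon g h \<Longrightarrow> canon g (g \<otimes> h)"
| right: "canon g h \<Longrightarrow> canon (g \<otimes> h) h"

lemmas base = base1 base2 base3 base4

definition conjugate_pairs :: "'a \<times> 'a \<Rightarrow> 'a \<times> 'a \<Rightarrow> bool" where
  "conjugate_pairs p q \<longleftrightarrow> (\<exists>k\<in>carrier G. q = (k \<otimes> fst p \<otimes> inv k, k \<otimes> snd p \<otimes> inv k))"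

lemma conjugate_pairs_refl: "g \<in> carrier G \<Longrightarrow> h \<in> carrier G \<Longrightarrow> conjugate_pairs (g, h) (g, h)"
  unfolding conjugate_pairs_def by (intro bexI[of _ \<one>]) auto

lemma conjugate_pairs_sym:
  assumes "g \<in> carrier G" "h \<in> carrier G" "conjugate_pairs (g, h) q" shows "conjugate_pairs q (g, h)"
proof -
  obtain k where "k \<in> carrier G" "q = (k \<otimes> g \<otimes> inv k, k \<otimes> h \<otimes> inv k)"
    using assms(3) by (auto simp: conjugate_pairs_def)
  then show ?thesis using assms unfolding conjugate_pairs_def by (intro bexI[of _ "inv k"]) (auto simp: m_assoc)
qed

lemma conjugate_pairs_trans:
  assumes "g \<in> carrier G" "h \<in> carrier G" "conjugate_pairs (g, h) q" "conjugate_pairs q q'"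
  shows "conjugate_pairs (g, h) q'"
proof -
  obtain k k' where k: "k \<in> carrier G" "q = (k \<otimes> g \<otimes> inv k, k \<otimes> h \<otimes> inv k)"
    and k': "k' \<in> carrier G" "q' = (k' \<otimes> fst q \<otimes> inv k', k' \<otimes> snd q \<otimes> inv k')"
    using assms(3,4) by (auto simp: conjugate_pairs_def)
  have "q' = ((k' \<otimes> k) \<otimes> g \<otimes> inv (k' \<otimes> k), (k' \<otimes> k) \<otimes> h \<otimes> inv (k' \<otimes> k))"
    using k k' assms(1,2) by (simp add: m_assoc inv_mult_group)
  then show ?thesis using k k' unfolding conjugate_pairs_def by auto
qed

lemma canon_carrier: "canon g h \<Longrightarrow> g \<in> carrier G \<and> h \<in> carrier G"
  by (induction rule: canon.induct) auto

text \<open>Two rotations invert both entries of a pair, so canonical pairs must be stable under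
  this up to conjugation. The inverse of \<open>g \<otimes> h\<close> multiplies the inverses in the
  wrong order; conjugation by \<open>g\<close>, or by \<open>inv h\<close>, restores the order while
  fixing the entry that is kept.\<close>

lemma canon_inv: "canon g h \<Longrightarrow> \<exists>g' h'. canon g' h' \<and> conjugate_pairs (g', h') (inv g, inv h)"
proof (induction rule: canon.induct)
  case (left g h)
  then obtain g' h' k where c: "canon g' h'" "k \<in> carrier G" "inv g = k \<otimes> g' \<otimes> inv k" "inv h = k \<otimes> h' \<otimes> inv k"
    by (auto simp: conjugate_pairs_def)
  note cc = canon_carrier[OF left(1)] canon_carrier[OF c(1)]
  have "g \<otimes> (k \<otimes> (g' \<otimes> h') \<otimes> inv k) \<otimes> inv g = g \<otimes> (inv g \<otimes> inv h) \<otimes> inv g"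
    unfolding c(3,4) using cc c(2) by (simp add: m_assoc)
  then have "inv (g \<otimes> h) = (g \<otimes> k) \<otimes> (g' \<otimes> h') \<otimes> inv (g \<otimes> k)"
    using cc c(2) by (simp add: m_assoc inv_mult_group)
  moreover have "g \<otimes> (k \<otimes> g' \<otimes> inv k) \<otimes> inv g = inv g"
    unfolding c(3)[symmetric] using cc by (simp add: m_assoc)
  then have "inv g = (g \<otimes> k) \<otimes> g' \<otimes> inv (g \<otimes> k)"
    using cc c(2) by (simp add: m_assoc inv_mult_group)
  ultimately have "conjugate_pairs (g', g' \<otimes> h') (inv g, inv (g \<otimes> h))"
    unfolding conjugate_pairs_def using cc c(2) by (intro bexI[of _ "g \<otimes> k"]) auto
  then show ?case using canon.left[OF c(1)] by blast
next
  case (right g h)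
  then obtain g' h' k where c: "canon g' h'" "k \<in> carrier G" "inv g = k \<otimes> g' \<otimes> inv k" "inv h = k \<otimes> h' \<otimes> inv k"
    by (auto simp: conjugate_pairs_def)
  note cc = canon_carrier[OF right(1)] canon_carrier[OF c(1)]
  have "inv h \<otimes> (k \<otimes> (g' \<otimes> h') \<otimes> inv k) \<otimes> h = inv h \<otimes> (inv g \<otimes> inv h) \<otimes> h"
    unfolding c(3,4) using cc c(2) by (simp add: m_assoc)
  then have "inv (g \<otimes> h) = (inv h \<otimes> k) \<otimes> (g' \<otimes> h') \<otimes> inv (inv h \<otimes> k)"
    using cc c(2) by (simp add: m_assoc inv_mult_group)
  moreover have "inv h \<otimes> (k \<otimes> h' \<otimes> inv k) \<otimes> h = inv h"
    unfolding c(4)[symmetric] using cc by (simp add: m_assoc)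
  then have "inv h = (inv h \<otimes> k) \<otimes> h' \<otimes> inv (inv h \<otimes> k)"
    using cc c(2) by (simp add: m_assoc inv_mult_group)
  ultimately have "conjugate_pairs (g' \<otimes> h', h') (inv (g \<otimes> h), inv h)"
    unfolding conjugate_pairs_def using cc c(2) by (intro bexI[of _ "inv h \<otimes> k"]) auto
  then show ?case using canon.right[OF c(1)] by blast
next
  case base1
  then show ?case using canon.base3 conjugate_pairs_refl[of "inv a" "inv b"] by auto
next
  case base2
  then show ?case using canon.base4 conjugate_pairs_refl[of "inv b" a] by auto
next
  case base3
  then show ?case using canon.base1 conjugate_pairs_refl[of a b] by auto
next
  case base4
  then show ?case using canon.base2 conjugate_pairs_refl[of b "inv a"] by auto
qed

definition has_nf :: "'a \<times> 'a \<Rightarrow> bool" where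
  "has_nf p \<longleftrightarrow> (\<exists>g h. canon g h \<and> (conjugate_pairs (g, h) p \<or> conjugate_pairs (h, inv g) p))"

lemma has_nfI: "canon g h \<Longrightarrow> conjugate_pairs (g, h) p \<Longrightarrow> has_nf p"
  "canon g h \<Longrightarrow> conjugate_pairs (h, inv g) p \<Longrightarrow> has_nf p"
  by (auto simp: has_nf_def)

lemma has_nf_conj:
  assumes "has_nf p" "conjugate_pairs p q" shows "has_nf q"
proof -
  obtain g h where c: "canon g h" "conjugate_pairs (g, h) p \<or> conjugate_pairs (h, inv g) p"
    using assms by (auto simp: has_nf_def)
  then show ?thesis
    using conjugate_pairs_trans[OF _ _ _ assms(2)] canon_carrier[OF c(1)] has_nfI[OF c(1)] by blast
qed

text \<open>The last construction step decides: a last step \<open>right\<close> is undone by the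
  shear, whereas a last step \<open>left\<close> becomes, up to conjugation, the step
  \<open>right\<close> from the same pair.\<close>

lemma canon_rotated_shear: "canon g h \<Longrightarrow> has_nf (h, h \<otimes> inv g)"
proof (induction rule: canon.cases)
  case (left g0 h0)
  note c = canon_carrier[OF left(3)]
  have "conjugate_pairs (g0 \<otimes> h0, h0) (h, h \<otimes> inv g)"
    unfolding conjugate_pairs_def left using c by (intro bexI[of _ "g0 \<otimes> h0"]) (auto simp: m_assoc inv_mult_group)
  then show ?case by (rule has_nfI(1)[OF canon.right[OF left(3)]])
next
  case (right g0 h0)
  note c = canon_carrier[OF right(3)]
  have e: "(h, h \<otimes> inv g) = (h0, inv g0)" using right c by (simp add: inv_mult_group)
  have "has_nf (h0, inv g0)" using has_nfI(2)[OF right(3)] conjugate_pairs_refl[of h0 "inv g0"] c by simp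
  then show ?case by (simp only: e)
next
  case base1
  then show ?case using has_nfI(1)[OF canon.left[OF base2]] conjugate_pairs_refl[of b "b \<otimes> inv a"] by simp
next
  case base2
  then show ?case using has_nfI(1)[OF canon.left[OF base3]] conjugate_pairs_refl[of "inv a" "inv a \<otimes> inv b"] by simp
next
  case base3
  then show ?case using has_nfI(1)[OF canon.left[OF base4]] conjugate_pairs_refl[of "inv b" "inv b \<otimes> a"] by simp
next
  case base4
  then show ?case using has_nfI(1)[OF canon.left[OF base1]] conjugate_pairs_refl[of a "a \<otimes> b"] by simp
qed

lemma canon_shear_inv: "canon g h \<Longrightarrow> has_nf (g, inv g \<otimes> h)"
proof (induction rule: canon.cases)
  case (left g0 h0)
  note c = canon_carrier[OF left(3)]
  then show ?case using has_nfI(1)[OF left(3)] conjugate_pairs_refl left by simp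
next
  case (right g0 h0)
  note c = canon_carrier[OF right(3)]
  have "conjugate_pairs (g0 \<otimes> h0, inv g0) (g, inv g \<otimes> h)"
    unfolding conjugate_pairs_def right using c
    by (intro bexI[of _ "inv (g0 \<otimes> h0)"]) (auto simp: m_assoc inv_mult_group)
  then show ?case by (rule has_nfI(2)[OF canon.left[OF right(3)]])
next
  case base1
  then show ?case using has_nfI(2)[OF canon.right[OF base4]] conjugate_pairs_refl[of a "inv a \<otimes> b"]
    by (simp add: inv_mult_group)
next
  case base2
  then show ?case using has_nfI(2)[OF canon.right[OF base1]] conjugate_pairs_refl[of b "inv b \<otimes> inv a"]
    by (simp add: inv_mult_group)
next
  case base3
  then show ?case using has_nfI(2)[OF canon.right[OF base2]] conjugate_pairs_refl[of "inv a" "a \<otimes> inv b"]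
    by (simp add: inv_mult_group)
next
  case base4
  then show ?case using has_nfI(2)[OF canon.right[OF base3]] conjugate_pairs_refl[of "inv b" "b \<otimes> a"]
    by (simp add: inv_mult_group)
qed

lemma nielsen_step_conj:
  assumes "g \<in> carrier G" "h \<in> carrier G" "conjugate_pairs (g, h) p" "nielsen_step p q"
  shows "conjugate_pairs (h, inv g) q \<or> conjugate_pairs (g, g \<otimes> h) q \<or> conjugate_pairs (g, inv g \<otimes> h) q \<or>
    conjugate_pairs (g, h) q"
proof -
  obtain k where k: "k \<in> carrier G" "p = (k \<otimes> g \<otimes> inv k, k \<otimes> h \<otimes> inv k)"
    using assms(3) by (auto simp: conjugate_pairs_def)
  show ?thesis using assms(4)
  proof (cases rule: nielsen_step.cases)
    case (rotate g' h')
    then have "conjugate_pairs (h, inv g) q" unfolding conjugate_pairs_def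
      using k assms(1,2) by (intro bexI[of _ k]) (auto simp: m_assoc inv_mult_group)
    then show ?thesis by blast
  next
    case (shear g' h')
    then have "conjugate_pairs (g, g \<otimes> h) q" unfolding conjugate_pairs_def
      using k assms(1,2) by (intro bexI[of _ k]) (auto simp: m_assoc inv_mult_group)
    then show ?thesis by blast
  next
    case (shear_inv g' h')
    then have "conjugate_pairs (g, inv g \<otimes> h) q" unfolding conjugate_pairs_def
      using k assms(1,2) by (intro bexI[of _ k]) (auto simp: m_assoc inv_mult_group)
    then show ?thesis by blast
  next
    case (conj g' h' k')
    then have "conjugate_pairs p q" by (auto simp: conjugate_pairs_def)
    then show ?thesis using conjugate_pairs_trans[OF assms(1-3)] by blast
  qed
qed

text \<open>Conjugation is harmless, so each of the other moves has to be checked on canonical and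
  on rotated canonical pairs. Positive shears of a canonical pair are construction steps; the
  remaining cases are \<open>canon_shear_inv\<close>, \<open>canon_rotated_shear\<close> and
  \<open>canon_inv\<close>.\<close>

lemma has_nf_step:
  assumes "has_nf p" "nielsen_step p q" shows "has_nf q"
proof -
  obtain g h where c: "canon g h" and d: "conjugate_pairs (g, h) p \<or> conjugate_pairs (h, inv g) p"
    using assms by (auto simp: has_nf_def)
  have gh: "g \<in> carrier G" "h \<in> carrier G" using canon_carrier[OF c] by auto
  from d show ?thesis
  proof
    assume "conjugate_pairs (g, h) p"
    from nielsen_step_conj[OF gh this assms(2)] show ?thesis
      using has_nfI(1)[OF c] has_nfI(2)[OF c] has_nfI(1)[OF canon.left[OF c]] has_nf_conj[OF canon_shear_inv[OF c]]
      by blast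
  next
    assume d: "conjugate_pairs (h, inv g) p"
    have 1: "has_nf (inv g, inv h)" using canon_inv[OF c] has_nfI(1) by blast
    have "inv h \<otimes> inv g = inv (g \<otimes> h)" using gh by (simp add: inv_mult_group)
    then have 2: "has_nf (h, inv h \<otimes> inv g)"
      using has_nfI(2)[OF canon.right[OF c]] conjugate_pairs_refl[of h "inv (g \<otimes> h)"] gh by simp
    from nielsen_step_conj[OF gh(2) _ d assms(2)] gh show ?thesis
      using has_nfI(2)[OF c] has_nf_conj[OF 1] has_nf_conj[OF 2] has_nf_conj[OF canon_rotated_shear[OF c]]
      by (metis inv_closed)
  qed
qed

lemma marked_has_nf: "marked g h \<Longrightarrow> has_nf (g, h)"
proof -
  have "has_nf p" if "nielsen (a, b) p" for p
    using that
    by (induction rule: rtranclp_induct) (use has_nfI(1)[OF base(1)] conjugate_pairs_refl has_nf_step in auto)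
  then show "marked g h \<Longrightarrow> has_nf (g, h)" by (simp add: marked_def)
qed

section \<open>Marked pairs are determined up to conjugation by homology\<close>

definition norm1 :: "int \<times> int \<Rightarrow> int" where "norm1 v = \<bar>fst v\<bar> + \<bar>snd v\<bar>"

definition same_quadrant :: "int \<times> int \<Rightarrow> int \<times> int \<Rightarrow> bool" where
  "same_quadrant v w \<longleftrightarrow> fst v * fst w \<ge> 0 \<and> snd v * snd w \<ge> 0"

lemma norm1_add: "same_quadrant v w \<Longrightarrow> norm1 (v + w) = norm1 v + norm1 w"
  by (auto simp: same_quadrant_def norm1_def zero_le_mult_iff)

lemma canon_quadrant:
  "canon g h \<Longrightarrow> same_quadrant (hvec g) (hvec h) \<and> norm1 (hvec g) \<ge> 1 \<and> norm1 (hvec h) \<ge> 1"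
proof (induction rule: canon.induct)
  case (left g h)
  then show ?case using canon_carrier[OF left(1)]
    by (auto simp: hvec_simps norm1_add) (auto simp: same_quadrant_def algebra_simps)
next
  case (right g h)
  then show ?case using canon_carrier[OF right(1)]
    by (auto simp: hvec_simps norm1_add) (auto simp: same_quadrant_def algebra_simps)
qed (auto simp: hvec_simps same_quadrant_def norm1_def)

lemma canon_cases:
  assumes "canon g h"
  obtains (axis) "(g, h) \<in> {(a, b), (b, inv a), (inv a, inv b), (inv b, a)}"
  | (left) h0 where "canon g h0" "h = g \<otimes> h0" "h0 \<in> carrier G" "hvec h = hvec g + hvec h0"
      "norm1 (hvec g) < norm1 (hvec h)"
  | (right) g0 where "canon g0 h" "g = g0 \<otimes> h" "g0 \<in> carrier G" "hvec g = hvec g0 + hvec h"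
      "norm1 (hvec h) < norm1 (hvec g)"
proof -
  have l: "h0 \<in> carrier G \<and> hvec (g \<otimes> h0) = hvec g + hvec h0 \<and> norm1 (hvec g) < norm1 (hvec (g \<otimes> h0)) \<and>
      norm1 (hvec h0) < norm1 (hvec (g \<otimes> h0))"
    if "canon g h0" for g h0
    using canon_quadrant[OF that] canon_carrier[OF that] by (simp add: hvec_simps norm1_add)
  show ?thesis using assms
  proof (cases rule: canon.cases)
    case left
    then show ?thesis using l that(2) by blast
  next
    case right
    then show ?thesis using l canon_carrier that(3) hvec_mult by blast
  qed (use that(1) in auto)
qed

lemma canon_norm1_eq_1:
  assumes "canon g h" "norm1 (hvec g) = 1" "norm1 (hvec h) = 1"
  shows "(g, h) \<in> {(a, b), (b, inv a), (inv a, inv b), (inv b, a)}"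
  using assms(1)
proof (cases rule: canon_cases)
  case (left h0)
  then show ?thesis using assms(2,3) by simp
next
  case (right g0)
  then show ?thesis using assms(2,3) by simp
qed

text \<open>Within a closed quadrant \<open>norm1\<close> is additive, so the last construction step
  can be read off from which of the two vectors is longer. The construction can thus be retraced
  from the homology vectors alone.\<close>

lemma canon_unique:
  "canon g h \<Longrightarrow> canon g' h' \<Longrightarrow> hvec g = hvec g' \<Longrightarrow> hvec h = hvec h' \<Longrightarrow> g = g' \<and> h = h'"
proof (induction arbitrary: g' h' rule: canon.induct)
  case (left g h)
  note IH = left.IH and q = canon_quadrant[OF left.hyps] and c = canon_carrier[OF left.hyps]
    and e = left.prems(2,3)
  have ge: "hvec (g \<otimes> h) = hvec g + hvec h" using c by (simp add: hvec_simps)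
  have lt: "norm1 (hvec g') < norm1 (hvec h')" "norm1 (hvec g') \<ge> 1"
    unfolding e[symmetric] ge using q by (simp_all add: norm1_add)
  show ?case using left.prems(1)
  proof (cases rule: canon_cases)
    case axis
    then show ?thesis using lt by (auto simp: hvec_simps norm1_def)
  next
    case (left h0)
    then show ?thesis using IH[of g' h0] e ge by simp
  next
    case (right g0)
    then show ?thesis using lt by simp
  qed
next
  case (right g h)
  note IH = right.IH and q = canon_quadrant[OF right.hyps] and c = canon_carrier[OF right.hyps]
    and e = right.prems(2,3)
  have ge: "hvec (g \<otimes> h) = hvec g + hvec h" using c by (simp add: hvec_simps)
  have lt: "norm1 (hvec h') < norm1 (hvec g')" "norm1 (hvec h') \<ge> 1"
    unfolding e[symmetric] ge using q by (simp_all add: norm1_add)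
  show ?case using right.prems(1)
  proof (cases rule: canon_cases)
    case axis
    then show ?thesis using lt by (auto simp: hvec_simps norm1_def)
  next
    case (left h0)
    then show ?thesis using lt by simp
  next
    case (right g0)
    then show ?thesis using IH[of g0 h'] e ge by simp
  qed
next
  case base1
  have "norm1 (hvec g') = 1" "norm1 (hvec h') = 1" using base1(2,3) by (simp_all add: hvec_ab norm1_def flip: base1(2,3))
  from canon_norm1_eq_1[OF base1(1) this] show ?case using base1 by (auto simp: hvec_simps)
next
  case base2
  have "norm1 (hvec g') = 1" "norm1 (hvec h') = 1" using base2(2,3) by (simp_all add: hvec_simps norm1_def flip: base2(2,3))
  from canon_norm1_eq_1[OF base2(1) this] show ?case using base2 by (auto simp: hvec_simps)
next
  case base3
  have "norm1 (hvec g') = 1" "norm1 (hvec h') = 1" using base3(2,3) by (simp_all add: hvec_simps norm1_def flip: base3(2,3))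
  from canon_norm1_eq_1[OF base3(1) this] show ?case using base3 by (auto simp: hvec_simps)
next
  case base4
  have "norm1 (hvec g') = 1" "norm1 (hvec h') = 1" using base4(2,3) by (simp_all add: hvec_simps norm1_def flip: base4(2,3))
  from canon_norm1_eq_1[OF base4(1) this] show ?case using base4 by (auto simp: hvec_simps)
qed

text \<open>If a basis is canonical as well as rotated canonical, then both \<open>v, w\<close> and
  \<open>- w, v\<close> lie in common closed quadrants. This makes the products of the coordinates
  vanish, so the vectors are unit vectors on the axes and only the four base pairs remain.\<close>

lemma canon_rotated_unique:
  assumes "canon g h" "canon g' h'" "hvec g = hvec h'" "hvec h = - hvec g'" "vdet (hvec g) (hvec h) = 1"
  shows "g = h' \<and> h = inv g'"
proof -
  define v w where "v = hvec g" and "w = hvec h"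
  have q: "same_quadrant v w" "same_quadrant w v" "same_quadrant (- w) v"
    using canon_quadrant[OF assms(1)] canon_quadrant[OF assms(2)] assms(3,4)
    by (auto simp: v_def w_def same_quadrant_def mult.commute)
  then have z: "fst v * fst w = 0" "snd v * snd w = 0" by (auto simp: same_quadrant_def mult.commute)
  have d: "fst v * snd w - snd v * fst w = 1" using assms(5) by (simp add: vdet_def v_def w_def)
  have n: "norm1 v = 1 \<and> norm1 w = 1"
  proof (cases "fst v = 0")
    case True
    then have "\<bar>snd v * fst w\<bar> = 1" using d by simp
    then have "\<bar>snd v\<bar> = 1" "\<bar>fst w\<bar> = 1" by (metis abs_zmult_eq_1 mult.commute)+
    then show ?thesis using True z by (auto simp: norm1_def)
  next
    case False
    then have w: "fst w = 0" using z by simp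
    then have "\<bar>fst v * snd w\<bar> = 1" using d by simp
    then have "\<bar>fst v\<bar> = 1" "\<bar>snd w\<bar> = 1" by (metis abs_zmult_eq_1 mult.commute)+
    then show ?thesis using w z by (auto simp: norm1_def)
  qed
  have "norm1 (hvec g') = 1" "norm1 (hvec h') = 1"
    using n assms(3,4) by (auto simp: v_def w_def norm1_def)
  then have b: "(g', h') \<in> {(a, b), (b, inv a), (inv a, inv b), (inv b, a)}"
    by (rule canon_norm1_eq_1[OF assms(2)])
  have b': "(g, h) \<in> {(a, b), (b, inv a), (inv a, inv b), (inv b, a)}"
    using canon_norm1_eq_1[OF assms(1)] n by (simp add: v_def w_def)
  show ?thesis using b b' assms(3,4) by (auto simp: hvec_simps)
qed

lemma conjugate_pairs_hvec:
  "g \<in> carrier G \<Longrightarrow> h \<in> carrier G \<Longrightarrow> conjugate_pairs (g, h) (g', h') \<Longrightarrow> hvec g' = hvec g \<and> hvec h' = hvec h"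
  by (auto simp: conjugate_pairs_def hvec_conj)

text \<open>In other words, automorphisms that act trivially on the abelianization are inner: both
  pairs have canonical forms, and homology determines these.\<close>

theorem marked_unique:
  assumes m: "marked g h" "marked g' h'" and e: "hvec g = hvec g'" "hvec h = hvec h'"
  shows "conjugate_pairs (g, h) (g', h')"
proof -
  have gh: "g \<in> carrier G" "h \<in> carrier G" using marked_carrier[OF m(1)] by auto
  have common: "conjugate_pairs (g, h) (g', h')"
    if "conjugate_pairs (x, y) (g, h)" "conjugate_pairs (x, y) (g', h')" "x \<in> carrier G" "y \<in> carrier G" for x y
    using conjugate_pairs_trans[OF gh conjugate_pairs_sym[OF that(3,4,1)] that(2)] .
  obtain x y where x: "canon x y" "conjugate_pairs (x, y) (g, h) \<or> conjugate_pairs (y, inv x) (g, h)"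
    using marked_has_nf[OF m(1)] by (auto simp: has_nf_def)
  obtain x' y' where x': "canon x' y'" "conjugate_pairs (x', y') (g', h') \<or> conjugate_pairs (y', inv x') (g', h')"
    using marked_has_nf[OF m(2)] by (auto simp: has_nf_def)
  have c: "x \<in> carrier G" "y \<in> carrier G" "x' \<in> carrier G" "y' \<in> carrier G"
    using canon_carrier x(1) x'(1) by auto
  have d: "vdet (hvec g) (hvec h) = 1" by (rule marked_vdet[OF m(1)])
  from x(2) x'(2) show ?thesis
  proof (elim disjE)
    assume p: "conjugate_pairs (x, y) (g, h)" "conjugate_pairs (x', y') (g', h')"
    have "x = x' \<and> y = y'"
      using canon_unique[OF x(1) x'(1)] conjugate_pairs_hvec[OF _ _ p(1)] conjugate_pairs_hvec[OF _ _ p(2)] c e by simp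
    then show ?thesis using common[OF p(1)] p(2) c by simp
  next
    assume p: "conjugate_pairs (x, y) (g, h)" "conjugate_pairs (y', inv x') (g', h')"
    have v: "hvec x = hvec g" "hvec y = hvec h" "hvec y' = hvec g" "- hvec x' = hvec h"
      using conjugate_pairs_hvec[OF _ _ p(1)] conjugate_pairs_hvec[OF _ _ p(2)] c e by (simp_all add: hvec_inv)
    have "x = y' \<and> y = inv x'" by (rule canon_rotated_unique[OF x(1) x'(1)]) (simp_all only: v d)
    then show ?thesis using common[OF p(1)] p(2) c by simp
  next
    assume p: "conjugate_pairs (y, inv x) (g, h)" "conjugate_pairs (x', y') (g', h')"
    have v: "hvec x' = hvec g" "hvec y' = hvec h" "hvec y = hvec g" "- hvec x = hvec h"
      using conjugate_pairs_hvec[OF _ _ p(1)] conjugate_pairs_hvec[OF _ _ p(2)] c e by (simp_all add: hvec_inv)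
    have "x' = y \<and> y' = inv x" by (rule canon_rotated_unique[OF x'(1) x(1)]) (simp_all only: v d)
    then show ?thesis using common[OF p(1)] p(2) c by simp
  next
    assume p: "conjugate_pairs (y, inv x) (g, h)" "conjugate_pairs (y', inv x') (g', h')"
    have "x = x' \<and> y = y'"
      using canon_unique[OF x(1) x'(1)] conjugate_pairs_hvec[OF _ _ p(1)] conjugate_pairs_hvec[OF _ _ p(2)] c e
      by (simp add: hvec_inv)
    then show ?thesis using common[OF p(1)] p(2) c by simp
  qed
qed

lemma marked_shear_power:
  assumes "marked g h"
  shows "\<exists>h'. marked g h' \<and> hvec h' = hvec h + (n * fst (hvec g), n * snd (hvec g))"
proof (induction n rule: int_induct[of _ 0])
  case base
  then show ?case using assms by (intro exI[of _ h]) (simp add: zero_prod_def[symmetric])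
next
  case (step1 i)
  then obtain h' where h': "marked g h'" "hvec h' = hvec h + (i * fst (hvec g), i * snd (hvec g))" by blast
  show ?case using marked_moves(3)[OF h'(1)] marked_carrier[OF h'(1)] h'(2)
    by (intro exI[of _ "g \<otimes> h'"]) (simp add: hvec_simps prod_eq_iff algebra_simps)
next
  case (step2 i)
  then obtain h' where h': "marked g h'" "hvec h' = hvec h + (i * fst (hvec g), i * snd (hvec g))" by blast
  show ?case using marked_moves(4)[OF h'(1)] marked_carrier[OF h'(1)] h'(2)
    by (intro exI[of _ "inv g \<otimes> h'"]) (simp add: hvec_simps prod_eq_iff algebra_simps)
qed

text \<open>Two completions of the same vector to a basis differ by a multiple of that vector.
  Shearing \<open>h\<close> accordingly leaves \<open>g\<close> unchanged and reduces the claim to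
  \<open>marked_unique\<close>.\<close>

theorem marked_conjugate:
  assumes m: "marked g h" "marked g' h'" and e: "hvec g = hvec g'"
  shows "\<exists>k\<in>carrier G. g' = k \<otimes> g \<otimes> inv k"
proof -
  define n where "n = vdet (hvec h') (hvec h)"
  have d: "vdet (hvec g) (hvec h) = 1" "vdet (hvec g) (hvec h') = 1"
    using marked_vdet[OF m(1)] marked_vdet[OF m(2)] e by auto
  have "hvec h' = hvec h + (n * fst (hvec g), n * snd (hvec g))"
    using vdet_cramer[OF d(1), of "hvec h'"] d(2) unfolding n_def[symmetric] by (simp add: prod_eq_iff)
  moreover obtain h1 where "marked g h1" "hvec h1 = hvec h + (n * fst (hvec g), n * snd (hvec g))"
    using marked_shear_power[OF m(1)] by blast
  ultimately have "conjugate_pairs (g, h1) (g', h')" using m(2) e by (intro marked_unique) auto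
  then show ?thesis by (auto simp: conjugate_pairs_def)
qed

text \<open>Every element of a free basis belongs to a marked pair: such a basis has two elements,
  whose images form a basis of \<open>\<int>\<^sup>2\<close>, and Nielsen reduction brings it to \<open>a\<close>, \<open>b\<close>.\<close>

lemma marked_if_generating:
  assumes gh: "g \<in> carrier G" "h \<in> carrier G" "generate G {g, h} = carrier G"
    and d: "vdet (hvec g) (hvec h) = 1"
  shows "marked g h"
proof -
  have nt: "x \<noteq> \<one> \<and> y \<noteq> \<one>" if "nielsen (g, h) (x, y)" for x y
    using nielsen_vdet[OF that] gh d by (auto simp: hvec_one vdet_def)
  obtain x y where xy: "nielsen (g, h) (x, y)" "{a, b} \<subseteq> {x, y, inv x, inv y}"
    using nielsen_reduction[OF gh nt] by blast
  have c: "x \<in> carrier G" "y \<in> carrier G" using nielsen_carrier[OF xy(1)] gh by auto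
  have dx: "vdet (hvec x) (hvec y) = 1" using nielsen_vdet[OF xy(1)] gh d by simp
  have "a = x \<or> a = y \<or> a = inv x \<or> a = inv y" "b = x \<or> b = y \<or> b = inv x \<or> b = inv y"
    using xy(2) by auto
  then have "x \<in> {a, inv a} \<or> y \<in> {a, inv a}" "x \<in> {b, inv b} \<or> y \<in> {b, inv b}"
    using c by auto
  moreover have "hvec z \<in> {(1, 0), (-1, 0)}" if "z \<in> {a, inv a}" for z using that by (auto simp: hvec_simps)
  moreover have "hvec z \<in> {(0, 1), (0, -1)}" if "z \<in> {b, inv b}" for z using that by (auto simp: hvec_simps)
  ultimately have "x \<in> {a, inv a} \<and> y \<in> {b, inv b} \<or> x \<in> {b, inv b} \<and> y \<in> {a, inv a}" by fastforce
  then have "x = a \<and> y = b \<or> x = b \<and> y = inv a \<or> x = inv a \<and> y = inv b \<or> x = inv b \<and> y = a"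
    using dx by (auto simp: hvec_simps vdet_def)
  then have "marked x y"
    using marked_moves(1,2)[of a b] marked_moves(1)[of "inv a" "inv b"] by (auto simp: marked_def)
  then show ?thesis using nielsen_sym[OF xy(1)] unfolding marked_def by simp
qed

theorem ex_marked_if_free_basis:
  assumes X: "free_basis G X" "g \<in> X"
  shows "\<exists>h. marked g h"
proof -
  interpret X: free_group G X using X(1) by unfold_locales
  have gc: "g \<in> carrier G" using X X.X_sub by auto
  define u where "u = hvec g"
  have "\<exists>h\<in>X. h \<noteq> g"
  proof (rule ccontr)
    assume "\<not> ?thesis"
    then have X1: "X = {g}" using X(2) by blast
    define L where "L v \<longleftrightarrow> (\<exists>n. v = (n * fst u, n * snd u))" for v
    have L: "L (hvec x)" if "x \<in> carrier G" for x
    proof (rule hvec_span[OF X.X_sub])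
      show "x \<in> generate G X" using that X.gen_X by simp
      show "\<And>y. y \<in> X \<Longrightarrow> L (hvec y)" unfolding L_def X1 u_def by (intro exI[of _ 1]) simp
      show "L 0" unfolding L_def by (intro exI[of _ 0]) (simp add: zero_prod_def)
      show "L (- v)" if l: "L v" for v
      proof -
        obtain n where "v = (n * fst u, n * snd u)" using l by (auto simp: L_def)
        then show ?thesis unfolding L_def by (intro exI[of _ "- n"]) simp
      qed
      show "L (v + w)" if l: "L v" "L w" for v w
      proof -
        obtain n m where "v = (n * fst u, n * snd u)" "w = (m * fst u, m * snd u)" using l by (auto simp: L_def)
        then show ?thesis unfolding L_def by (intro exI[of _ "n + m"]) (simp add: distrib_right)
      qed
    qed
    from L[of a] L[of b] obtain n m where "(1, 0) = (n * fst u, n * snd u)" "(0, 1) = (m * fst u, m * snd u)"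
      by (auto simp: L_def hvec_ab)
    then have "n \<noteq> 0" "n * snd u = 0" "m * snd u = 1" unfolding prod.inject by auto
    then show False by simp
  qed
  then obtain h where h: "h \<in> X" "h \<noteq> g" by blast
  have X2: "X = {g, h}"
    using X.basis_card_le_2[OF ab_carrier gen_X X(2) h(1)] h X(2) by blast
  have hc: "h \<in> carrier G" using h(1) X.X_sub by auto
  have gen: "generate G {g, h} = carrier G" using X.gen_X X2 by simp
  define w where "w = hvec h"
  define L where "L v \<longleftrightarrow> (\<exists>m n. v = (m * fst u + n * fst w, m * snd u + n * snd w))" for v
  have L: "L (hvec x)" if "x \<in> carrier G" for x
  proof (rule hvec_span[of "{g, h}"])
    show "x \<in> generate G {g, h}" using that gen by simp
    show "L (hvec y)" if "y \<in> {g, h}" for y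
    proof (cases "y = g")
      case True
      show ?thesis unfolding L_def by (rule exI[of _ 1], rule exI[of _ 0]) (simp add: True u_def)
    next
      case False
      then have "y = h" using that by simp
      show ?thesis unfolding L_def by (rule exI[of _ 0], rule exI[of _ 1]) (simp add: \<open>y = h\<close> w_def)
    qed
    show "L 0" unfolding L_def by (rule exI[of _ 0], rule exI[of _ 0]) (simp add: zero_prod_def)
    show "L (- v)" if l: "L v" for v
    proof -
      obtain m n where "v = (m * fst u + n * fst w, m * snd u + n * snd w)" using l by (auto simp: L_def)
      then show ?thesis unfolding L_def by (intro exI[of _ "- m"] exI[of _ "- n"]) simp
    qed
    show "L (v + v')" if "L v" "L v'" for v v'
    proof -
      obtain m n m' n' where "v = (m * fst u + n * fst w, m * snd u + n * snd w)"
        "v' = (m' * fst u + n' * fst w, m' * snd u + n' * snd w)" using \<open>L v\<close> \<open>L v'\<close> by (auto simp: L_def)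
      then show ?thesis unfolding L_def by (intro exI[of _ "m + m'"] exI[of _ "n + n'"]) (simp add: algebra_simps)
    qed
  qed (use gc hc in auto)
  from L[of a] L[of b] obtain m n m' n' where e: "(1, 0) = (m * fst u + n * fst w, m * snd u + n * snd w)"
    "(0, 1) = (m' * fst u + n' * fst w, m' * snd u + n' * snd w)"
    by (auto simp: L_def hvec_ab)
  \<comment> \<open>The unit vectors are integral combinations of \<open>u\<close> and
    \<open>w\<close>, so the determinant of \<open>u\<close> and \<open>w\<close> divides 1.\<close>
  have "vdet (1, 0) (0, 1) = (m * n' - n * m') * vdet u w"
    unfolding e by (simp add: vdet_def algebra_simps)
  then have "vdet u w dvd 1" by (metis dvd_triv_right fst_conv snd_conv vdet_def diff_zero mult_1 mult_zero_left)
  then have "\<bar>vdet u w\<bar> = 1" by simp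
  then consider "vdet u w = 1" | "vdet u w = -1" by linarith
  then show ?thesis
  proof cases
    case 1
    then show ?thesis using marked_if_generating[OF gc hc gen] by (auto simp: u_def w_def)
  next
    case 2
    have "inv (inv h) \<in> generate G {g, inv h}" by (rule generate.inv) simp
    then have "generate G {g, inv h} = carrier G"
      using gc hc by (intro generate_pair_mono[OF _ _ _ gen]) (auto intro: generate.incl)
    then have "marked g (inv h)"
      using 2 gc hc by (intro marked_if_generating) (auto simp: hvec_inv u_def w_def)
    then show ?thesis by blast
  qed
qed

end

section \<open>Induced automorphisms and trace identities\<close>

context group begin

lemma hom_word_val:
  assumes "\<theta> \<in> hom G G" "fst ` set w \<subseteq> carrier G"
  shows "word_val G (map (\<lambda>l. (\<theta> (fst l), snd l)) w) = \<theta> (word_val G w)"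
proof -
  interpret t: group_hom G G \<theta> using assms group_axioms by (simp add: group_hom_def group_hom_axioms_def)
  show ?thesis using assms(2) by (induction w) (auto simp: letter_val_def)
qed

lemma free_basis_image:
  assumes \<theta>: "\<theta> \<in> hom G G" "bij_betw \<theta> (carrier G) (carrier G)" and Y: "free_basis G Y"
  shows "free_basis G (\<theta> ` Y)"
proof -
  interpret t: group_hom G G \<theta> using \<theta> group_axioms by (simp add: group_hom_def group_hom_axioms_def)
  have sub: "Y \<subseteq> carrier G" "generate G Y = carrier G" using Y by (auto simp: free_basis_def)
  have "\<theta> ` carrier G = carrier G" using \<theta>(2) by (rule bij_betw_imp_surj_on)
  then have gen: "generate G (\<theta> ` Y) = carrier G" using t.generate_img[OF sub(1)] sub(2) by simp
  have inj: "inj_on \<theta> (carrier G)" using \<theta>(2) by (rule bij_betw_imp_inj_on)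
  have "word_val G w \<noteq> \<one>" if w: "fst ` set w \<subseteq> \<theta> ` Y" "reduced_word w" "w \<noteq> []" for w
  proof
    assume one: "word_val G w = \<one>"
    define i where "i = inv_into Y \<theta>"
    have i: "i y \<in> Y \<and> \<theta> (i y) = y" if "y \<in> \<theta> ` Y" for y
      unfolding i_def using that by (simp add: inv_into_into f_inv_into_f)
    define w' where "w' = map (\<lambda>l. (i (fst l), snd l)) w"
    have w': "fst ` set w' \<subseteq> Y" using w(1) i by (force simp: w'_def)
    have map_w': "map (\<lambda>l. (\<theta> (fst l), snd l)) w' = w"
      unfolding w'_def map_map by (rule map_idI) (use w(1) i in \<open>force simp: prod_eq_iff\<close>)
    have "reduced_word w'"
      unfolding reduced_word_conv w'_def successively_map
    proof (rule successively_mono[OF w(2)[unfolded reduced_word_conv]])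
      fix l m assume lm: "l \<in> set w" "m \<in> set w" "m \<noteq> letter_inv l"
      have e: "\<theta> (i (fst l)) = fst l" "\<theta> (i (fst m)) = fst m" using i w(1) lm(1,2) by blast+
      show "(i (fst m), snd m) \<noteq> letter_inv (i (fst l), snd l)"
      proof
        assume "(i (fst m), snd m) = letter_inv (i (fst l), snd l)"
        then have "i (fst m) = i (fst l)" "snd m = (\<not> snd l)" by (auto simp: letter_inv_def)
        then have "m = letter_inv l" using e by (simp add: letter_inv_def prod_eq_iff)
        then show False using lm(3) by simp
      qed
    qed
    moreover have "w' \<noteq> []" using w(3) by (simp add: w'_def)
    ultimately have "word_val G w' \<noteq> \<one>" using Y w' by (auto simp: free_basis_def)
    moreover have e: "\<theta> (word_val G w') = \<theta> \<one>"
      using hom_word_val[OF \<theta>(1) order_trans[OF w' sub(1)]] unfolding map_w' one by (metis t.hom_one)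
    have "word_val G w' = \<one>"
      using inj_onD[OF inj e word_val_closed[OF order_trans[OF w' sub(1)]]] by blast
    ultimately show False by blast
  qed
  then show ?thesis using gen sub(1) by (auto simp: free_basis_def)
qed

lemma curve_rel_image:
  assumes \<theta>: "\<theta> \<in> hom G G" "bij_betw \<theta> (carrier G) (carrier G)" and g: "g \<in> carrier G"
  shows "\<theta> ` (curve_rel G `` {g}) = curve_rel G `` {\<theta> g}"
proof -
  interpret t: group_hom G G \<theta> using \<theta> group_axioms by (simp add: group_hom_def group_hom_axioms_def)
  have inj: "inj_on \<theta> (carrier G)" and surj: "\<theta> ` carrier G = carrier G"
    using \<theta>(2) by (auto simp: bij_betw_def)
  show ?thesis
  proof (intro equalityI subsetI)
    fix y assume "y \<in> \<theta> ` (curve_rel G `` {g})"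
    then obtain x k where x: "x \<in> carrier G" "k \<in> carrier G" "y = \<theta> x"
      "g = k \<otimes> x \<otimes> inv k \<or> g = k \<otimes> inv x \<otimes> inv k" by (auto simp: curve_rel_def)
    then have "\<theta> g = \<theta> k \<otimes> \<theta> x \<otimes> inv (\<theta> k) \<or> \<theta> g = \<theta> k \<otimes> inv (\<theta> x) \<otimes> inv (\<theta> k)"
      by auto
    then show "y \<in> curve_rel G `` {\<theta> g}" using x g by (auto simp: curve_rel_def)
  next
    fix y assume "y \<in> curve_rel G `` {\<theta> g}"
    then obtain k where k: "y \<in> carrier G" "k \<in> carrier G"
      "\<theta> g = k \<otimes> y \<otimes> inv k \<or> \<theta> g = k \<otimes> inv y \<otimes> inv k" by (auto simp: curve_rel_def)
    obtain x l where x: "x \<in> carrier G" "y = \<theta> x" and l: "l \<in> carrier G" "k = \<theta> l"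
      using k surj by (metis imageE)
    have "\<theta> g = \<theta> (l \<otimes> x \<otimes> inv l) \<or> \<theta> g = \<theta> (l \<otimes> inv x \<otimes> inv l)" using k x l by simp
    then have "g = l \<otimes> x \<otimes> inv l \<or> g = l \<otimes> inv x \<otimes> inv l"
      using inj_onD[OF inj _ g] x l by auto
    then show "y \<in> \<theta> ` (curve_rel G `` {g})" using x l g by (auto simp: curve_rel_def)
  qed
qed

end

section \<open>Automorphisms realising marked pairs\<close>

context rank_two begin

definition elementary where "elementary x y = extend G (\<lambda>z. if z = a then x else y)"

lemma elementary_hom:
  assumes "x \<in> carrier G" "y \<in> carrier G"
  shows "elementary x y \<in> hom G G" "elementary x y a = x" "elementary x y b = y"
  unfolding elementary_def using assms neq extend_hom[OF group_axioms, of "\<lambda>z. if z = a then x else y"] by auto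

lemma elementary_inverse:
  assumes c: "x \<in> carrier G" "y \<in> carrier G" "x' \<in> carrier G" "y' \<in> carrier G"
    and e: "elementary x y x' = a" "elementary x y y' = b" and g: "g \<in> carrier G"
  shows "elementary x y (elementary x' y' g) = g"
proof -
  have "(elementary x y \<circ> elementary x' y') g = id g"
  proof (rule hom_eq_on_generate[OF group_axioms, of "elementary x y \<circ> elementary x' y'" id "{a, b}" g])
    show "elementary x y \<circ> elementary x' y' \<in> hom G G"
      using Group.hom_compose elementary_hom(1) c by blast
    show "id \<in> hom G G" by (simp add: hom_def)
    show "g \<in> generate G {a, b}" using g gen_X by simp
    show "(elementary x y \<circ> elementary x' y') z = id z" if "z \<in> {a, b}" for z
      using that e elementary_hom[OF c(3,4)] by auto
  qed simp
  then show ?thesis by simp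
qed

lemma elementary_bij:
  assumes c: "x \<in> carrier G" "y \<in> carrier G" "x' \<in> carrier G" "y' \<in> carrier G"
    and e: "elementary x y x' = a" "elementary x y y' = b" "elementary x' y' x = a" "elementary x' y' y = b"
  shows "bij_betw (elementary x y) (carrier G) (carrier G)"
proof (rule bij_betwI[where g = "elementary x' y'"])
  show "elementary x y \<in> carrier G \<rightarrow> carrier G" "elementary x' y' \<in> carrier G \<rightarrow> carrier G"
    using elementary_hom(1) c by (auto simp: hom_def)
  show "\<And>g. g \<in> carrier G \<Longrightarrow> elementary x' y' (elementary x y g) = g"
    by (rule elementary_inverse) (use c e in auto)
  show "\<And>g. g \<in> carrier G \<Longrightarrow> elementary x y (elementary x' y' g) = g"
    by (rule elementary_inverse) (use c e in auto)
qed

lemma elementary_simps: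
  assumes "x \<in> carrier G" "y \<in> carrier G" "g \<in> carrier G"
  shows "h \<in> carrier G \<Longrightarrow> elementary x y (g \<otimes> h) = elementary x y g \<otimes> elementary x y h"
    "elementary x y (inv g) = inv (elementary x y g)"
proof -
  interpret t: group_hom G G "elementary x y"
    using elementary_hom(1)[OF assms(1,2)] group_axioms by (simp add: group_hom_def group_hom_axioms_def)
  show "h \<in> carrier G \<Longrightarrow> elementary x y (g \<otimes> h) = elementary x y g \<otimes> elementary x y h"
    "elementary x y (inv g) = inv (elementary x y g)" using assms by auto
qed

text \<open>A rotation or shear of the images of \<open>a\<close> and \<open>b\<close> is
  precomposition with the corresponding elementary automorphism; a conjugation is applied after the
  automorphism instead.\<close>

lemma marked_automorphism:
  assumes "marked g h"
  shows "\<exists>\<theta>. \<theta> \<in> hom G G \<and> bij_betw \<theta> (carrier G) (carrier G) \<and> \<theta> a = g \<and> \<theta> b = h"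
proof -
  have "\<exists>\<theta>. \<theta> \<in> hom G G \<and> bij_betw \<theta> (carrier G) (carrier G) \<and> \<theta> a = fst p \<and> \<theta> b = snd p"
    if "nielsen (a, b) p" for p
    using that
  proof (induction rule: rtranclp_induct)
    case base
    show ?case by (intro exI[of _ id] conjI bij_betw_id) (auto simp: hom_def)
  next
    case (step p q)
    then obtain \<theta> where \<theta>: "\<theta> \<in> hom G G" "bij_betw \<theta> (carrier G) (carrier G)" "\<theta> a = fst p" "\<theta> b = snd p" by blast
    interpret t: group_hom G G \<theta> using \<theta>(1) group_axioms by (simp add: group_hom_def group_hom_axioms_def)
    have comp: ?case if e: "e \<in> hom G G" "bij_betw e (carrier G) (carrier G)" "\<theta> (e a) = fst q" "\<theta> (e b) = snd q" for e
    proof (intro exI[of _ "\<theta> \<circ> e"] conjI)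
      show "\<theta> \<circ> e \<in> hom G G" by (rule Group.hom_compose[OF e(1) \<theta>(1)])
      show "bij_betw (\<theta> \<circ> e) (carrier G) (carrier G)" by (rule bij_betw_trans[OF e(2) \<theta>(2)])
    qed (use e in auto)
    have eh: "elementary x y \<in> hom G G" "elementary x y a = x" "elementary x y b = y"
      if "x \<in> carrier G" "y \<in> carrier G" for x y using elementary_hom that by auto
    from step(2) show ?case
    proof (cases rule: nielsen_step.cases)
      case (rotate g h)
      have "bij_betw (elementary b (inv a)) (carrier G) (carrier G)"
        by (rule elementary_bij[of _ _ "inv b" a]) (simp_all add: eh elementary_simps)
      then show ?thesis by (rule comp[rotated]) (use rotate \<theta> in \<open>auto simp: eh\<close>)
    next
      case (shear g h)
      have "bij_betw (elementary a (a \<otimes> b)) (carrier G) (carrier G)"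
        by (rule elementary_bij[of _ _ a "inv a \<otimes> b"]) (simp_all add: eh elementary_simps)
      then show ?thesis by (rule comp[rotated]) (use shear \<theta> in \<open>auto simp: eh\<close>)
    next
      case (shear_inv g h)
      have "bij_betw (elementary a (inv a \<otimes> b)) (carrier G) (carrier G)"
        by (rule elementary_bij[of _ _ a "a \<otimes> b"]) (simp_all add: eh elementary_simps)
      then show ?thesis by (rule comp[rotated]) (use shear_inv \<theta> in \<open>auto simp: eh\<close>)
    next
      case (conj g h k)
      have "bij_betw (\<lambda>g. k \<otimes> g \<otimes> inv k) (carrier G) (carrier G)"
        using conj by (intro bij_betwI[where g = "\<lambda>g. inv k \<otimes> g \<otimes> k"]) (auto simp: m_assoc)
      then have "bij_betw ((\<lambda>g. k \<otimes> g \<otimes> inv k) \<circ> \<theta>) (carrier G) (carrier G)" by (rule bij_betw_trans[OF \<theta>(2)])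
      moreover have "(\<lambda>g. k \<otimes> g \<otimes> inv k) \<circ> \<theta> \<in> hom G G"
        by (rule Group.hom_compose[OF \<theta>(1) conj_hom[OF conj(5)]])
      ultimately show ?thesis using conj \<theta> 
        by (intro exI[of _ "(\<lambda>g. k \<otimes> g \<otimes> inv k) \<circ> \<theta>"] conjI) (assumption | simp)+
    qed
  qed
  from this[of "(g, h)"] assms show ?thesis by (simp add: marked_def)
qed

lemma marked_free_basis: "marked g h \<Longrightarrow> free_basis G {g, h}"
  using marked_automorphism[of g h] free_basis_image[OF _ _ free] by auto

lemma hvec_automorphism:
  assumes f: "f \<in> hom G G" and e: "hvec (f a) = mact H (1, 0)" "hvec (f b) = mact H (0, 1)" and g: "g \<in> carrier G"
  shows "hvec (f g) = mact H (hvec g)"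
proof -
  interpret t: group_hom G G f using f group_axioms by (simp add: group_hom_def group_hom_axioms_def)
  have "g \<in> generate G {a, b}" using g gen_X by simp
  then show ?thesis
  proof (induction rule: generate.induct)
    case one then show ?case by (simp add: hvec_one mact_def zero_prod_def)
  next
    case (incl h) then show ?case using e by (auto simp: hvec_ab)
  next
    case (inv h) then show ?case using e by (auto simp: hvec_ab hvec_inv mact_def)
  next
    case (eng g h)
    then have "g \<in> carrier G" "h \<in> carrier G" using gen_X by auto
    then show ?case using eng by (simp add: hvec_mult)
  qed
qed

lemma hvec_int_pow: "g \<in> carrier G \<Longrightarrow> hvec (g [^] (n :: int)) = (n * fst (hvec g), n * snd (hvec g))"
proof (induction n rule: int_induct[of _ 0])
  case base
  then show ?case by (simp add: hvec_one zero_prod_def)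
next
  case (step1 i)
  then show ?case by (simp add: int_pow_mult hvec_mult prod_eq_iff algebra_simps)
next
  case (step2 i)
  then show ?case using int_pow_mult[of g i "-1"]
    by (simp add: hvec_mult hvec_inv int_pow_neg prod_eq_iff algebra_simps)
qed

lemma hvec_derived: "d \<in> derived G (carrier G) \<Longrightarrow> d \<in> carrier G \<and> hvec d = 0"
proof -
  assume d: "d \<in> derived G (carrier G)"
  have sub: "derived_set G (carrier G) \<subseteq> carrier G" by auto
  have "hvec d = 0"
    by (rule hvec_span[OF sub, of d "\<lambda>v. v = 0"]) (use d in \<open>auto simp: derived_def hvec_mult hvec_inv\<close>)
  then show ?thesis using d generate_in_carrier[OF sub] by (auto simp: derived_def)
qed

lemma hvec_induced:
  assumes "induced_by G a b H f" "g \<in> carrier G"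
  shows "hvec (f g) = mact H (hvec g)"
proof (rule hvec_automorphism[OF _ _ _ assms(2)])
  have *: "hvec x = (n, m)" if x: "x \<in> derived G (carrier G) #> (a [^] n \<otimes> b [^] m)" for x and n m :: int
  proof -
    obtain d where "d \<in> derived G (carrier G)" "x = d \<otimes> (a [^] n \<otimes> b [^] m)" using x by (auto simp: r_coset_def)
    then show ?thesis using hvec_derived[of d] by (simp add: hvec_mult hvec_int_pow hvec_ab)
  qed
  show "f \<in> hom G G" using assms(1) by (auto simp: induced_by_def auto_def)
  show "hvec (f a) = mact H (1, 0)" "hvec (f b) = mact H (0, 1)"
    using * assms(1) by (auto simp: induced_by_def mact_def)
qed

end

section \<open>Trace identities in \<open>SL2C\<close>\<close>

lemma SL2C_inverse:
  assumes A: "A \<in> carrier SL2C"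
  shows "inv\<^bsub>SL2C\<^esub> A = vector [vector [A $ 2 $ 2, - (A $ 1 $ 2)], vector [- (A $ 2 $ 1), A $ 1 $ 1]]" (is "_ = ?B")
proof -
  interpret S: group SL2C by (rule group_SL2C)
  have dA: "A $ 1 $ 1 * A $ 2 $ 2 - A $ 1 $ 2 * A $ 2 $ 1 = 1"
    using A by (simp add: SL2C_def det_2)
  have "det ?B = 1"
    unfolding det_2 vector_2 using dA by (metis (no_types) minus_mult_minus mult.commute)
  moreover have "?B ** A = mat 1"
    unfolding matrix_matrix_mult_def mat_def vec_eq_iff forall_2 sum_2 vector_2 vec_lambda_beta
    using dA by (simp add: mult.commute)
  ultimately have "?B \<in> carrier SL2C" "?B \<otimes>\<^bsub>SL2C\<^esub> A = \<one>\<^bsub>SL2C\<^esub>" by (auto simp: SL2C_def)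
  then show ?thesis using A by (metis S.inv_equality)
qed

lemma trace_mult_entries:
  "trace (A \<otimes>\<^bsub>SL2C\<^esub> B) = A $ 1 $ 1 * B $ 1 $ 1 + A $ 1 $ 2 * B $ 2 $ 1 + (A $ 2 $ 1 * B $ 1 $ 2 + A $ 2 $ 2 * B $ 2 $ 2)"
  by (simp add: SL2C_def trace_def sum_2 matrix_matrix_mult_def)

lemma trace_commute: "trace (A \<otimes>\<^bsub>SL2C\<^esub> B) = trace (B \<otimes>\<^bsub>SL2C\<^esub> A)"
  unfolding SL2C_def monoid.simps by (rule trace_mul_sym)

text \<open>By Cayley-Hamilton, \<open>A\<close> plus its inverse is the scalar matrix with entry
  \<open>trace A\<close>; this is the source of the edge relation.\<close>

lemma trace_mult_add_trace_inv_mult: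
  assumes "A \<in> carrier SL2C"
  shows "trace (A \<otimes>\<^bsub>SL2C\<^esub> B) + trace (inv\<^bsub>SL2C\<^esub> A \<otimes>\<^bsub>SL2C\<^esub> B) = trace A * trace B"
  unfolding trace_mult_entries SL2C_inverse[OF assms] vector_2
  by (simp add: trace_def sum_2 algebra_simps)

text \<open>Fricke's identity. Three applications of the product formula for traces reduce the
  commutator to the traces of \<open>A\<close>, \<open>B\<close> and their product.\<close>

lemma trace_commutator:
  assumes A: "A \<in> carrier SL2C" and B: "B \<in> carrier SL2C"
  shows "trace (A \<otimes>\<^bsub>SL2C\<^esub> B \<otimes>\<^bsub>SL2C\<^esub> inv\<^bsub>SL2C\<^esub> A \<otimes>\<^bsub>SL2C\<^esub> inv\<^bsub>SL2C\<^esub> B)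
    = (trace A)\<^sup>2 + (trace B)\<^sup>2 + (trace (A \<otimes>\<^bsub>SL2C\<^esub> B))\<^sup>2 - trace A * trace B * trace (A \<otimes>\<^bsub>SL2C\<^esub> B) - 2"
proof -
  interpret S: group SL2C by (rule group_SL2C)
  define t where "t = trace (A \<otimes>\<^bsub>SL2C\<^esub> B)"
  define C where "C = B \<otimes>\<^bsub>SL2C\<^esub> inv\<^bsub>SL2C\<^esub> A \<otimes>\<^bsub>SL2C\<^esub> inv\<^bsub>SL2C\<^esub> B"
  have "C \<in> carrier SL2C" using A B by (simp add: C_def)
  have "trace (A \<otimes>\<^bsub>SL2C\<^esub> C) + trace (inv\<^bsub>SL2C\<^esub> A \<otimes>\<^bsub>SL2C\<^esub> C) = trace A * trace C"
    by (rule trace_mult_add_trace_inv_mult[OF A])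
  moreover have "trace C = trace A"
    unfolding C_def using A B by (simp add: trace_conj_SL2C trace_inv_SL2C)
  moreover have "trace (inv\<^bsub>SL2C\<^esub> A \<otimes>\<^bsub>SL2C\<^esub> C) = trace (inv\<^bsub>SL2C\<^esub> A \<otimes>\<^bsub>SL2C\<^esub> B) * t - (trace B)\<^sup>2 + 2"
  proof -
    define D where "D = inv\<^bsub>SL2C\<^esub> A \<otimes>\<^bsub>SL2C\<^esub> B"
    have D: "D \<in> carrier SL2C" using A B by (simp add: D_def)
    have p1: "trace (D \<otimes>\<^bsub>SL2C\<^esub> (inv\<^bsub>SL2C\<^esub> A \<otimes>\<^bsub>SL2C\<^esub> inv\<^bsub>SL2C\<^esub> B))
      + trace (inv\<^bsub>SL2C\<^esub> D \<otimes>\<^bsub>SL2C\<^esub> (inv\<^bsub>SL2C\<^esub> A \<otimes>\<^bsub>SL2C\<^esub> inv\<^bsub>SL2C\<^esub> B))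
      = trace D * trace (inv\<^bsub>SL2C\<^esub> A \<otimes>\<^bsub>SL2C\<^esub> inv\<^bsub>SL2C\<^esub> B)" by (rule trace_mult_add_trace_inv_mult[OF D])
    have p2: "trace (inv\<^bsub>SL2C\<^esub> A \<otimes>\<^bsub>SL2C\<^esub> inv\<^bsub>SL2C\<^esub> B) = t"
      using trace_inv_SL2C[of "B \<otimes>\<^bsub>SL2C\<^esub> A"] A B trace_commute[of A B] by (simp add: S.inv_mult_group t_def)
    have p3: "inv\<^bsub>SL2C\<^esub> D \<otimes>\<^bsub>SL2C\<^esub> (inv\<^bsub>SL2C\<^esub> A \<otimes>\<^bsub>SL2C\<^esub> inv\<^bsub>SL2C\<^esub> B) = inv\<^bsub>SL2C\<^esub> B \<otimes>\<^bsub>SL2C\<^esub> inv\<^bsub>SL2C\<^esub> B"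
      using A B by (simp add: D_def S.inv_mult_group S.m_assoc)
    have p4: "trace (inv\<^bsub>SL2C\<^esub> B \<otimes>\<^bsub>SL2C\<^esub> inv\<^bsub>SL2C\<^esub> B) = (trace B)\<^sup>2 - 2"
    proof -
      have "trace (B \<otimes>\<^bsub>SL2C\<^esub> inv\<^bsub>SL2C\<^esub> B) + trace (inv\<^bsub>SL2C\<^esub> B \<otimes>\<^bsub>SL2C\<^esub> inv\<^bsub>SL2C\<^esub> B) = trace B * trace (inv\<^bsub>SL2C\<^esub> B)"
        by (rule trace_mult_add_trace_inv_mult[OF B])
      moreover have "trace (B \<otimes>\<^bsub>SL2C\<^esub> inv\<^bsub>SL2C\<^esub> B) = 2"
        using B by (simp add: S.r_inv) (simp add: SL2C_def trace_I)
      ultimately show ?thesis using B by (simp add: trace_inv_SL2C power2_eq_square algebra_simps)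
    qed
    have p5: "inv\<^bsub>SL2C\<^esub> A \<otimes>\<^bsub>SL2C\<^esub> C = D \<otimes>\<^bsub>SL2C\<^esub> (inv\<^bsub>SL2C\<^esub> A \<otimes>\<^bsub>SL2C\<^esub> inv\<^bsub>SL2C\<^esub> B)"
      using A B by (simp add: C_def D_def S.m_assoc)
    show ?thesis using p1 unfolding p2 p3 p4 p5 D_def[symmetric] by algebra
  qed
  moreover have "trace (inv\<^bsub>SL2C\<^esub> A \<otimes>\<^bsub>SL2C\<^esub> B) = trace A * trace B - t"
    using trace_mult_add_trace_inv_mult[OF A, of B] by (simp add: t_def algebra_simps)
  moreover have "A \<otimes>\<^bsub>SL2C\<^esub> B \<otimes>\<^bsub>SL2C\<^esub> inv\<^bsub>SL2C\<^esub> A \<otimes>\<^bsub>SL2C\<^esub> inv\<^bsub>SL2C\<^esub> B = A \<otimes>\<^bsub>SL2C\<^esub> C"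
    using A B by (simp add: C_def S.m_assoc)
  ultimately show ?thesis unfolding t_def[symmetric]
    by (simp add: power2_eq_square algebra_simps)
qed

section \<open>Curve classes and the sum\<close>

locale stabilized_rep = rank_two G a b for G (structure) and a b +
  fixes \<rho> :: "'a \<Rightarrow> complex ^ 2 ^ 2" and \<tau> :: complex and H :: "int ^ 2 ^ 2" and f :: "'a \<Rightarrow> 'a"
  assumes \<tau>_neq_2: "\<tau> \<noteq> 2" and rep: "tau_rep G a b \<tau> \<rho>"
    and det_H: "det H = 1" and hyp: "hyperbolic H" and ind: "induced_by G a b H f"
    and stab: "stabilized_by G \<rho> f" and BQ: "BQ_conditions G f \<rho>"
begin

lemma \<rho>_hom: "\<rho> \<in> hom G SL2C"
  using rep by (simp add: tau_rep_def)

lemma \<rho>_closed: "g \<in> carrier G \<Longrightarrow> \<rho> g \<in> carrier SL2C"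
  using \<rho>_hom by (auto simp: hom_def)

lemma \<rho>_mult: "g \<in> carrier G \<Longrightarrow> h \<in> carrier G \<Longrightarrow> \<rho> (g \<otimes> h) = \<rho> g \<otimes>\<^bsub>SL2C\<^esub> \<rho> h"
  using \<rho>_hom by (auto simp: hom_def)

lemma \<rho>_inv: "g \<in> carrier G \<Longrightarrow> \<rho> (inv g) = inv\<^bsub>SL2C\<^esub> (\<rho> g)"
proof -
  interpret r: group_hom G SL2C \<rho>
    using \<rho>_hom group_axioms group_SL2C by (simp add: group_hom_def group_hom_axioms_def)
  show "g \<in> carrier G \<Longrightarrow> \<rho> (inv g) = inv\<^bsub>SL2C\<^esub> (\<rho> g)" by simp
qed

section \<open>The Markoff map of a representation\<close>

definition tr :: "'a \<Rightarrow> complex" where "tr g = trace (\<rho> g)"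

lemma tr_inv: "g \<in> carrier G \<Longrightarrow> tr (inv g) = tr g"
  by (simp add: tr_def \<rho>_inv trace_inv_SL2C \<rho>_closed)

lemma tr_conj: "g \<in> carrier G \<Longrightarrow> k \<in> carrier G \<Longrightarrow> tr (k \<otimes> g \<otimes> inv k) = tr g"
  by (simp add: tr_def \<rho>_mult \<rho>_inv trace_conj_SL2C \<rho>_closed)

lemma tr_commute: "g \<in> carrier G \<Longrightarrow> h \<in> carrier G \<Longrightarrow> tr (g \<otimes> h) = tr (h \<otimes> g)"
  by (simp add: tr_def \<rho>_mult) (rule trace_commute)

lemma tr_mult: "g \<in> carrier G \<Longrightarrow> h \<in> carrier G \<Longrightarrow> tr (g \<otimes> h) + tr (inv g \<otimes> h) = tr g * tr h"
  using trace_mult_add_trace_inv_mult[OF \<rho>_closed] by (simp add: tr_def \<rho>_mult \<rho>_inv)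

text \<open>By \<open>trace_commutator\<close> this is the trace of the commutator plus 2. Its
  invariance under Nielsen moves turns the single condition on \<open>a\<close> and \<open>b\<close>
  into the vertex relation at every basis.\<close>

definition fricke :: "'a \<times> 'a \<Rightarrow> complex" where
  "fricke p = (tr (fst p))\<^sup>2 + (tr (snd p))\<^sup>2 + (tr (fst p \<otimes> snd p))\<^sup>2 - tr (fst p) * tr (snd p) * tr (fst p \<otimes> snd p)"

lemma fricke_step:
  assumes "nielsen_step p q" shows "fricke q = fricke p"
  using assms
proof (cases rule: nielsen_step.cases)
  case (rotate g h)
  have "tr (h \<otimes> inv g) = tr (inv g \<otimes> h)" using rotate by (intro tr_commute) auto
  then have t: "tr (h \<otimes> inv g) = tr g * tr h - tr (g \<otimes> h)"
    using tr_mult[of g h] rotate by (simp add: algebra_simps)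
  show ?thesis unfolding rotate(1,2) fricke_def fst_conv snd_conv t tr_inv[OF rotate(3)]
    by (simp add: power2_eq_square algebra_simps)
next
  case (shear g h)
  have t: "tr (g \<otimes> (g \<otimes> h)) = tr g * tr (g \<otimes> h) - tr h"
    using tr_mult[of g "g \<otimes> h"] shear by (simp add: algebra_simps)
  show ?thesis unfolding shear(1,2) fricke_def fst_conv snd_conv t by (simp add: power2_eq_square algebra_simps)
next
  case (shear_inv g h)
  have t: "tr (inv g \<otimes> h) = tr g * tr h - tr (g \<otimes> h)"
    using tr_mult[of g h] shear_inv by (simp add: algebra_simps)
  have c: "g \<otimes> (inv g \<otimes> h) = h" using shear_inv by (simp flip: m_assoc)
  show ?thesis unfolding shear_inv(1,2) fricke_def fst_conv snd_conv c t by (simp add: power2_eq_square algebra_simps)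
next
  case (conj g h k)
  have "(k \<otimes> g \<otimes> inv k) \<otimes> (k \<otimes> h \<otimes> inv k) = k \<otimes> (g \<otimes> h) \<otimes> inv k" using conj by (simp add: m_assoc)
  then show ?thesis using conj by (simp add: fricke_def tr_conj)
qed

lemma fricke_marked: "marked g h \<Longrightarrow> fricke (g, h) = \<tau> + 2"
proof -
  have ab: "fricke (a, b) = \<tau> + 2"
  proof -
    have "\<rho> (a \<otimes> b \<otimes> inv a \<otimes> inv b) = \<rho> a \<otimes>\<^bsub>SL2C\<^esub> \<rho> b \<otimes>\<^bsub>SL2C\<^esub> inv\<^bsub>SL2C\<^esub> (\<rho> a) \<otimes>\<^bsub>SL2C\<^esub> inv\<^bsub>SL2C\<^esub> (\<rho> b)"
      by (simp add: \<rho>_mult \<rho>_inv)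
    then have "fricke (a, b) - 2 = \<tau>"
      using rep trace_commutator[OF \<rho>_closed \<rho>_closed, of a b] by (simp add: tau_rep_def fricke_def tr_def \<rho>_mult)
    then show ?thesis by (simp add: algebra_simps)
  qed
  have "fricke p = \<tau> + 2" if "nielsen (a, b) p" for p
    using that by (induction rule: rtranclp_induct) (auto simp: ab fricke_step)
  then show "marked g h \<Longrightarrow> fricke (g, h) = \<tau> + 2" by (simp add: marked_def)
qed

text \<open>By \<open>marked_conjugate\<close> the choice is immaterial up to conjugation, so
  \<open>\<phi>\<close> and \<open>cls\<close> below depend only on the vector
  (\<open>tr_marked\<close>, \<open>cls_marked\<close>).\<close>

definition rep_elt :: "int \<times> int \<Rightarrow> 'a" where
  "rep_elt v = (SOME g. (\<exists>h. marked g h) \<and> hvec g = v)"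

definition \<phi> :: "int \<times> int \<Rightarrow> complex" where "\<phi> v = tr (rep_elt v)"

definition cls :: "int \<times> int \<Rightarrow> 'a set" where "cls v = curve_rel G `` {rep_elt v}"

lemma rep_elt:
  assumes "primitive v"
  shows "\<exists>h. marked (rep_elt v) h" "hvec (rep_elt v) = v" "rep_elt v \<in> carrier G"
proof -
  obtain w where "vdet v w = 1" using ex_vdet_eq_1[OF assms] by blast
  then obtain g h where "marked g h" "hvec g = v" using ex_marked by blast
  then have "\<exists>g. (\<exists>h. marked g h) \<and> hvec g = v" by blast
  from someI_ex[OF this] show "\<exists>h. marked (rep_elt v) h" "hvec (rep_elt v) = v"
    unfolding rep_elt_def by blast+
  then show "rep_elt v \<in> carrier G" using marked_carrier by blast
qed

lemma marked_primitive: "marked g h \<Longrightarrow> primitive (hvec g)"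
  using marked_vdet[of g h] primitive_if_vdet[of "hvec g" "hvec h"] by simp

lemma marked_rep_elt:
  assumes "marked g h" obtains k where "k \<in> carrier G" "g = k \<otimes> rep_elt (hvec g) \<otimes> inv k"
proof -
  note r = rep_elt[OF marked_primitive[OF assms]]
  obtain h' where "marked (rep_elt (hvec g)) h'" using r by blast
  then show ?thesis using marked_conjugate[OF _ assms] r(2) that by blast
qed

lemma tr_marked: "marked g h \<Longrightarrow> tr g = \<phi> (hvec g)"
  using tr_conj rep_elt(3)[OF marked_primitive] marked_rep_elt unfolding \<phi>_def by metis

lemma cls_marked:
  assumes "marked g h" shows "cls (hvec g) = curve_rel G `` {g}"
proof -
  obtain k where k: "k \<in> carrier G" "g = k \<otimes> rep_elt (hvec g) \<otimes> inv k" using marked_rep_elt[OF assms] by blast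
  have "(g, rep_elt (hvec g)) \<in> curve_rel G"
    using k rep_elt(3)[OF marked_primitive[OF assms]] marked_carrier[OF assms] by (auto simp: curve_rel_def)
  then show ?thesis unfolding cls_def using equiv_class_eq[OF equiv_curve_rel[OF group_axioms]] by metis
qed

lemma minus_\<phi>: "primitive v \<Longrightarrow> \<phi> (- v) = \<phi> v"
proof -
  assume p: "primitive v"
  obtain h where h: "marked (rep_elt v) h" using rep_elt[OF p] by blast
  have "tr (inv (rep_elt v)) = \<phi> (- v)"
    using tr_marked[OF marked_moves(2)[OF h]] rep_elt[OF p] by (simp add: hvec_inv)
  then show ?thesis using rep_elt(3)[OF p] by (simp add: tr_inv \<phi>_def)
qed

lemma cls_minus: "primitive v \<Longrightarrow> cls (- v) = cls v"
proof -
  assume p: "primitive v"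
  obtain h where h: "marked (rep_elt v) h" using rep_elt[OF p] by blast
  note c = rep_elt(3)[OF p]
  have "cls (- v) = curve_rel G `` {inv (rep_elt v)}"
    using cls_marked[OF marked_moves(2)[OF h]] rep_elt[OF p] by (simp add: hvec_inv)
  moreover have "(inv (rep_elt v), rep_elt v) \<in> curve_rel G"
    using c by (auto simp: curve_rel_def intro!: bexI[of _ \<one>])
  ultimately show ?thesis unfolding cls_def using equiv_class_eq[OF equiv_curve_rel[OF group_axioms]] by metis
qed

lemma hvec_curve_rel: "(g, h) \<in> curve_rel G \<Longrightarrow> same_up_to_sign (hvec g) (hvec h)"
  by (auto simp: curve_rel_def hvec_conj hvec_inv same_up_to_sign_def)

lemma cls_eqD:
  assumes "primitive v" "primitive w" "cls v = cls w" shows "same_up_to_sign v w"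
proof -
  have "(rep_elt v, rep_elt w) \<in> curve_rel G"
    using assms rep_elt(3) eq_equiv_class[OF _ equiv_curve_rel[OF group_axioms]] unfolding cls_def by metis
  from hvec_curve_rel[OF this] show ?thesis using rep_elt(2) assms by simp
qed

lemma same_up_to_sign_cls: "primitive v \<Longrightarrow> same_up_to_sign v w \<Longrightarrow> cls w = cls v"
  by (auto simp: same_up_to_sign_def cls_minus)

lemma rep_elt_in_cls: "primitive v \<Longrightarrow> rep_elt v \<in> cls v"
  unfolding cls_def using rep_elt(3) equiv_class_self[OF equiv_curve_rel[OF group_axioms]] by blast

lemma cls_carrier: "x \<in> cls v \<Longrightarrow> x \<in> carrier G"
  by (auto simp: cls_def curve_rel_def)

lemma curve_classes_eq: "curve_classes G = cls ` {v. primitive v}"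
proof (intro equalityI subsetI)
  fix C assume C: "C \<in> curve_classes G"
  then obtain g X where g: "C \<in> carrier G // curve_rel G" "g \<in> C" "free_basis G X" "g \<in> X"
    by (auto simp: curve_classes_def)
  then obtain h where h: "marked g h" using ex_marked_if_free_basis by blast
  have "C = curve_rel G `` {g}"
    using g(1,2) equiv_curve_rel[OF group_axioms] by (metis Image_singleton_iff equiv_class_eq quotientE)
  then show "C \<in> cls ` {v. primitive v}" using cls_marked[OF h] marked_primitive[OF h] by auto
next
  fix C assume "C \<in> cls ` {v. primitive v}"
  then obtain v where v: "primitive v" "C = cls v" by auto
  obtain h where h: "marked (rep_elt v) h" using rep_elt[OF v(1)] by blast
  have "C \<in> carrier G // curve_rel G" unfolding v(2) cls_def using rep_elt(3)[OF v(1)] by (rule quotientI)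
  moreover have "rep_elt v \<in> C" using rep_elt_in_cls[OF v(1)] v(2) by simp
  ultimately show "C \<in> curve_classes G" using marked_free_basis[OF h] by (auto simp: curve_classes_def)
qed

lemma tr_f: "g \<in> carrier G \<Longrightarrow> tr (f g) = tr g"
proof -
  assume g: "g \<in> carrier G"
  then obtain P where "P \<in> carrier SL2C" "\<rho> (f g) = P \<otimes>\<^bsub>SL2C\<^esub> \<rho> g \<otimes>\<^bsub>SL2C\<^esub> inv\<^bsub>SL2C\<^esub> P"
    using stab unfolding stabilized_by_def conjugate_reps_def by blast
  then show "tr (f g) = tr g" using \<rho>_closed[OF g] by (simp add: tr_def trace_conj_SL2C)
qed

lemma f_auto: "f \<in> auto G"
  using ind by (simp add: induced_by_def)

lemma autoD: "h \<in> auto G \<Longrightarrow> h \<in> hom G G \<and> bij_betw h (carrier G) (carrier G)"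
  by (simp add: auto_def Bij_def)

lemma auto_closed: "h \<in> auto G \<Longrightarrow> g \<in> carrier G \<Longrightarrow> h g \<in> carrier G"
  by (auto simp: auto_def hom_def)

lemma auto_marked:
  assumes h: "h \<in> auto G" and p: "primitive v" shows "\<exists>y. marked (h (rep_elt v)) y"
proof -
  obtain x where x: "marked (rep_elt v) x" using rep_elt[OF p] by blast
  have "free_basis G (h ` {rep_elt v, x})"
    using free_basis_image[OF _ _ marked_free_basis[OF x]] autoD[OF h] by blast
  then show ?thesis by (rule ex_marked_if_free_basis) simp
qed

lemma auto_cls:
  assumes h: "h \<in> auto G" and p: "primitive v"
  shows "h ` cls v = cls (hvec (h (rep_elt v)))" "primitive (hvec (h (rep_elt v)))"
proof -
  obtain x where x: "marked (h (rep_elt v)) x" using auto_marked[OF h p] by blast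
  show "primitive (hvec (h (rep_elt v)))" by (rule marked_primitive[OF x])
  show "h ` cls v = cls (hvec (h (rep_elt v)))"
    unfolding cls_marked[OF x] cls_def[of v] using curve_rel_image[OF _ _ rep_elt(3)[OF p]] autoD[OF h] by blast
qed

lemma hvec_f: "g \<in> carrier G \<Longrightarrow> hvec (f g) = mact H (hvec g)"
  by (rule hvec_induced[OF ind])

lemma \<phi>_mact: "primitive v \<Longrightarrow> \<phi> (mact H v) = \<phi> v"
proof -
  assume p: "primitive v"
  obtain x where x: "marked (f (rep_elt v)) x" using auto_marked[OF f_auto p] by blast
  have "\<phi> (mact H v) = tr (f (rep_elt v))" using tr_marked[OF x] hvec_f rep_elt[OF p] by simp
  then show ?thesis using tr_f rep_elt(3)[OF p] by (simp add: \<phi>_def)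
qed

section \<open>Orbits under the group generated by \<open>f\<close>\<close>

abbreviation A where "A \<equiv> AutoGroup G"

definition fgen where "fgen = generate A {f}"

lemma A_group: "group A" by (rule AutoGroup)

lemma carrier_A: "carrier A = auto G" by (simp add: AutoGroup_def)

lemma A_mult: "k \<in> auto G \<Longrightarrow> l \<in> auto G \<Longrightarrow> g \<in> carrier G \<Longrightarrow> (k \<otimes>\<^bsub>A\<^esub> l) g = k (l g)"
  by (simp add: AutoGroup_def BijGroup_def auto_def compose_def)

lemma A_one: "g \<in> carrier G \<Longrightarrow> \<one>\<^bsub>A\<^esub> g = g"
  by (simp add: AutoGroup_def BijGroup_def)

lemma fgen_auto: "h \<in> fgen \<Longrightarrow> h \<in> auto G"
  using group.generate_in_carrier[OF A_group, of "{f}" h] f_auto carrier_A by (auto simp: fgen_def)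

lemma A_inv: "k \<in> auto G \<Longrightarrow> inv\<^bsub>A\<^esub> k \<in> auto G"
  using group.inv_closed[OF A_group, of k] by (simp add: carrier_A)

lemma A_r_inv: "k \<in> auto G \<Longrightarrow> g \<in> carrier G \<Longrightarrow> k ((inv\<^bsub>A\<^esub> k) g) = g"
  using A_mult[of k "inv\<^bsub>A\<^esub> k" g] group.r_inv[OF A_group, of k] by (simp add: A_inv carrier_A A_one)

lemma A_l_inv: "k \<in> auto G \<Longrightarrow> g \<in> carrier G \<Longrightarrow> (inv\<^bsub>A\<^esub> k) (k g) = g"
  using A_mult[of "inv\<^bsub>A\<^esub> k" k g] group.l_inv[OF A_group, of k] by (simp add: A_inv carrier_A A_one)

text \<open>An element of the cyclic group acts on homology by an integral power of
  \<open>H\<close>, and \<open>n\<close> and \<open>m\<close> record its negative and positive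
  parts. Powers of \<open>H\<close> commute, so the exponents add under composition.\<close>

lemma hvec_fgen: "h \<in> fgen \<Longrightarrow> \<exists>n m. \<forall>g\<in>carrier G. (mact H ^^ n) (hvec (h g)) = (mact H ^^ m) (hvec g)"
  unfolding fgen_def
proof (induction rule: generate.induct)
  case one
  show ?case by (rule exI[of _ 0], rule exI[of _ 0]) (simp add: A_one)
next
  case (incl h)
  then show ?case using hvec_f by (intro exI[of _ 0] exI[of _ 1]) simp
next
  case (inv h)
  then have "hvec g = mact H (hvec ((inv\<^bsub>A\<^esub> f) g))" if "g \<in> carrier G" for g
    using hvec_f[OF auto_closed[OF A_inv[OF f_auto] that]] A_r_inv[OF f_auto that] by simp
  then show ?case using inv by (intro exI[of _ 1] exI[of _ 0]) simp
next
  case (eng h1 h2)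
  then obtain n1 m1 n2 m2 where
    1: "\<And>g. g \<in> carrier G \<Longrightarrow> (mact H ^^ n1) (hvec (h1 g)) = (mact H ^^ m1) (hvec g)"
    and 2: "\<And>g. g \<in> carrier G \<Longrightarrow> (mact H ^^ n2) (hvec (h2 g)) = (mact H ^^ m2) (hvec g)" by blast
  have h: "h1 \<in> auto G" "h2 \<in> auto G" using eng.hyps fgen_auto by (auto simp: fgen_def)
  have "(mact H ^^ (n2 + n1)) (hvec ((h1 \<otimes>\<^bsub>A\<^esub> h2) g)) = (mact H ^^ (m1 + m2)) (hvec g)"
    if g: "g \<in> carrier G" for g
  proof -
    have "(mact H ^^ (n2 + n1)) (hvec ((h1 \<otimes>\<^bsub>A\<^esub> h2) g)) = (mact H ^^ n2) ((mact H ^^ m1) (hvec (h2 g)))"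
      using 1[OF auto_closed[OF h(2) g]] A_mult[OF h g] by (simp add: funpow_add)
    also have "\<dots> = (mact H ^^ m1) ((mact H ^^ n2) (hvec (h2 g)))"
      by (metis add.commute comp_apply funpow_add)
    finally show ?thesis using 2[OF g] by (simp add: funpow_add)
  qed
  then show ?case by blast
qed

lemma fgen_power: "\<exists>h\<in>fgen. \<forall>g\<in>carrier G. hvec (h g) = (mact H ^^ n) (hvec g)"
proof (induction n)
  case 0
  show ?case by (rule bexI[of _ "\<one>\<^bsub>A\<^esub>"]) (auto simp: A_one fgen_def intro: generate.one)
next
  case (Suc n)
  then obtain h where h: "h \<in> fgen" "\<forall>g\<in>carrier G. hvec (h g) = (mact H ^^ n) (hvec g)" by blast
  have "f \<otimes>\<^bsub>A\<^esub> h \<in> fgen" using h(1) unfolding fgen_def by (intro generate.eng generate.incl[of f "{f}" A]) auto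
  moreover have "hvec ((f \<otimes>\<^bsub>A\<^esub> h) g) = (mact H ^^ Suc n) (hvec g)" if "g \<in> carrier G" for g
    using h that hvec_f auto_closed[OF fgen_auto[OF h(1)]] A_mult[OF f_auto fgen_auto[OF h(1)]] by simp
  ultimately show ?case by blast
qed

definition orb :: "int \<times> int \<Rightarrow> 'a set set" where "orb v = {h ` cls v | h. h \<in> fgen}"

lemma curve_orbits_eq: "curve_orbits G f = orb ` {v. primitive v}"
proof -
  have "carrier (subgroup_generated A {f}) = fgen"
    using f_auto by (simp add: fgen_def carrier_subgroup_generated carrier_A)
  then show ?thesis
    unfolding curve_orbits_def orbits_def orbit_def curve_classes_eq orb_def by auto
qed

lemma cls_in_orb: "cls v \<in> orb v"
proof -
  have "\<one>\<^bsub>A\<^esub> \<in> fgen" unfolding fgen_def by (rule generate.one)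
  moreover have "\<one>\<^bsub>A\<^esub> ` cls v = cls v" by (simp add: A_one cls_carrier)
  ultimately show ?thesis unfolding orb_def by auto
qed

lemma orb_shift:
  assumes p: "primitive v" shows "orb ((mact H ^^ n) v) = orb v"
proof -
  obtain k where k: "k \<in> fgen" "\<forall>g\<in>carrier G. hvec (k g) = (mact H ^^ n) (hvec g)" using fgen_power by blast
  note ka = fgen_auto[OF k(1)]
  have kc: "k ` cls v = cls ((mact H ^^ n) v)" using auto_cls(1)[OF ka p] k(2) rep_elt[OF p] by simp
  have "h ` cls ((mact H ^^ n) v) \<in> orb v" if "h \<in> fgen" for h
  proof -
    have "h \<otimes>\<^bsub>A\<^esub> k \<in> fgen" using that k(1) unfolding fgen_def by (rule generate.eng)
    moreover have "h ` cls ((mact H ^^ n) v) = (h \<otimes>\<^bsub>A\<^esub> k) ` cls v"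
      unfolding kc[symmetric] image_image by (rule image_cong) (simp_all add: A_mult[OF fgen_auto[OF that] ka] cls_carrier)
    ultimately show ?thesis unfolding orb_def by blast
  qed
  moreover have "h ` cls v \<in> orb ((mact H ^^ n) v)" if "h \<in> fgen" for h
  proof -
    have i: "inv\<^bsub>A\<^esub> k \<in> fgen"
      using group.generate_m_inv_closed[OF A_group, of "{f}" k] k(1) f_auto carrier_A by (simp add: fgen_def)
    then have "h \<otimes>\<^bsub>A\<^esub> inv\<^bsub>A\<^esub> k \<in> fgen" using that unfolding fgen_def by (intro generate.eng)
    moreover have "(h \<otimes>\<^bsub>A\<^esub> inv\<^bsub>A\<^esub> k) ` cls ((mact H ^^ n) v) = h ` cls v"
      unfolding kc[symmetric] image_image
      by (rule image_cong)
        (simp_all add: A_mult[OF fgen_auto[OF that] A_inv[OF ka]] auto_closed[OF ka] A_l_inv[OF ka] cls_carrier)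
    ultimately show ?thesis unfolding orb_def by blast
  qed
  ultimately show ?thesis unfolding orb_def by blast
qed

text \<open>A class determines its vector up to sign, and the group generated by \<open>f\<close>
  acts on vectors through powers of \<open>H\<close>; orbits of curves are thus the classes of
  \<open>orbit_rel\<close> on primitive vectors.\<close>

lemma orb_eq_iff:
  assumes p: "primitive v" "primitive w" shows "orb v = orb w \<longleftrightarrow> orbit_rel H v w"
proof
  assume "orbit_rel H v w"
  then obtain n m where nm: "same_up_to_sign ((mact H ^^ n) v) ((mact H ^^ m) w)" by (auto simp: orbit_rel_def)
  then have "cls ((mact H ^^ m) w) = cls ((mact H ^^ n) v)"
    using same_up_to_sign_cls primitive_funpow_mact[OF det_H p(1)] by blast
  then have "orb ((mact H ^^ n) v) = orb ((mact H ^^ m) w)" by (simp add: orb_def)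
  then show "orb v = orb w" using orb_shift p by simp
next
  assume "orb v = orb w"
  then have "cls v \<in> orb w" using cls_in_orb by blast
  then obtain h where h: "h \<in> fgen" "cls v = h ` cls w" by (auto simp: orb_def)
  obtain n m where nm: "\<forall>g\<in>carrier G. (mact H ^^ n) (hvec (h g)) = (mact H ^^ m) (hvec g)" using hvec_fgen[OF h(1)] by blast
  note c = auto_cls[OF fgen_auto[OF h(1)] p(2)]
  have "same_up_to_sign v (hvec (h (rep_elt w)))" using cls_eqD[OF p(1) c(2)] h(2) c(1) by simp
  then have "same_up_to_sign ((mact H ^^ n) v) ((mact H ^^ n) (hvec (h (rep_elt w))))"
    by (auto simp: same_up_to_sign_def)
  then have "same_up_to_sign ((mact H ^^ n) v) ((mact H ^^ m) w)" using nm rep_elt[OF p(2)] by simp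
  then show "orbit_rel H v w" by (auto simp: orbit_rel_def)
qed

lemma orbit_trace_orb:
  assumes "primitive v" shows "orbit_trace \<rho> (orb v) = \<phi> v"
proof -
  have "orb v \<in> curve_orbits G f" using assms by (simp add: curve_orbits_eq)
  from orbit_trace_eq[OF group_axioms f_auto \<rho>_hom stab this cls_in_orb rep_elt_in_cls[OF assms]]
  show ?thesis by (simp add: \<phi>_def tr_def)
qed

lemma markoff:
  assumes "E \<noteq> 0" "E + 1 / E = - \<tau>" shows "markoff_map \<phi> E"
proof
  show "E \<noteq> 0" by fact
  show "E \<noteq> -1"
  proof
    assume "E = -1"
    then have "\<tau> = 2" using assms(2) by simp
    then show False using \<tau>_neq_2 by simp
  qed
  show "\<And>v. primitive v \<Longrightarrow> \<phi> (- v) = \<phi> v" by (rule minus_\<phi>)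
  fix v w :: "int \<times> int"
  show "\<phi> v \<notin> complex_of_real ` {-2..2}" if "primitive v"
  proof -
    have "orb v \<in> curve_orbits G f" using that by (simp add: curve_orbits_eq)
    then show ?thesis using BQ orbit_trace_orb[OF that] unfolding BQ_conditions_def by metis
  qed
  assume d: "vdet v w = 1"
  obtain g h where m: "marked g h" and gh: "hvec g = v" "hvec h = w" using ex_marked[OF d] by blast
  have c: "g \<in> carrier G" "h \<in> carrier G" using marked_carrier[OF m] by auto
  have x: "tr g = \<phi> v" using tr_marked[OF m] gh by simp
  have y: "tr h = \<phi> w" using tr_marked[OF marked_moves(1)[OF m]] gh by simp
  have z: "tr (g \<otimes> h) = \<phi> (v + w)" using tr_marked[OF marked_moves(5)[OF m]] gh c by (simp add: hvec_mult)
  have "marked (inv h \<otimes> g) h" using nielsen_shears(4)[of "(a, b)" g h] m c by (simp add: marked_def)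
  then have z': "tr (inv h \<otimes> g) = \<phi> (v - w)" using tr_marked gh c by (fastforce simp: hvec_simps)
  show "\<phi> (v + w) + \<phi> (v - w) = \<phi> v * \<phi> w"
    using tr_mult[OF c(2,1)] tr_commute[OF c] unfolding x y z z' by (simp add: mult.commute)
  have "\<tau> = - (E + 1 / E)" unfolding assms(2) by simp
  then show "(\<phi> v)\<^sup>2 + (\<phi> w)\<^sup>2 + (\<phi> (v + w))\<^sup>2 - \<phi> v * \<phi> w * \<phi> (v + w) = 2 - E - 1 / E"
    using fricke_marked[OF m] unfolding fricke_def by (simp add: x y z)
next
  \<comment> \<open>The value depends only on the orbit, so finitely many orbits give finitely many
    small values although each contains infinitely many vectors.\<close>
  have "{\<phi> v | v. primitive v \<and> cmod (\<phi> v) \<le> 2} \<subseteq>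
      orbit_trace \<rho> ` {X \<in> curve_orbits G f. cmod (orbit_trace \<rho> X) \<le> 2}"
  proof
    fix c assume "c \<in> {\<phi> v | v. primitive v \<and> cmod (\<phi> v) \<le> 2}"
    then obtain v where "primitive v" "cmod (\<phi> v) \<le> 2" "c = \<phi> v" by blast
    then show "c \<in> orbit_trace \<rho> ` {X \<in> curve_orbits G f. cmod (orbit_trace \<rho> X) \<le> 2}"
      using orbit_trace_orb[of v] by (intro image_eqI[of _ _ "orb v"]) (auto simp: curve_orbits_eq)
  qed
  then show "finite {\<phi> v | v. primitive v \<and> cmod (\<phi> v) \<le> 2}"
    using BQ finite_subset unfolding BQ_conditions_def by blast
qed

theorem sum_identity:
  "(\<lambda>X. norm (h_fun \<tau> (orbit_trace \<rho> X))) summable_on curve_orbits G f \<and>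
    (\<exists>k::int. (\<Sum>\<^sub>\<infinity>X\<in>curve_orbits G f. h_fun \<tau> (orbit_trace \<rho> X)) = of_int k * (2 * of_real pi * \<i>))"
proof -
  define \<nu> E where "\<nu> = Arcosh (- \<tau> / 2)" and "E = exp \<nu>"
  \<comment> \<open>The number \<open>E\<close> is \<open>eigen (- \<tau>)\<close>: the hyperbolic
    cosine of \<open>\<nu>\<close> is \<open>- \<tau> / 2\<close>.\<close>
  have E: "E \<noteq> 0" "E + 1 / E = - \<tau>"
    using eigen_add_inverse[of "- \<tau>"] by (auto simp: E_def \<nu>_def eigen_def)
  interpret M: markoff_map \<phi> E by (rule markoff[OF E])
  have hh: "h_fun \<tau> (\<phi> v) = M.h v" for v
    unfolding h_fun_def M.h_def M.F_def Let_def exp_trace_length \<nu>_def[symmetric] exp_minus E_def[symmetric]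
    by (simp add: inverse_eq_divide)
  obtain D where D: "\<And>u. u \<in> D \<Longrightarrow> primitive u"
    and rep: "\<And>u. primitive u \<Longrightarrow> \<exists>u'\<in>D. orbit_rel H u u'"
    and unique: "\<And>u u'. u \<in> D \<Longrightarrow> u' \<in> D \<Longrightarrow> orbit_rel H u u' \<Longrightarrow> u = u'"
    and sum: "finite {u \<in> D. cmod (\<phi> u) \<le> 2} \<Longrightarrow>
      (\<lambda>u. norm (M.h u)) summable_on D \<and> exp (infsum M.h D) = 1"
    using M.sum_over_orbits[OF det_H _ \<phi>_mact] hyp unfolding hyperbolic_def by blast
  have inj: "inj_on orb D"
    using orb_eq_iff D unique by (intro inj_onI) blast
  have img: "orb ` D = curve_orbits G f"
  proof (intro equalityI subsetI)
    fix X assume "X \<in> curve_orbits G f"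
    then obtain v where v: "primitive v" "X = orb v" by (auto simp: curve_orbits_eq)
    then obtain u where "u \<in> D" "orbit_rel H v u" using rep by blast
    then show "X \<in> orb ` D" using orb_eq_iff[OF v(1) D] v(2) by blast
  qed (use D curve_orbits_eq in auto)
  then have bij: "bij_betw orb D (curve_orbits G f)" using inj by (simp add: bij_betw_def)
  have "orb ` {u \<in> D. cmod (\<phi> u) \<le> 2} \<subseteq> {X \<in> curve_orbits G f. cmod (orbit_trace \<rho> X) \<le> 2}"
    using img D orbit_trace_orb by auto
  then have "finite (orb ` {u \<in> D. cmod (\<phi> u) \<le> 2})"
    using BQ finite_subset unfolding BQ_conditions_def by blast
  then have "finite {u \<in> D. cmod (\<phi> u) \<le> 2}"
    by (rule finite_imageD) (rule inj_on_subset[OF inj], auto)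
  from sum[OF this] have s: "(\<lambda>u. norm (M.h u)) summable_on D" "exp (infsum M.h D) = 1" by auto
  have e: "h_fun \<tau> (orbit_trace \<rho> (orb u)) = M.h u" if "u \<in> D" for u
    using orbit_trace_orb[OF D[OF that]] by (simp add: hh)
  have "(\<lambda>u. norm (h_fun \<tau> (orbit_trace \<rho> (orb u)))) summable_on D"
    using s(1) by (rule summable_on_cong[THEN iffD1, rotated]) (simp add: e)
  then have 1: "(\<lambda>X. norm (h_fun \<tau> (orbit_trace \<rho> X))) summable_on curve_orbits G f"
    using summable_on_reindex_bij_betw[OF bij, of "\<lambda>X. norm (h_fun \<tau> (orbit_trace \<rho> X))"] by simp
  have "(\<Sum>\<^sub>\<infinity>X\<in>curve_orbits G f. h_fun \<tau> (orbit_trace \<rho> X)) = (\<Sum>\<^sub>\<infinity>u\<in>D. h_fun \<tau> (orbit_trace \<rho> (orb u)))"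
    using infsum_reindex_bij_betw[OF bij, of "\<lambda>X. h_fun \<tau> (orbit_trace \<rho> X)"] by simp
  also have "\<dots> = infsum M.h D" by (rule infsum_cong) (rule e)
  finally have "exp (\<Sum>\<^sub>\<infinity>X\<in>curve_orbits G f. h_fun \<tau> (orbit_trace \<rho> X)) = 1" using s(2) by simp
  then obtain k :: int where "Re (\<Sum>\<^sub>\<infinity>X\<in>curve_orbits G f. h_fun \<tau> (orbit_trace \<rho> X)) = 0"
    "Im (\<Sum>\<^sub>\<infinity>X\<in>curve_orbits G f. h_fun \<tau> (orbit_trace \<rho> X)) = of_int (2 * k) * pi"
    by (auto simp: exp_eq_1)
  then have "(\<Sum>\<^sub>\<infinity>X\<in>curve_orbits G f. h_fun \<tau> (orbit_trace \<rho> X)) = of_int k * (2 * of_real pi * \<i>)"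
    by (simp add: complex_eq_iff)
  then show ?thesis using 1 by blast
qed

end

theorem theorem2p5:
  fixes \<Gamma> :: "('g, 'm) monoid_scheme" and a b :: 'g
    and \<tau> :: complex and \<rho> :: "'g \<Rightarrow> complex ^ 2 ^ 2"
    and H :: "int ^ 2 ^ 2" and f :: "'g \<Rightarrow> 'g"
  assumes "group \<Gamma>" and "free_basis \<Gamma> {a, b}" and "a \<noteq> b"
    and "\<tau> \<noteq> 2"
    and "tau_rep \<Gamma> a b \<tau> \<rho>"
    and "det H = 1" and "hyperbolic H"
    and "induced_by \<Gamma> a b H f"
    and "stabilized_by \<Gamma> \<rho> f"
    and "BQ_conditions \<Gamma> f \<rho>"
  shows "(\<lambda>X. norm (h_fun \<tau> (orbit_trace \<rho> X))) summable_on curve_orbits \<Gamma> f \<and>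
    (\<exists>k::int. (\<Sum>\<^sub>\<infinity>X\<in>curve_orbits \<Gamma> f. h_fun \<tau> (orbit_trace \<rho> X)) = of_int k * (2 * of_real pi * \<i>))"
proof -
  interpret stabilized_rep \<Gamma> a b \<rho> \<tau> H f
    using assms by (simp add: stabilized_rep_def stabilized_rep_axioms_def rank_two_def rank_two_axioms_def)
  show ?thesis by (rule sum_identity)
qed

end
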